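(* Let $f$ be a real-valued real analytic (respectively smooth) function of finite type defined near the origin in $\mathbb{R}^2$, with $f(0,0)=0$ and $\nabla f(0,0)=0$. Assume that the given coordinates $(x_1,x_2)$ are not adapted to $f$. Then all of the following conditions hold true: (a) The principal face $\pi(f)$ of the Newton polyhedron is a compact edge. It thus lies on a uniquely determined line $\kappa_1t_1+\kappa_2t_2=1$ with $\kappa_1,\kappa_2>0$; interchanging the coordinates $x_1,x_2$ if necessary, we assume that $\kappa_1\le\kappa_2$. (b) $\kappa_2/\kappa_1\in\mathbb{N}$. (c) Any root of $f_p$ of maximal order $m(f_p)$ on the unit circle $S^1$ (i.e. any point of $S^1$ at which $f_p$ vanishes to order $m(f_p)$) lies away from the coordinate axes, and $m(f_p)>d(f)$. In particular, there exists a unique non-trivial (i.e. non-zero) real root $a$ of the polynomial $x_2\mapsto f_p(1,x_2)$ with multiplicity $n_a=m(f_p)>d(f)$. Moreover, in this case, if we put $m:=\kappa_2/\kappa_1\in\mathbb{N}$, then a coordinate system adapted to the principal part $f_p$ of $f$ is defined by $y_1:=x_1$, $y_2:=x_2-ax_1^m$, and the height of $f_p$ is given by $h(f_p)=m(f_p)$. Conversely, if all of the conditions (a)–(c) are satisfied by $f$, then the given coordinates $(x_1,x_2)$ are not adapted to the principal part $f_p$ of $f$.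
   Context: Here $\mathbb{N}=\{0,1,2,\dots\}$ and $\mathbb{R}_+=[0,\infty)$. For a smooth real-valued $f$ near the origin with Taylor series $\sum_{j,k}c_{jk}x_1^jx_2^k$ at the origin, the Taylor support is $\mathcal{T}(f)=\{(j,k)\in\mathbb{N}^2:c_{jk}\neq0\}$; $f$ is of finite type (at the origin) if $\mathcal{T}(f)\neq\emptyset$ (for real analytic $f$: $f\not\equiv0$). The Newton polyhedron $\mathcal{N}(f)$ is the convex hull of the union of all quadrants $(j,k)+\mathbb{R}_+^2$, $(j,k)\in\mathcal{T}(f)$, in the plane with coordinates $(t_1,t_2)$. A face is an edge (possibly unbounded) or a vertex. The distance $d(f)$ is the number $d$ such that $(d,d)$ is the point where the bisectrix $t_1=t_2$ intersects the boundary of $\mathcal{N}(f)$. The principal face $\pi(f)$ is the face of minimal dimension containing $(d,d)$. The principal part of $f$ is $f_p(x_1,x_2)=\sum_{(j,k)\in\pi(f)}c_{jk}x_1^jx_2^k$ (a polynomial if $\pi(f)$ is compact). A local analytic (respectively smooth) coordinate system $y$ at the origin is given by $x=\varphi(y)$ with $\varphi$ an analytic (respectively smooth) local diffeomorphism near $0$ with $\varphi(0)=0$; in it $f$ is expressed as $f\circ\varphi$, and $d_y:=d(f\circ\varphi)$. The height is $h(f):=\sup d_y$, the supremum over all local analytic (respectively smooth) coordinate systems $y$ at the origin. The coordinate system $y$ is adapted to $f$ if $d_y=h(f)$; in particular the given coordinates are adapted to $f$ if $d(f)=h(f)$. The same definitions apply to $f_p$. A polynomial $P$ is mixed homogeneous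 if for some $\kappa_1,\kappa_2>0$ and some $b$ one has $P(r^{\kappa_1}x_1,r^{\kappa_2}x_2)=r^bP(x_1,x_2)$ for all $r>0$. For such $P$, $m(P)$ denotes the maximal order of vanishing of $P$ along the unit circle $S^1$ centered at the origin. *)

theory Defs
  imports "HOL-Analysis.Analysis" "HOL-Computational_Algebra.Polynomial"
begin

section \<open>Smooth and real analytic maps on the plane\<close>

primrec cont_diff_on ::
  "nat \<Rightarrow> 'a::real_normed_vector set \<Rightarrow> ('a \<Rightarrow> 'b::real_normed_vector) \<Rightarrow> bool" where
  "cont_diff_on 0 S f \<longleftrightarrow> continuous_on S f"
| "cont_diff_on (Suc n) S f \<longleftrightarrow>
     (\<forall>x\<in>S. f differentiable (at x)) \<and>
     (\<forall>v. cont_diff_on n S (\<lambda>x. frechet_derivative f (at x) v))"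

definition smooth_on :: "'a::real_normed_vector set \<Rightarrow> ('a \<Rightarrow> 'b::real_normed_vector) \<Rightarrow> bool" where
  "smooth_on S f \<longleftrightarrow> (\<forall>n. cont_diff_on n S f)"

definition real_analytic_on :: "(real \<times> real) set \<Rightarrow> (real \<times> real \<Rightarrow> 'b::real_normed_vector) \<Rightarrow> bool" where
  "real_analytic_on S f \<longleftrightarrow>
     (\<forall>p\<in>S. \<exists>c. \<exists>\<epsilon>>0. \<forall>h. norm h < \<epsilon> \<longrightarrow>
        ((\<lambda>(j, k). (fst h ^ j * snd h ^ k) *\<^sub>R c j k) has_sum f (p + h)) (UNIV :: (nat \<times> nat) set))"

text \<open>The category in which functions and coordinate changes live; it lets one statement
  cover the real analytic and the smooth case.\<close>

datatype regularity = Analytic | Smooth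

definition regular_on ::
  "regularity \<Rightarrow> (real \<times> real) set \<Rightarrow> (real \<times> real \<Rightarrow> 'b::real_normed_vector) \<Rightarrow> bool" where
  "regular_on r S f \<longleftrightarrow>
     (case r of Analytic \<Rightarrow> real_analytic_on S f | Smooth \<Rightarrow> smooth_on S f)"

section \<open>Taylor support and Newton polyhedron\<close>

definition partial_deriv :: "nat \<Rightarrow> nat \<Rightarrow> (real \<times> real \<Rightarrow> real) \<Rightarrow> real \<times> real \<Rightarrow> real" where
  "partial_deriv j k f =
     ((\<lambda>g x. frechet_derivative g (at x) (1, 0)) ^^ j)
       (((\<lambda>g x. frechet_derivative g (at x) (0, 1)) ^^ k) f)"

definition taylor_coeff :: "(real \<times> real \<Rightarrow> real) \<Rightarrow> real \<times> real \<Rightarrow> nat \<Rightarrow> nat \<Rightarrow> real" where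
  "taylor_coeff f p j k = partial_deriv j k f p / (fact j * fact k)"

definition taylor_support :: "(real \<times> real \<Rightarrow> real) \<Rightarrow> (nat \<times> nat) set" where
  "taylor_support f = {(j, k). taylor_coeff f 0 j k \<noteq> 0}"

definition finite_type :: "(real \<times> real \<Rightarrow> real) \<Rightarrow> bool" where
  "finite_type f \<longleftrightarrow> taylor_support f \<noteq> {}"

definition newton_polyhedron :: "(real \<times> real \<Rightarrow> real) \<Rightarrow> (real \<times> real) set" where
  "newton_polyhedron f =
     convex hull (\<Union>(j, k)\<in>taylor_support f. {(t1, t2). real j \<le> t1 \<and> real k \<le> t2})"

definition newton_distance :: "(real \<times> real \<Rightarrow> real) \<Rightarrow> real" where
  "newton_distance f = (THE d. (d, d) \<in> frontier (newton_polyhedron f))"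

text \<open>Only vertices and edges count as faces: neither the empty set nor the whole polyhedron,
  which are faces in the sense of \<^const>\<open>face_of\<close>, is admitted.\<close>

definition newton_face :: "(real \<times> real \<Rightarrow> real) \<Rightarrow> (real \<times> real) set \<Rightarrow> bool" where
  "newton_face f F \<longleftrightarrow>
     F edge_of newton_polyhedron f \<or> (\<exists>v. v extreme_point_of newton_polyhedron f \<and> F = {v})"

definition principal_face :: "(real \<times> real \<Rightarrow> real) \<Rightarrow> (real \<times> real) set" where
  "principal_face f =
     (THE F. is_arg_min aff_dim
        (\<lambda>G. newton_face f G \<and> (newton_distance f, newton_distance f) \<in> G) F)"

text \<open>The sum is finite, and the principal part a polynomial, if the principal face is compact.
  Otherwise it need not converge, and is then 0 by the convention of \<^const>\<open>infsum\<close>.\<close>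

definition principal_part :: "(real \<times> real \<Rightarrow> real) \<Rightarrow> real \<times> real \<Rightarrow> real" where
  "principal_part f x =
     (\<Sum>\<^sub>\<infinity>(j, k)\<in>{(j, k). (real j, real k) \<in> principal_face f}.
        taylor_coeff f 0 j k * fst x ^ j * snd x ^ k)"

definition principal_line :: "(real \<times> real \<Rightarrow> real) \<Rightarrow> real \<Rightarrow> real \<Rightarrow> bool" where
  "principal_line f \<kappa>1 \<kappa>2 \<longleftrightarrow>
     0 < \<kappa>1 \<and> 0 < \<kappa>2 \<and> principal_face f \<subseteq> {(t1, t2). \<kappa>1 * t1 + \<kappa>2 * t2 = 1}"

section \<open>Height and adapted coordinates\<close>

text \<open>A local coordinate system \<open>y\<close> is given by the map \<open>\<phi>\<close> with \<open>x = \<phi> y\<close>.  Only the germ of \<open>\<phi>\<close>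
  at the origin matters; its values away from the origin are unconstrained.\<close>

definition coordinate_system :: "regularity \<Rightarrow> (real \<times> real \<Rightarrow> real \<times> real) \<Rightarrow> bool" where
  "coordinate_system r \<phi> \<longleftrightarrow>
     \<phi> 0 = 0 \<and>
     (\<exists>U V \<psi>. open U \<and> open V \<and> 0 \<in> U \<and> homeomorphism U V \<phi> \<psi> \<and>
        regular_on r U \<phi> \<and> regular_on r V \<psi>)"

text \<open>For \<open>f\<close> of finite type the set of distances is bounded above, by the order of vanishing
  of \<open>f\<close> at the origin, so the real supremum is meaningful.\<close>

definition height :: "regularity \<Rightarrow> (real \<times> real \<Rightarrow> real) \<Rightarrow> real" where
  "height r f = (SUP \<phi>\<in>{\<phi>. coordinate_system r \<phi>}. newton_distance (f \<circ> \<phi>))"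

definition adapted_system ::
  "regularity \<Rightarrow> (real \<times> real \<Rightarrow> real \<times> real) \<Rightarrow> (real \<times> real \<Rightarrow> real) \<Rightarrow> bool" where
  "adapted_system r \<phi> f \<longleftrightarrow> coordinate_system r \<phi> \<and> newton_distance (f \<circ> \<phi>) = height r f"

definition adapted :: "regularity \<Rightarrow> (real \<times> real \<Rightarrow> real) \<Rightarrow> bool" where
  "adapted r f \<longleftrightarrow> newton_distance f = height r f"

section \<open>Roots of the principal part\<close>

text \<open>The order of vanishing at a point is that of a function of two variables.  For a nonzero
  mixed homogeneous polynomial and a point of the unit circle, it agrees with the order of
  vanishing of the restriction to the circle, since the orbits of the dilations are transversal
  to the circle.\<close>

definition vanishing_order :: "(real \<times> real \<Rightarrow> real) \<Rightarrow> real \<times> real \<Rightarrow> nat" where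
  "vanishing_order P p = (LEAST n. \<exists>j k. j + k = n \<and> taylor_coeff P p j k \<noteq> 0)"

definition max_order_on_circle :: "(real \<times> real \<Rightarrow> real) \<Rightarrow> nat" where
  "max_order_on_circle P = (SUP p\<in>sphere 0 1. vanishing_order P p)"

definition slice_poly :: "(real \<times> real \<Rightarrow> real) \<Rightarrow> real poly" where
  "slice_poly P = (THE q. poly q = (\<lambda>t. P (1, t)))"

definition nontrivial_max_root :: "(real \<times> real \<Rightarrow> real) \<Rightarrow> real \<Rightarrow> bool" where
  "nontrivial_max_root P a \<longleftrightarrow>
     a \<noteq> 0 \<and> poly (slice_poly P) a = 0 \<and> order a (slice_poly P) = max_order_on_circle P"

section \<open>The three conditions\<close>

definition condition_a :: "(real \<times> real \<Rightarrow> real) \<Rightarrow> bool" where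
  "condition_a f \<longleftrightarrow>
     principal_face f edge_of newton_polyhedron f \<and> compact (principal_face f)"

text \<open>Interchanging the coordinates if necessary: \<open>g\<close> is \<open>f\<close> in the given or in the interchanged
  coordinates, with \<open>\<kappa>1 \<le> \<kappa>2\<close> for \<open>g\<close>.  If \<open>\<kappa>1 = \<kappa>2\<close>, both choices of \<open>g\<close> qualify.\<close>

definition normalization ::
  "(real \<times> real \<Rightarrow> real) \<Rightarrow> (real \<times> real \<Rightarrow> real) \<Rightarrow> real \<Rightarrow> real \<Rightarrow> bool" where
  "normalization f g \<kappa>1 \<kappa>2 \<longleftrightarrow>
     (g = f \<or> g = f \<circ> prod.swap) \<and> principal_line g \<kappa>1 \<kappa>2 \<and> \<kappa>1 \<le> \<kappa>2"

definition condition_b :: "real \<Rightarrow> real \<Rightarrow> bool" where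
  "condition_b \<kappa>1 \<kappa>2 \<longleftrightarrow> \<kappa>2 / \<kappa>1 \<in> \<nat>"

definition condition_c :: "(real \<times> real \<Rightarrow> real) \<Rightarrow> bool" where
  "condition_c g \<longleftrightarrow>
     (\<forall>p\<in>sphere 0 1.
        vanishing_order (principal_part g) p = max_order_on_circle (principal_part g) \<longrightarrow>
        fst p \<noteq> 0 \<and> snd p \<noteq> 0) \<and>
     real (max_order_on_circle (principal_part g)) > newton_distance g"

end

theory Submission
  imports Defs "HOL-Library.Landau_Symbols"
begin

text \<open>The Newton distance is governed by weights.  For \<open>m \<ge> 1\<close> put
  \<open>D\<^sub>r(x) = (r x\<^sub>1, r\<^sup>m x\<^sub>2)\<close>.  Every such weight, and every weight with the two coordinates
  interchanged, has a point \<open>(j, k)\<close> of the Taylor support with \<open>j + m k \<le> d(f) (1 + m)\<close>; and if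
  \<open>D < d(f)\<close>, a line separating \<open>(D, D)\<close> from the Newton polyhedron provides one of these weights for
  which \<open>j + m k \<ge> D (1 + m)\<close> on the whole support (\<open>separating_weight\<close>).  The weighted order has a
  description that mentions no Taylor coefficient: \<open>j + m k \<ge> b\<close> holds on the support if and only if
  \<open>r\<^sup>-\<^sup>b f(D\<^sub>r x)\<close> converges for all \<open>x\<close> as \<open>r\<close> tends to 0 from above, and the limit is then the weighted
  homogeneous part of weight \<open>b\<close> (\<open>weighted_limit\<close>, \<open>weighted_limit_converse\<close>).  A change of
  coordinates \<open>\<phi>\<close> therefore acts on weighted parts through nothing but the limit \<open>\<Phi>\<close> of
  \<open>D\<^sub>r\<^sup>-\<^sup>1 \<circ> \<phi> \<circ> D\<^sub>r\<close> (\<open>weighted_part_compose\<close>).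

  The heart of the matter is \<open>coordinate_change_forces_root\<close>.  Suppose that \<open>g = f \<circ> \<phi>\<close> has a larger
  distance than \<open>f\<close>.  After interchanging coordinates, the support of \<open>g\<close> satisfies
  \<open>j + m k \<ge> D (1 + m)\<close> for some \<open>D > d(f)\<close> and \<open>m \<ge> 1\<close>, and \<open>\<partial>\<^sub>1 \<phi>\<^sub>1(0) \<noteq> 0\<close>.  Let \<open>n\<close> be the order of
  vanishing of \<open>y\<^sub>1 \<mapsto> \<phi>\<^sub>2(y\<^sub>1, 0)\<close> at 0, possibly infinite.  If \<open>n \<ge> m\<close>, then the limit \<open>\<Phi>\<close> for the weight \<open>m\<close> is a bijection of
  the plane, so that \<open>f\<close> has the same weighted order as \<open>g\<close>, which contradicts \<open>D > d(f)\<close>.  Hence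
  \<open>1 \<le> n < m\<close>.  For the weight \<open>n\<close> the limit \<open>\<Phi>\<close> is again a bijection, so the lowest weighted part of \<open>g\<close>
  is the lowest weighted part of \<open>f\<close> composed with \<open>\<Phi>\<close>.  The inequality for the weight \<open>m\<close> forces every
  monomial of that part of \<open>g\<close> to contain \<open>y\<^sub>2\<close> with an exponent exceeding \<open>D\<close>.  So the weighted part of
  \<open>f\<close> vanishes to an order exceeding \<open>D\<close> at \<open>\<Phi>(1, 0)\<close>, a point off the axes.  A weighted homogeneous
  polynomial with such a root has monomials on both sides of the diagonal
  (\<open>has_principal_edge_of_root\<close>); its line thus carries the principal face, which is a compact edge
  whose weights have the integral ratio \<open>n\<close>.

  What remains concerns the polynomial \<open>f\<^sub>p\<close> alone.  Its order at nonzero points of the axes is less than the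
  distance, since the principal edge has end points on both sides of the diagonal, and two different
  roots of \<open>f\<^sub>p(1, x\<^sub>2)\<close> of multiplicity exceeding \<open>d(f)\<close> would exceed the degree.  The shear
  \<open>x\<^sub>2 = y\<^sub>2 + a y\<^sub>1\<^sup>n\<close> along the root \<open>a\<close> makes every exponent of \<open>y\<^sub>2\<close> at least \<open>m(f\<^sub>p)\<close>, so the new distance
  is at least \<open>m(f\<^sub>p)\<close>.  A larger distance would, by the previous paragraph applied to \<open>f\<^sub>p\<close>, produce a
  root of an order exceeding \<open>m(f\<^sub>p)\<close>.  The converse follows because the shear strictly increases the
  distance of \<open>f\<^sub>p\<close>.

  The analytic case is reduced to the smooth one: analytic maps are smooth, and the only coordinate
  systems that have to be exhibited are polynomial.\<close>

section \<open>Smooth maps\<close>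

lemma frechet_derivative_cong_open:
  assumes "open S" "x \<in> S" "\<And>y. y \<in> S \<Longrightarrow> f y = g y" "g differentiable (at x)"
  shows "f differentiable (at x)"
    and "frechet_derivative f (at x) = frechet_derivative g (at x)"
proof -
  have "(g has_derivative frechet_derivative g (at x)) (at x)"
    using assms(4) by (simp add: frechet_derivative_works)
  then have *: "(f has_derivative frechet_derivative g (at x)) (at x)"
    by (rule has_derivative_transform_within_open[OF _ assms(1,2)]) (simp add: assms(3))
  show "f differentiable (at x)"
    using * differentiableI by blast
  show "frechet_derivative f (at x) = frechet_derivative g (at x)"
    using frechet_derivative_at[OF *] by simp
qed

text \<open>Smoothness is the largest property of functions that entails differentiability and is inherited by
  directional derivatives.  This avoids inductions over the order of differentiability: for sums,
  products and compositions it suffices to find a class of functions closed under differentiation.\<close>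

lemma smooth_on_coinduct:
  assumes "open S" and "X f"
    and diff: "\<And>g x. X g \<Longrightarrow> x \<in> S \<Longrightarrow> g differentiable (at x)"
    and deriv: "\<And>g v. X g \<Longrightarrow> \<exists>h. X h \<and> (\<forall>x\<in>S. frechet_derivative g (at x) v = h x)"
  shows "smooth_on S f"
proof -
  have "cont_diff_on n S g'" if "X g" "\<And>x. x \<in> S \<Longrightarrow> g' x = g x" for n g g'
    using that
  proof (induction n arbitrary: g g')
    case 0
    have "g' differentiable (at x)" if "x \<in> S" for x
      using frechet_derivative_cong_open(1)[OF \<open>open S\<close> that 0(2)] diff[OF 0(1) that] by auto
    then show ?case
      using differentiable_imp_continuous_within
      by (fastforce intro!: continuous_at_imp_continuous_on)
  next
    case (Suc n)
    have *: "g' differentiable (at x)"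
      "frechet_derivative g' (at x) = frechet_derivative g (at x)" if "x \<in> S" for x
      using frechet_derivative_cong_open[OF \<open>open S\<close> that Suc(3)] diff[OF Suc(2) that] by auto
    have "cont_diff_on n S (\<lambda>x. frechet_derivative g' (at x) v)" for v
    proof -
      obtain h where "X h" "\<forall>x\<in>S. frechet_derivative g (at x) v = h x"
        using deriv[OF Suc(2)] by blast
      then show ?thesis
        using Suc.IH * by simp
    qed
    then show ?case
      using * by simp
  qed
  then show ?thesis
    using \<open>X f\<close> unfolding smooth_on_def by blast
qed

lemma smooth_on_imp_differentiable: "smooth_on S f \<Longrightarrow> x \<in> S \<Longrightarrow> f differentiable (at x)"
  unfolding smooth_on_def using cont_diff_on.simps(2) by blast

lemma smooth_on_has_derivative:
  "smooth_on S f \<Longrightarrow> x \<in> S \<Longrightarrow> (f has_derivative frechet_derivative f (at x)) (at x)"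
  using smooth_on_imp_differentiable frechet_derivative_works by blast

lemma smooth_on_directional: "smooth_on S f \<Longrightarrow> smooth_on S (\<lambda>x. frechet_derivative f (at x) v)"
  unfolding smooth_on_def using cont_diff_on.simps(2) by blast

lemma smooth_on_continuous: "smooth_on S f \<Longrightarrow> continuous_on S f"
  unfolding smooth_on_def using cont_diff_on.simps(1) by blast

lemma smooth_on_subset:
  assumes "smooth_on S f" "open T" "T \<subseteq> S"
  shows "smooth_on T f"
proof (rule smooth_on_coinduct[where X = "smooth_on S"])
  show "\<exists>h. smooth_on S h \<and> (\<forall>x\<in>T. frechet_derivative g (at x) v = h x)" if "smooth_on S g" for g :: "'a \<Rightarrow> 'b" and v
    using smooth_on_directional[OF that] by blast
qed (use assms smooth_on_imp_differentiable in blast)+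

lemma smooth_on_bounded_linear:
  assumes "open S" "bounded_linear L" "smooth_on S f"
  shows "smooth_on S (\<lambda>x. L (f x))"
proof (rule smooth_on_coinduct[where X = "\<lambda>g. \<exists>f. smooth_on S f \<and> g = (\<lambda>x. L (f x))"])
  have D: "((\<lambda>x. L (f x)) has_derivative (\<lambda>h. L (frechet_derivative f (at x) h))) (at x)"
    if "smooth_on S f" "x \<in> S" for f :: "'a \<Rightarrow> 'b" and x
    using bounded_linear.has_derivative[OF assms(2) smooth_on_has_derivative[OF that]] .
  show "g differentiable at x"
    if "\<exists>f. smooth_on S f \<and> g = (\<lambda>x. L (f x))" "x \<in> S" for g x
    using that D by (auto intro: differentiableI)
  show "\<exists>h. (\<exists>f. smooth_on S f \<and> h = (\<lambda>x. L (f x))) \<and> (\<forall>x\<in>S. frechet_derivative g (at x) v = h x)"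
    if g: "\<exists>f. smooth_on S f \<and> g = (\<lambda>x. L (f x))" for g v
  proof -
    obtain f where f: "smooth_on S f" "g = (\<lambda>x. L (f x))"
      using g by blast
    have "frechet_derivative g (at x) v = L (frechet_derivative f (at x) v)" if "x \<in> S" for x
      using frechet_derivative_at[OF D[OF f(1) that]] f(2) by metis
    then show ?thesis
      using smooth_on_directional[OF f(1)] by (intro exI[of _ "\<lambda>x. L (frechet_derivative f (at x) v)"]) auto
  qed
qed (use assms in blast)+

text \<open>The class closed under differentiation to which a composition \<open>f \<circ> (u, v)\<close> belongs: by the chain rule
  its derivatives are sums of products of functions of the same form and of derivatives of \<open>u\<close> and \<open>v\<close>.\<close>

inductive compositional :: "'a::real_normed_vector set \<Rightarrow> (real \<times> real) set \<Rightarrow>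
    ('a \<Rightarrow> real) \<Rightarrow> ('a \<Rightarrow> real) \<Rightarrow> ('a \<Rightarrow> real) \<Rightarrow> bool"
  for U V u v where
  smooth: "smooth_on U f \<Longrightarrow> compositional U V u v f"
| outer: "smooth_on V f \<Longrightarrow> compositional U V u v (\<lambda>x. f (u x, v x))"
| add: "compositional U V u v f \<Longrightarrow> compositional U V u v g \<Longrightarrow> compositional U V u v (\<lambda>x. f x + g x)"
| mult: "compositional U V u v f \<Longrightarrow> compositional U V u v g \<Longrightarrow> compositional U V u v (\<lambda>x. f x * g x)"

lemma compositional_imp_smooth:
  fixes u v :: "'a::real_normed_vector \<Rightarrow> real"
  assumes U: "open U" and u: "smooth_on U u" and v: "smooth_on U v"
    and UV: "\<And>x. x \<in> U \<Longrightarrow> (u x, v x) \<in> V" and f: "compositional U V u v f"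
  shows "smooth_on U f"
proof -
  have *: "\<exists>f'. (\<forall>x\<in>U. (f has_derivative f' x) (at x)) \<and> (\<forall>h. compositional U V u v (\<lambda>x. f' x h))"
    if "compositional U V u v f" for f
    using that
  proof induction
    case (smooth f)
    then show ?case
      by (intro exI[of _ "\<lambda>x. frechet_derivative f (at x)"])
        (auto intro: smooth_on_has_derivative smooth_on_directional compositional.smooth)
  next
    case (outer f)
    let ?D = frechet_derivative
    let ?f' = "\<lambda>x h. ?D f (at (u x, v x)) (1, 0) * ?D u (at x) h + ?D f (at (u x, v x)) (0, 1) * ?D v (at x) h"
    have "((\<lambda>x. f (u x, v x)) has_derivative ?f' x) (at x)" if "x \<in> U" for x
    proof -
      have f': "(f has_derivative ?D f (at (u x, v x))) (at (u x, v x))"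
        using smooth_on_has_derivative[OF outer UV[OF that]] .
      have "((\<lambda>x. (u x, v x)) has_derivative (\<lambda>h. (?D u (at x) h, ?D v (at x) h))) (at x)"
        by (rule has_derivative_Pair) (use that u v smooth_on_has_derivative in auto)
      from has_derivative_compose[OF this f']
      have comp: "((\<lambda>x. f (u x, v x)) has_derivative (\<lambda>h. ?D f (at (u x, v x)) (?D u (at x) h, ?D v (at x) h))) (at x)" .
      have lin: "?D f (at (u x, v x)) (a, b) = ?D f (at (u x, v x)) (1, 0) * a + ?D f (at (u x, v x)) (0, 1) * b" for a b
      proof -
        interpret linear "?D f (at (u x, v x))"
          using f' has_derivative_linear by blast
        have "(a, b) = a *\<^sub>R (1, 0) + b *\<^sub>R (0, 1)"
          by simp
        then show ?thesis
          by (metis add scaleR mult.commute real_scaleR_def)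
      qed
      have "(\<lambda>h. ?D f (at (u x, v x)) (?D u (at x) h, ?D v (at x) h)) = ?f' x"
        by (rule ext) (rule lin)
      from subst[OF this, of "\<lambda>D. ((\<lambda>x. f (u x, v x)) has_derivative D) (at x)", OF comp]
      show ?thesis .
    qed
    moreover have "compositional U V u v (\<lambda>x. ?f' x h)" for h
    proof -
      have f: "compositional U V u v (\<lambda>x. ?D f (at (u x, v x)) w)" for w
        using compositional.outer[OF smooth_on_directional[OF outer, of w]] .
      show ?thesis
        using compositional.add[OF
            compositional.mult[OF f[of "(1, 0)"] compositional.smooth[OF smooth_on_directional[OF u, of h]]]
            compositional.mult[OF f[of "(0, 1)"] compositional.smooth[OF smooth_on_directional[OF v, of h]]]] .
    qed
    ultimately show ?case
      by (intro exI[of _ ?f']) blast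
  next
    case (add f g)
    then obtain f' g' where "\<forall>x\<in>U. (f has_derivative f' x) (at x)" "\<forall>h. compositional U V u v (\<lambda>x. f' x h)"
      "\<forall>x\<in>U. (g has_derivative g' x) (at x)" "\<forall>h. compositional U V u v (\<lambda>x. g' x h)"
      by blast
    then show ?case
      by (intro exI[of _ "\<lambda>x h. f' x h + g' x h"]) (auto intro: compositional.add derivative_eq_intros)
  next
    case (mult f g)
    then obtain f' g' where "\<forall>x\<in>U. (f has_derivative f' x) (at x)" "\<forall>h. compositional U V u v (\<lambda>x. f' x h)"
      "\<forall>x\<in>U. (g has_derivative g' x) (at x)" "\<forall>h. compositional U V u v (\<lambda>x. g' x h)"
      by blast
    then show ?case
      using mult.hyps
      by (intro exI[of _ "\<lambda>x h. f x * g' x h + f' x h * g x"])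
        (auto intro!: compositional.add compositional.mult has_derivative_mult)
  qed
  show ?thesis
  proof (rule smooth_on_coinduct[where X = "compositional U V u v"])
    show "g differentiable at x" if "compositional U V u v g" "x \<in> U" for g x
      using *[OF that(1)] that(2) differentiableI by blast
    show "\<exists>h. compositional U V u v h \<and> (\<forall>x\<in>U. frechet_derivative g (at x) w = h x)"
      if g: "compositional U V u v g" for g w
    proof -
      obtain g' where g': "\<forall>x\<in>U. (g has_derivative g' x) (at x)" "\<forall>h. compositional U V u v (\<lambda>x. g' x h)"
        using *[OF g] by blast
      then show ?thesis
        using frechet_derivative_at by metis
    qed
  qed (use U f in auto)
qed

lemma smooth_on_compose:
  fixes u v :: "'a::real_normed_vector \<Rightarrow> real" and f :: "real \<times> real \<Rightarrow> real"
  assumes "open U" "smooth_on U u" "smooth_on U v" "smooth_on V f"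
    and "\<And>x. x \<in> U \<Longrightarrow> (u x, v x) \<in> V"
  shows "smooth_on U (\<lambda>x. f (u x, v x))"
  using compositional_imp_smooth[OF assms(1-3) _ compositional.outer] assms by blast

lemma smooth_on_add:
  assumes U: "open U" and fg: "smooth_on U f" "smooth_on U g"
  shows "smooth_on U (\<lambda>x. f x + g x)"
proof (rule smooth_on_coinduct[where X = "\<lambda>h. \<exists>f g. smooth_on U f \<and> smooth_on U g \<and> h = (\<lambda>x. f x + g x)"])
  fix h :: "'a \<Rightarrow> 'b" assume "\<exists>f g. smooth_on U f \<and> smooth_on U g \<and> h = (\<lambda>x. f x + g x)"
  then obtain f g where h: "smooth_on U f" "smooth_on U g" "h = (\<lambda>x. f x + g x)"
    by blast
  have D: "(h has_derivative (\<lambda>v. frechet_derivative f (at x) v + frechet_derivative g (at x) v)) (at x)"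
    if "x \<in> U" for x
    unfolding h(3) using h(1,2) that by (intro has_derivative_add smooth_on_has_derivative)
  then show "h differentiable at x" if "x \<in> U" for x
    using that differentiableI by blast
  fix v
  have "frechet_derivative h (at x) v = frechet_derivative f (at x) v + frechet_derivative g (at x) v" if "x \<in> U" for x
    using frechet_derivative_at[OF D[OF that]] by metis
  then show "\<exists>h'. (\<exists>f g. smooth_on U f \<and> smooth_on U g \<and> h' = (\<lambda>x. f x + g x)) \<and>
      (\<forall>x\<in>U. frechet_derivative h (at x) v = h' x)"
    using smooth_on_directional[OF h(1)] smooth_on_directional[OF h(2)]
    by (intro exI[of _ "\<lambda>x. frechet_derivative f (at x) v + frechet_derivative g (at x) v"]) blast
qed (use assms in blast)+

lemma smooth_on_mult:
  fixes f g :: "'a::real_normed_vector \<Rightarrow> real"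
  assumes "open U" "smooth_on U f" "smooth_on U g"
  shows "smooth_on U (\<lambda>x. f x * g x)"
  by (rule compositional_imp_smooth[OF assms, of UNIV])
    (use assms in \<open>auto intro: compositional.mult compositional.smooth\<close>)

lemma smooth_on_const: "open S \<Longrightarrow> smooth_on S (\<lambda>_. c)"
  by (rule smooth_on_coinduct[where X = "\<lambda>g. \<exists>c. g = (\<lambda>_. c)"])
    (auto simp: frechet_derivative_const)

lemma smooth_on_linear:
  assumes "open S" "bounded_linear L"
  shows "smooth_on S L"
proof (rule smooth_on_coinduct[where X = "\<lambda>g. bounded_linear g \<or> (\<exists>c. g = (\<lambda>_. c))"])
  show "\<exists>h. (bounded_linear h \<or> (\<exists>c. h = (\<lambda>_. c))) \<and> (\<forall>x\<in>S. frechet_derivative g (at x) v = h x)"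
    if "bounded_linear g \<or> (\<exists>c. g = (\<lambda>_. c))" for g :: "'a \<Rightarrow> 'b" and v
    using that
  proof
    assume "bounded_linear g"
    then have "frechet_derivative g (at x) = g" for x
      using frechet_derivative_at[OF bounded_linear_imp_has_derivative] by metis
    then show ?thesis
      by auto
  qed (auto simp: frechet_derivative_const)
qed (use assms in \<open>auto intro: bounded_linear_imp_differentiable\<close>)

lemma smooth_on_power:
  fixes f :: "'a::real_normed_vector \<Rightarrow> real"
  assumes "open U" "smooth_on U f"
  shows "smooth_on U (\<lambda>x. f x ^ n)"
  by (induction n) (use assms in \<open>auto intro: smooth_on_const smooth_on_mult\<close>)

lemma smooth_on_sum:
  fixes f :: "'b \<Rightarrow> 'a::real_normed_vector \<Rightarrow> real"
  assumes "open U" "\<And>i. i \<in> A \<Longrightarrow> smooth_on U (f i)"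
  shows "smooth_on U (\<lambda>x. \<Sum>i\<in>A. f i x)"
  using assms(2) by (induction A rule: infinite_finite_induct) (auto intro: smooth_on_const smooth_on_add assms(1))

section \<open>Taylor expansions\<close>

lemma partial_deriv_Suc1:
  "partial_deriv (Suc j) k f = (\<lambda>x. frechet_derivative (partial_deriv j k f) (at x) (1, 0))"
  by (simp add: partial_deriv_def)

lemma partial_deriv_Suc2:
  "partial_deriv 0 (Suc k) f = (\<lambda>x. frechet_derivative (partial_deriv 0 k f) (at x) (0, 1))"
  by (simp add: partial_deriv_def)

lemma partial_deriv_0: "partial_deriv 0 0 f = f"
  by (simp add: partial_deriv_def)

lemma smooth_on_partial_deriv:
  assumes "smooth_on U f"
  shows "smooth_on U (partial_deriv j k f)"
proof (induction j)
  case 0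
  show ?case
    by (induction k) (use assms in \<open>auto simp: partial_deriv_0 partial_deriv_Suc2 intro: smooth_on_directional\<close>)
qed (simp add: partial_deriv_Suc1 smooth_on_directional)

lemma smooth_on_line_derivative:
  fixes g :: "real \<times> real \<Rightarrow> real"
  assumes "smooth_on U g" "q + t *\<^sub>R v \<in> U"
  shows "((\<lambda>t. g (q + t *\<^sub>R v)) has_real_derivative frechet_derivative g (at (q + t *\<^sub>R v)) v) (at t)"
proof -
  let ?D = "frechet_derivative g (at (q + t *\<^sub>R v))"
  have D: "(g has_derivative ?D) (at (q + t *\<^sub>R v))"
    using smooth_on_has_derivative[OF assms] .
  have "((\<lambda>t. q + t *\<^sub>R v) has_derivative (\<lambda>s. s *\<^sub>R v)) (at t)"
    by (auto intro!: derivative_eq_intros)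
  from has_derivative_compose[OF this D]
  have "((\<lambda>t. g (q + t *\<^sub>R v)) has_derivative (\<lambda>s. ?D (s *\<^sub>R v))) (at t)" .
  moreover have "?D (s *\<^sub>R v) = ?D v * s" for s
    using has_derivative_linear[OF D] by (simp add: linear_cmul mult.commute)
  ultimately show ?thesis
    by (simp add: has_field_derivative_def)
qed

abbreviation taylor_sum :: "(nat \<Rightarrow> nat \<Rightarrow> real) \<Rightarrow> nat \<Rightarrow> real \<times> real \<Rightarrow> real" where
  "taylor_sum c N x \<equiv> \<Sum>(j, k)\<in>{(j, k). j + k < N}. c j k * fst x ^ j * snd x ^ k"

text \<open>The Taylor series is used only as an asymptotic series; this is the form in which smooth functions
  possess it and in which it is unique.\<close>

definition expansion :: "(real \<times> real \<Rightarrow> real) \<Rightarrow> (nat \<Rightarrow> nat \<Rightarrow> real) \<Rightarrow> bool" where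
  "expansion f c \<longleftrightarrow> (\<forall>N. (\<lambda>x. f x - taylor_sum c N x)
      \<in> O[nhds 0](\<lambda>x. norm x ^ N))"

lemma finite_total_degree_less: "finite {(j, k). j + k < (N::nat)}"
  by (rule finite_subset[of _ "{..<N} \<times> {..<N}"]) auto

lemma sum_total_degree_less:
  "(\<Sum>(j, k)\<in>{(j, k). j + k < N}. F j k) = (\<Sum>k<N. \<Sum>j<N - k. F j (k::nat))"
proof -
  have "(\<Sum>k<N. \<Sum>j<N - k. F j k) = (\<Sum>(k, j)\<in>(SIGMA k:{..<N}. {..<N - k}). F j k)"
    by (rule sum.Sigma) auto
  also have "\<dots> = (\<Sum>(j, k)\<in>{(j, k). j + k < N}. F j k)"
    by (rule sum.reindex_bij_witness[of _ prod.swap prod.swap]) auto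
  finally show ?thesis ..
qed

lemma mult_power_le_norm_power:
  fixes x :: "real \<times> real"
  assumes "j + k = N"
  shows "\<bar>fst x\<bar> ^ j * \<bar>snd x\<bar> ^ k \<le> norm x ^ N"
proof -
  have "\<bar>fst x\<bar> \<le> norm x" "\<bar>snd x\<bar> \<le> norm x"
    using norm_fst_le[of "fst x" "snd x"] norm_snd_le[of "snd x" "fst x"] by auto
  then have "\<bar>fst x\<bar> ^ j * \<bar>snd x\<bar> ^ k \<le> norm x ^ j * norm x ^ k"
    by (intro mult_mono power_mono) auto
  also have "\<dots> = norm x ^ N"
    using assms by (simp add: power_add[symmetric])
  finally show ?thesis .
qed

text \<open>The function is expanded along vertical lines and then each coefficient, a function of the first
  coordinate, along the horizontal axis.  The order matches the definition of \<^const>\<open>partial_deriv\<close>,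
  which differentiates in the second variable first, so that only Taylor formulas in one variable enter.\<close>

lemma taylor_expansion:
  fixes f :: "real \<times> real \<Rightarrow> real"
  assumes U: "open U" "p \<in> U" and f: "smooth_on U f"
  shows "expansion (\<lambda>h. f (p + h)) (taylor_coeff f p)"
  unfolding expansion_def
proof
  fix N
  obtain e where e: "e > 0" "cball p e \<subseteq> U"
    using U open_contains_cball by blast
  have "\<exists>B. \<forall>x\<in>cball p e. \<bar>partial_deriv j k f x\<bar> \<le> B" for j k
  proof -
    have "continuous_on (cball p e) (partial_deriv j k f)"
      using smooth_on_continuous[OF smooth_on_partial_deriv[OF f]] e(2) continuous_on_subset by blast
    then have "bounded (partial_deriv j k f ` cball p e)"
      using compact_continuous_image compact_cball compact_imp_bounded by blast
    then show ?thesis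
      unfolding bounded_iff by auto
  qed
  then obtain B where B: "\<And>j k x. x \<in> cball p e \<Longrightarrow> \<bar>partial_deriv j k f x\<bar> \<le> B j k"
    by metis
  have B0: "0 \<le> B j k" for j k
    using B[of p j k] e(1) by force
  define C where "C = (\<Sum>k<N. B (N - k) k) + B 0 N"
  have key: "\<bar>f (p + h) - taylor_sum (taylor_coeff f p) N h\<bar>
      \<le> C * norm h ^ N" if h: "norm h \<le> e / 2" for h
  proof -
    obtain h1 h2 where hh: "h = (h1, h2)"
      by force
    have h12: "\<bar>h1\<bar> \<le> e / 2" "\<bar>h2\<bar> \<le> e / 2"
      using norm_fst_le[of h1 h2] norm_snd_le[of h2 h1] h hh by auto
    have in_ball: "p + (s, t) \<in> cball p e" if "\<bar>s\<bar> \<le> \<bar>h1\<bar>" "\<bar>t\<bar> \<le> \<bar>h2\<bar>" for s t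
      using norm_Pair_le[of "- s" "- t"] that h12 by (simp add: dist_norm)
    define G where "G m k t = partial_deriv m k f (p + (t, 0))" for m k t
    define R where "R k = G 0 k h1 - (\<Sum>j<N - k. G j k 0 / fact j * h1 ^ j)" for k
    have R: "\<bar>R k\<bar> \<le> B (N - k) k * \<bar>h1\<bar> ^ (N - k)" for k
    proof -
      have "DERIV (G m k) t :> G (Suc m) k t" if "\<bar>t\<bar> \<le> \<bar>h1\<bar>" for m t
        unfolding G_def partial_deriv_Suc1
        using smooth_on_line_derivative[OF smooth_on_partial_deriv[OF f], of p t "(1, 0)" m k]
          in_ball[OF that, of 0] e(2) by auto
      then obtain t where "\<bar>t\<bar> \<le> \<bar>h1\<bar>"
        "G 0 k h1 = (\<Sum>j<N - k. G j k 0 / fact j * h1 ^ j) + G (N - k) k t / fact (N - k) * h1 ^ (N - k)"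
        using Maclaurin_bi_le[of "\<lambda>m. G m k" "G 0 k" "N - k" h1] by blast
      then have "\<bar>R k\<bar> = \<bar>G (N - k) k t\<bar> / fact (N - k) * \<bar>h1\<bar> ^ (N - k)"
        unfolding R_def by (simp add: abs_mult power_abs)
      also have "\<dots> \<le> B (N - k) k / 1 * \<bar>h1\<bar> ^ (N - k)"
        using B[OF in_ball[OF \<open>\<bar>t\<bar> \<le> \<bar>h1\<bar>\<close>, of 0]] B0
        by (intro mult_right_mono frac_le) (auto simp: G_def)
      finally show ?thesis
        by simp
    qed
    define H where "H k t = partial_deriv 0 k f (p + (h1, t))" for k t
    have "DERIV (H k) t :> H (Suc k) t" if "\<bar>t\<bar> \<le> \<bar>h2\<bar>" for k t
      unfolding H_def partial_deriv_Suc2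
      using smooth_on_line_derivative[OF smooth_on_partial_deriv[OF f], of "p + (h1, 0)" t "(0, 1)" 0 k]
        in_ball[OF _ that, of h1] e(2) by (auto simp: add.assoc)
    then obtain t where t: "\<bar>t\<bar> \<le> \<bar>h2\<bar>"
      "H 0 h2 = (\<Sum>k<N. H k 0 / fact k * h2 ^ k) + H N t / fact N * h2 ^ N"
      using Maclaurin_bi_le[of H "H 0" N h2] by blast
    have S: "\<bar>H N t / fact N * h2 ^ N\<bar> \<le> B 0 N * \<bar>h2\<bar> ^ N"
    proof -
      have "\<bar>H N t / fact N * h2 ^ N\<bar> = \<bar>H N t\<bar> / fact N * \<bar>h2\<bar> ^ N"
        by (simp add: abs_mult power_abs)
      also have "\<dots> \<le> B 0 N / 1 * \<bar>h2\<bar> ^ N"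
        using B[OF in_ball[OF order_refl t(1)]] B0
        by (intro mult_right_mono frac_le) (auto simp: H_def)
      finally show ?thesis
        by simp
    qed
    have "H k 0 = R k + (\<Sum>j<N - k. partial_deriv j k f p / fact j * h1 ^ j)" for k
      by (simp add: R_def H_def G_def flip: zero_prod_def)
    with t(2) have "f (p + h) = (\<Sum>k<N. (R k + (\<Sum>j<N - k. partial_deriv j k f p / fact j * h1 ^ j)) / fact k * h2 ^ k)
       + H N t / fact N * h2 ^ N"
      by (simp add: H_def hh partial_deriv_0)
    also have "(\<Sum>k<N. (R k + (\<Sum>j<N - k. partial_deriv j k f p / fact j * h1 ^ j)) / fact k * h2 ^ k)
       = (\<Sum>k<N. R k / fact k * h2 ^ k) + (\<Sum>k<N. \<Sum>j<N - k. taylor_coeff f p j k * h1 ^ j * h2 ^ k)"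
    proof -
      have "(\<Sum>j<N - k. partial_deriv j k f p / fact j * h1 ^ j) / fact k * h2 ^ k
        = (\<Sum>j<N - k. taylor_coeff f p j k * h1 ^ j * h2 ^ k)" for k
        unfolding sum_divide_distrib sum_distrib_right taylor_coeff_def
        by (rule sum.cong) auto
      then show ?thesis
        by (simp only: add_divide_distrib distrib_right sum.distrib)
    qed
    finally have "f (p + h) - (\<Sum>k<N. \<Sum>j<N - k. taylor_coeff f p j k * h1 ^ j * h2 ^ k)
      = (\<Sum>k<N. R k / fact k * h2 ^ k) + H N t / fact N * h2 ^ N"
      by simp
    then have "\<bar>f (p + h) - (\<Sum>k<N. \<Sum>j<N - k. taylor_coeff f p j k * h1 ^ j * h2 ^ k)\<bar>
      \<le> (\<Sum>k<N. \<bar>R k / fact k * h2 ^ k\<bar>) + B 0 N * \<bar>h2\<bar> ^ N"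
      using S sum_abs[of "\<lambda>k. R k / fact k * h2 ^ k" "{..<N}"] by linarith
    also have "\<dots> \<le> (\<Sum>k<N. B (N - k) k * norm h ^ N) + B 0 N * norm h ^ N"
    proof (intro add_mono sum_mono)
      fix k assume "k \<in> {..<N}"
      have "\<bar>R k / fact k * h2 ^ k\<bar> = \<bar>R k\<bar> / fact k * \<bar>h2\<bar> ^ k"
        by (simp add: abs_mult power_abs)
      also have "\<dots> \<le> (B (N - k) k * \<bar>h1\<bar> ^ (N - k)) / 1 * \<bar>h2\<bar> ^ k"
        using R B0 by (intro mult_right_mono frac_le) auto
      also have "\<dots> = B (N - k) k * (\<bar>h1\<bar> ^ (N - k) * \<bar>h2\<bar> ^ k)"
        by simp
      also have "\<dots> \<le> B (N - k) k * norm h ^ N"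
        using mult_power_le_norm_power[of "N - k" k N h] \<open>k \<in> {..<N}\<close> B0 hh
        by (intro mult_left_mono) auto
      finally show "\<bar>R k / fact k * h2 ^ k\<bar> \<le> B (N - k) k * norm h ^ N" .
    next
      show "B 0 N * \<bar>h2\<bar> ^ N \<le> B 0 N * norm h ^ N"
        using mult_power_le_norm_power[of 0 N N h] B0 hh by (intro mult_left_mono) auto
    qed
    finally show ?thesis
      by (simp add: sum_total_degree_less hh C_def sum_distrib_right distrib_right)
  qed
  show "(\<lambda>x. f (p + x) - taylor_sum (taylor_coeff f p) N x)
      \<in> O[nhds 0](\<lambda>x. norm x ^ N)"
  proof (rule bigoI)
    have "eventually (\<lambda>h. norm h < e / 2) (nhds (0 :: real \<times> real))"
      using eventually_nhds_in_open[of "ball 0 (e / 2)" "0 :: real \<times> real"] e(1) by simp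
    then show "\<forall>\<^sub>F x in nhds 0. norm (f (p + x) - taylor_sum (taylor_coeff f p) N x)
        \<le> C * norm (norm x ^ N)"
      by eventually_elim (use key in simp)
  qed
qed

section \<open>Real analytic functions\<close>

lemma has_sum_shift_index:
  fixes F :: "nat \<Rightarrow> nat \<Rightarrow> real"
  assumes "\<And>k. F 0 k = 0"
  shows "((\<lambda>(j, k). F j k) has_sum X) UNIV \<longleftrightarrow> ((\<lambda>(j, k). F (Suc j) k) has_sum X) UNIV"
proof -
  have *: "range (\<lambda>(j, k). (Suc j, k)) = {(j, k). j > 0}"
    by (auto simp: image_iff) (metis Suc_pred)
  have "((\<lambda>(j, k). F j k) has_sum X) UNIV \<longleftrightarrow> ((\<lambda>(j, k). F j k) has_sum X) {(j, k). j > 0}"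
    by (rule has_sum_cong_neutral) (use assms in auto)
  also have "\<dots> \<longleftrightarrow> ((\<lambda>(j, k). F j k) has_sum X) (range (\<lambda>(j, k). (Suc j, k)))"
    by (simp only: *)
  also have "\<dots> \<longleftrightarrow> ((\<lambda>(j, k). F (Suc j) k) has_sum X) UNIV"
    by (subst has_sum_reindex) (auto simp: inj_on_def o_def case_prod_unfold)
  finally show ?thesis .
qed

lemma has_sum_swap_index:
  "((\<lambda>(j, k). F j k) has_sum X) (UNIV :: (nat \<times> nat) set) \<longleftrightarrow> ((\<lambda>(j, k). F k j) has_sum X) UNIV"
  by (rule has_sum_reindex_bij_witness[of _ prod.swap prod.swap]) auto

text \<open>Termwise derivatives on the half-sized square are dominated by the terms of the series at the corner
  \<open>(d, d)\<close>, since the factor \<open>j\<close> is absorbed by the geometric gain \<open>2\<^sup>-\<^sup>j\<close>.\<close>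

lemma power_series_derivative_term_bound:
  fixes x y d :: real
  assumes "d > 0" "\<bar>x\<bar> \<le> d / 2" "\<bar>y\<bar> \<le> d / 2"
  shows "\<bar>c * (real j * x ^ (j - 1)) * y ^ k\<bar> \<le> 2 / d * (\<bar>c\<bar> * d ^ j * d ^ k)"
proof (cases j)
  case (Suc i)
  have "real (Suc i) \<le> 2 * 2 ^ i"
    by (induction i) auto
  then have "real (Suc i) * \<bar>x\<bar> ^ i * \<bar>y\<bar> ^ k \<le> (2 * 2 ^ i) * (d / 2) ^ i * d ^ k"
    using assms by (intro mult_mono power_mono) auto
  also have "\<dots> = 2 * d ^ i * d ^ k"
    by (simp add: power_divide)
  finally have "\<bar>c\<bar> * (real (Suc i) * \<bar>x\<bar> ^ i * \<bar>y\<bar> ^ k) \<le> \<bar>c\<bar> * (2 * d ^ i * d ^ k)"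
    by (rule mult_left_mono) auto
  also have "\<dots> = 2 / d * (\<bar>c\<bar> * d ^ j * d ^ k)"
    using assms(1) Suc by simp
  finally show ?thesis
    unfolding Suc abs_mult power_abs by (simp add: mult.assoc del: of_nat_Suc)
qed (use assms in auto)

text \<open>The double series is enumerated by \<^const>\<open>prod_decode\<close> and differentiated term by term; the derivative
  series converges uniformly by the Weierstrass test.\<close>

lemma real_analytic_on_differentiable:
  fixes f :: "real \<times> real \<Rightarrow> real"
  assumes U: "open U" and f: "real_analytic_on U f" and p: "p \<in> U"
  shows "f differentiable (at p)"
    and "\<exists>c. \<exists>\<epsilon>>0. \<forall>h. norm h < \<epsilon> \<longrightarrow>
      ((\<lambda>(j, k). (fst h ^ j * snd h ^ k) *\<^sub>R c j k) has_sum frechet_derivative f (at (p + h)) v) UNIV"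
proof -
  obtain c \<epsilon> where \<epsilon>: "\<epsilon> > 0" and c: "\<And>h. norm h < \<epsilon> \<Longrightarrow>
     ((\<lambda>(j, k). (fst h ^ j * snd h ^ k) *\<^sub>R c j k) has_sum f (p + h)) UNIV"
    using bspec[OF f[unfolded real_analytic_on_def] p] by blast
  define d where "d = \<epsilon> / 3"
  have d: "d > 0" "2 * d < \<epsilon>"
    using \<epsilon> by (auto simp: d_def)
  define M where "M = (\<lambda>(j, k). 2 / d * (\<bar>c j k\<bar> * d ^ j * d ^ k))"
  have M: "M summable_on UNIV"
  proof -
    have "norm (d, d) < \<epsilon>"
      using norm_Pair_le[of d d] d by auto
    from c[OF this] have "(\<lambda>(j, k). (d ^ j * d ^ k) * c j k) summable_on UNIV"
      by (auto simp: summable_on_def)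
    then have "(\<lambda>x. norm ((\<lambda>(j, k). (d ^ j * d ^ k) * c j k) x)) summable_on UNIV"
      using summable_on_iff_abs_summable_on_real by blast
    then have "(\<lambda>x. 2 / d * norm ((\<lambda>(j, k). (d ^ j * d ^ k) * c j k) x)) summable_on UNIV"
      by (rule summable_on_cmult_right)
    moreover have "(\<lambda>x. 2 / d * norm ((\<lambda>(j, k). (d ^ j * d ^ k) * c j k) x)) = M"
      using d by (auto simp: M_def abs_mult fun_eq_iff)
    ultimately show ?thesis
      by simp
  qed
  define S :: "(real \<times> real) set" where "S = ball 0 (d / 2)"
  have S: "open S" "convex S" "0 \<in> S"
    using d by (auto simp: S_def)
  have S_le: "\<bar>fst h\<bar> \<le> d / 2" "\<bar>snd h\<bar> \<le> d / 2" "norm h < \<epsilon>" if "h \<in> S" for h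
    using that norm_fst_le[of "fst h" "snd h"] norm_snd_le[of "snd h" "fst h"] d by (auto simp: S_def)
  define a where "a = (\<lambda>h (j, k). c j k * (real j * fst h ^ (j - 1)) * snd h ^ k)"
  define b where "b = (\<lambda>h (j, k). c j k * (real k * snd h ^ (k - 1)) * fst h ^ j)"
  have a_le: "norm (a h jk) \<le> M jk" and b_le: "norm (b h jk) \<le> M jk" if "h \<in> S" for h jk
  proof -
    obtain j k where jk: "jk = (j, k)"
      by force
    show "norm (a h jk) \<le> M jk"
      using power_series_derivative_term_bound[OF d(1) S_le(1,2)[OF that], of "c j k" j k]
      by (simp only: a_def M_def jk prod.case real_norm_def)
    have "2 / d * (\<bar>c j k\<bar> * d ^ k * d ^ j) = M jk"
      by (simp add: M_def jk)
    with power_series_derivative_term_bound[OF d(1) S_le(2,1)[OF that], of "c j k" k j]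
    show "norm (b h jk) \<le> M jk"
      by (simp only: b_def jk prod.case real_norm_def)
  qed
  have sm: "a h summable_on UNIV" "b h summable_on UNIV" if "h \<in> S" for h
    using iffD2[OF summable_on_iff_abs_summable_on_real
        Infinite_Sum.abs_summable_on_comparison_test'[OF M a_le[OF that]]]
      iffD2[OF summable_on_iff_abs_summable_on_real
        Infinite_Sum.abs_summable_on_comparison_test'[OF M b_le[OF that]]] .
  have to_sums: "(\<lambda>i. F (prod_decode i)) sums X" if "(F has_sum X) UNIV" for F :: "nat \<times> nat \<Rightarrow> real" and X
    using that has_sum_reindex_bij_betw[OF bij_prod_decode, of F X] has_sum_imp_sums by blast
  define A where "A h = infsum (a h) UNIV" for h
  define B where "B h = infsum (b h) UNIV" for h
  have M_sum: "summable (\<lambda>i. M (prod_decode i))"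
    using to_sums[OF has_sum_infsum[OF M]] sums_summable by blast
  have unif: "uniform_limit S (\<lambda>n h. \<Sum>i<n. G h (prod_decode i)) (\<lambda>h. infsum (G h) UNIV) sequentially"
    if G: "\<And>h jk. h \<in> S \<Longrightarrow> norm (G h jk) \<le> M jk" "\<And>h. h \<in> S \<Longrightarrow> G h summable_on UNIV" for G :: "real \<times> real \<Rightarrow> nat \<times> nat \<Rightarrow> real"
  proof -
    have "uniform_limit S (\<lambda>n h. \<Sum>i<n. G h (prod_decode i)) (\<lambda>h. \<Sum>i. G h (prod_decode i)) sequentially"
      by (rule Weierstrass_m_test[OF _ M_sum]) (use G(1) in blast)
    moreover have "(\<Sum>i. G h (prod_decode i)) = infsum (G h) UNIV" if "h \<in> S" for h
      using to_sums[OF has_sum_infsum[OF G(2)[OF that]]] sums_unique by metis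
    ultimately show ?thesis
      by (simp add: uniform_limit_iff)
  qed
  have "\<exists>g. \<forall>h\<in>S. (\<lambda>i. (\<lambda>(j, k). (fst h ^ j * snd h ^ k) *\<^sub>R c j k) (prod_decode i)) sums (g h) \<and>
      (g has_derivative (\<lambda>v. A h * fst v + B h * snd v)) (at h within S)"
  proof (rule has_derivative_series)
    show "convex S" "0 \<in> S"
      using S by auto
    show "(\<lambda>i. (\<lambda>(j, k). (fst 0 ^ j * snd 0 ^ k) *\<^sub>R c j k) (prod_decode i)) sums f (p + 0)"
      using to_sums[OF c[of 0]] \<epsilon> by simp
    show "((\<lambda>h. (\<lambda>(j, k). (fst h ^ j * snd h ^ k) *\<^sub>R c j k) (prod_decode n)) has_derivative
        (\<lambda>v. a h (prod_decode n) * fst v + b h (prod_decode n) * snd v)) (at h within S)" for n h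
    proof -
      obtain j k where jk: "prod_decode n = (j, k)"
        by force
      show ?thesis
        unfolding jk a_def b_def
        by (auto intro!: derivative_eq_intros simp: fun_eq_iff algebra_simps)
    qed
    fix e :: real assume "e > 0"
    have 1: "\<forall>\<^sub>F n in sequentially. \<forall>h\<in>S. dist (\<Sum>i<n. a h (prod_decode i)) (A h) < e / 2"
      using unif[of a] a_le sm(1) \<open>e > 0\<close> unfolding uniform_limit_iff A_def by (meson half_gt_zero)
    have 2: "\<forall>\<^sub>F n in sequentially. \<forall>h\<in>S. dist (\<Sum>i<n. b h (prod_decode i)) (B h) < e / 2"
      using unif[of b] b_le sm(2) \<open>e > 0\<close> unfolding uniform_limit_iff B_def by (meson half_gt_zero)
    from 1 2 show "\<forall>\<^sub>F n in sequentially. \<forall>h\<in>S. \<forall>v.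
       norm ((\<Sum>i<n. a h (prod_decode i) * fst v + b h (prod_decode i) * snd v) - (A h * fst v + B h * snd v)) \<le> e * norm v"
    proof eventually_elim
      case (elim n)
      show ?case
      proof (intro ballI allI)
        fix h and v :: "real \<times> real" assume h: "h \<in> S"
        let ?a = "\<Sum>i<n. a h (prod_decode i)" and ?b = "\<Sum>i<n. b h (prod_decode i)"
        have "(\<Sum>i<n. a h (prod_decode i) * fst v + b h (prod_decode i) * snd v) - (A h * fst v + B h * snd v)
            = (?a - A h) * fst v + (?b - B h) * snd v"
          by (simp add: sum.distrib sum_distrib_right left_diff_distrib)
        also have "norm \<dots> \<le> \<bar>?a - A h\<bar> * \<bar>fst v\<bar> + \<bar>?b - B h\<bar> * \<bar>snd v\<bar>"
          by (metis abs_mult abs_triangle_ineq real_norm_def)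
        also have "\<dots> \<le> e / 2 * norm v + e / 2 * norm v"
          using elim h norm_fst_le[of "fst v" "snd v"] norm_snd_le[of "snd v" "fst v"] \<open>e > 0\<close>
          by (intro add_mono mult_mono) (auto simp: dist_real_def intro: less_imp_le)
        finally show "norm ((\<Sum>i<n. a h (prod_decode i) * fst v + b h (prod_decode i) * snd v) - (A h * fst v + B h * snd v)) \<le> e * norm v"
          by simp
      qed
    qed
  qed
  then obtain g where g: "\<And>h. h \<in> S \<Longrightarrow> (\<lambda>i. (\<lambda>(j, k). (fst h ^ j * snd h ^ k) *\<^sub>R c j k) (prod_decode i)) sums (g h)"
    "\<And>h. h \<in> S \<Longrightarrow> (g has_derivative (\<lambda>v. A h * fst v + B h * snd v)) (at h within S)"
    by blast
  have g_eq: "g h = f (p + h)" if "h \<in> S" for h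
    using sums_unique2[OF g(1)[OF that] to_sums[OF c[OF S_le(3)[OF that]]]] .
  have f': "(f has_derivative (\<lambda>v. A h * fst v + B h * snd v)) (at (p + h))" if h: "h \<in> S" for h
  proof -
    have "(g has_derivative (\<lambda>v. A h * fst v + B h * snd v)) (at h)"
      using g(2)[OF h] at_within_open[OF h S(1)] by simp
    then have "((\<lambda>h. f (p + h)) has_derivative (\<lambda>v. A h * fst v + B h * snd v)) (at h)"
      by (rule has_derivative_transform_within_open[OF _ S(1) h]) (rule g_eq)
    then have g': "((\<lambda>h. f (p + h)) has_derivative (\<lambda>v. A h * fst v + B h * snd v)) (at ((p + h) - p))"
      by simp
    have "((\<lambda>x. x - p) has_derivative (\<lambda>v. v)) (at (p + h))"
      by (auto intro!: derivative_eq_intros)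
    from has_derivative_compose[OF this g'] show ?thesis
      by simp
  qed
  from f'[OF S(3)] show "f differentiable (at p)"
    by (auto intro: differentiableI)
  show "\<exists>c. \<exists>\<epsilon>>0. \<forall>h. norm h < \<epsilon> \<longrightarrow>
      ((\<lambda>(j, k). (fst h ^ j * snd h ^ k) *\<^sub>R c j k) has_sum frechet_derivative f (at (p + h)) v) UNIV"
  proof (intro exI conjI allI impI)
    show "d / 2 > 0"
      using d by simp
    fix h :: "real \<times> real" assume "norm h < d / 2"
    then have h: "h \<in> S"
      by (simp add: S_def)
    have "((\<lambda>(j, k). c (Suc j) k * (real (Suc j) * fst h ^ j) * snd h ^ k) has_sum A h) UNIV"
      using has_sum_shift_index[of "\<lambda>j k. a h (j, k)" "A h"] has_sum_infsum[OF sm(1)[OF h]]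
      by (simp add: A_def a_def case_prod_unfold)
    moreover have "((\<lambda>(j, k). c j (Suc k) * (real (Suc k) * snd h ^ k) * fst h ^ j) has_sum B h) UNIV"
      using has_sum_shift_index[of "\<lambda>j k. b h (k, j)" "B h"] has_sum_infsum[OF sm(2)[OF h]]
        has_sum_swap_index[of "\<lambda>j k. b h (j, k)" "B h"] has_sum_swap_index[of "\<lambda>j k. b h (k, Suc j)" "B h"]
      by (simp add: B_def b_def case_prod_unfold)
    ultimately have "((\<lambda>x. (case x of (j, k) \<Rightarrow> c (Suc j) k * (real (Suc j) * fst h ^ j) * snd h ^ k) * fst v
       + (case x of (j, k) \<Rightarrow> c j (Suc k) * (real (Suc k) * snd h ^ k) * fst h ^ j) * snd v)
       has_sum A h * fst v + B h * snd v) UNIV"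
      by (intro has_sum_add has_sum_cmult_left)
    moreover have "frechet_derivative f (at (p + h)) v = A h * fst v + B h * snd v"
      using frechet_derivative_at[OF f'[OF h]] by metis
    moreover have "(\<lambda>x. (case x of (j, k) \<Rightarrow> c (Suc j) k * (real (Suc j) * fst h ^ j) * snd h ^ k) * fst v
       + (case x of (j, k) \<Rightarrow> c j (Suc k) * (real (Suc k) * snd h ^ k) * fst h ^ j) * snd v)
      = (\<lambda>(j, k). (fst h ^ j * snd h ^ k) *\<^sub>R (real (Suc j) * c (Suc j) k * fst v + real (Suc k) * c j (Suc k) * snd v))"
      by (auto simp: fun_eq_iff algebra_simps)
    ultimately show "((\<lambda>(j, k). (fst h ^ j * snd h ^ k) *\<^sub>R
        (\<lambda>j k. real (Suc j) * c (Suc j) k * fst v + real (Suc k) * c j (Suc k) * snd v) j k)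
        has_sum frechet_derivative f (at (p + h)) v) UNIV"
      by simp
  qed
qed

lemma real_analytic_on_imp_smooth:
  fixes f :: "real \<times> real \<Rightarrow> real"
  assumes "open U" "real_analytic_on U f"
  shows "smooth_on U f"
proof (rule smooth_on_coinduct[where X = "real_analytic_on U"])
  show "\<exists>h. real_analytic_on U h \<and> (\<forall>x\<in>U. frechet_derivative g (at x) v = h x)"
    if "real_analytic_on U g" for g :: "real \<times> real \<Rightarrow> real" and v
    using real_analytic_on_differentiable(2)[OF assms(1) that]
    by (intro exI[of _ "\<lambda>x. frechet_derivative g (at x) v"]) (simp add: real_analytic_on_def)
qed (use assms real_analytic_on_differentiable(1) in auto)

lemma real_analytic_on_bounded_linear:
  assumes "bounded_linear L" "real_analytic_on U f"
  shows "real_analytic_on U (\<lambda>x. L (f x))"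
  unfolding real_analytic_on_def
proof
  interpret L: bounded_linear L
    by fact
  fix p assume "p \<in> U"
  from bspec[OF assms(2)[unfolded real_analytic_on_def] this] obtain c \<epsilon> where
    \<epsilon>: "\<epsilon> > 0" "\<And>h. norm h < \<epsilon> \<Longrightarrow> ((\<lambda>(j, k). (fst h ^ j * snd h ^ k) *\<^sub>R c j k) has_sum f (p + h)) UNIV"
    by blast
  have "((\<lambda>(j, k). (fst h ^ j * snd h ^ k) *\<^sub>R L (c j k)) has_sum L (f (p + h))) UNIV" if "norm h < \<epsilon>" for h
    using has_sum_bounded_linear[OF assms(1) \<epsilon>(2)[OF that]] by (simp add: case_prod_unfold L.scaleR)
  then show "\<exists>c. \<exists>\<epsilon>>0. \<forall>h. norm h < \<epsilon> \<longrightarrow>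
      ((\<lambda>(j, k). (fst h ^ j * snd h ^ k) *\<^sub>R c j k) has_sum L (f (p + h))) UNIV"
    using \<epsilon>(1) by (intro exI[of _ "\<lambda>j k. L (c j k)"] exI[of _ \<epsilon>]) auto
qed

lemma real_analytic_on_add:
  assumes "real_analytic_on U f" "real_analytic_on U g"
  shows "real_analytic_on U (\<lambda>x. f x + g x)"
  unfolding real_analytic_on_def
proof
  fix p assume p: "p \<in> U"
  obtain c \<epsilon> where c: "\<epsilon> > 0" "\<And>h. norm h < \<epsilon> \<Longrightarrow>
     ((\<lambda>(j, k). (fst h ^ j * snd h ^ k) *\<^sub>R c j k) has_sum f (p + h)) UNIV"
    using bspec[OF assms(1)[unfolded real_analytic_on_def] p] by blast
  obtain c' \<epsilon>' where c': "\<epsilon>' > 0" "\<And>h. norm h < \<epsilon>' \<Longrightarrow>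
     ((\<lambda>(j, k). (fst h ^ j * snd h ^ k) *\<^sub>R c' j k) has_sum g (p + h)) UNIV"
    using bspec[OF assms(2)[unfolded real_analytic_on_def] p] by blast
  show "\<exists>c. \<exists>\<epsilon>>0. \<forall>h. norm h < \<epsilon> \<longrightarrow>
      ((\<lambda>(j, k). (fst h ^ j * snd h ^ k) *\<^sub>R c j k) has_sum f (p + h) + g (p + h)) UNIV"
  proof (intro exI conjI allI impI)
    show "min \<epsilon> \<epsilon>' > 0"
      using c c' by simp
    show "((\<lambda>(j, k). (fst h ^ j * snd h ^ k) *\<^sub>R (\<lambda>j k. c j k + c' j k) j k) has_sum f (p + h) + g (p + h)) UNIV"
      if "norm h < min \<epsilon> \<epsilon>'" for h
      using has_sum_add[OF c(2) c'(2), of h h] that by (simp add: case_prod_unfold scaleR_add_right)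
  qed
qed

lemma real_analytic_on_linear:
  fixes L :: "real \<times> real \<Rightarrow> 'b::real_normed_vector"
  assumes "bounded_linear L"
  shows "real_analytic_on U L"
  unfolding real_analytic_on_def
proof
  interpret L: bounded_linear L
    by fact
  fix p :: "real \<times> real"
  define c where "c j k = (if (j, k) = (0, 0) then L p else if (j, k) = (1, 0) then L (1, 0)
      else if (j, k) = (0, 1) then L (0, 1) else 0)" for j k :: nat
  have "((\<lambda>(j, k). (fst h ^ j * snd h ^ k) *\<^sub>R c j k) has_sum L (p + h)) UNIV" for h
  proof -
    have "L (p + h) = L p + L (fst h *\<^sub>R (1, 0) + snd h *\<^sub>R (0, 1))"
      by (simp add: L.add)
    then have "L (p + h) = L p + fst h *\<^sub>R L (1, 0) + snd h *\<^sub>R L (0, 1)"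
      by (simp only: L.add L.scaleR add.assoc)
    then have "((\<lambda>(j, k). (fst h ^ j * snd h ^ k) *\<^sub>R c j k) has_sum L (p + h)) {(0, 0), (1, 0), (0, 1)}"
      by (intro has_sum_finiteI) (auto simp: c_def)
    then show ?thesis
      by (rule iffD1[OF has_sum_cong_neutral, rotated -1]) (auto simp: c_def split: if_splits)
  qed
  then show "\<exists>c. \<exists>\<epsilon>>0. \<forall>h. norm h < \<epsilon> \<longrightarrow>
      ((\<lambda>(j, k). (fst h ^ j * snd h ^ k) *\<^sub>R c j k) has_sum L (p + h)) UNIV"
    by (intro exI[of _ c] exI[of _ 1]) auto
qed

lemma real_analytic_on_times_coordinate:
  fixes f :: "real \<times> real \<Rightarrow> real"
  assumes "real_analytic_on U f"
  shows "real_analytic_on U (\<lambda>x. fst x * f x)" and "real_analytic_on U (\<lambda>x. snd x * f x)"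
proof -
  have shift: "((\<lambda>(j, k). (s ^ j * t ^ k) * (if j = 0 then 0 else c (j - 1) k)) has_sum s * X) UNIV"
    if "((\<lambda>(j, k). (s ^ j * t ^ k) * c j k) has_sum X) UNIV" for s t X :: real and c
    using has_sum_cmult_right[OF that, of s]
    by (subst has_sum_shift_index) (auto simp: case_prod_unfold mult_ac)
  have coord: "\<exists>c. \<exists>\<epsilon>>0. \<forall>h. norm h < \<epsilon> \<longrightarrow>
      ((\<lambda>(j, k). (fst h ^ j * snd h ^ k) *\<^sub>R c j k) has_sum fst (p + h) * f (p + h)) UNIV"
      "\<exists>c. \<exists>\<epsilon>>0. \<forall>h. norm h < \<epsilon> \<longrightarrow>
      ((\<lambda>(j, k). (fst h ^ j * snd h ^ k) *\<^sub>R c j k) has_sum snd (p + h) * f (p + h)) UNIV"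
    if p: "p \<in> U" for p
  proof -
    obtain c \<epsilon> where \<epsilon>: "\<epsilon> > 0" and c: "\<And>h. norm h < \<epsilon> \<Longrightarrow>
       ((\<lambda>(j, k). (fst h ^ j * snd h ^ k) * c j k) has_sum f (p + h)) UNIV"
      using bspec[OF assms[unfolded real_analytic_on_def] p] unfolding real_scaleR_def by blast
    have "((\<lambda>(j, k). (fst h ^ j * snd h ^ k) * (fst p * c j k + (if j = 0 then 0 else c (j - 1) k)))
        has_sum fst (p + h) * f (p + h)) UNIV" if "norm h < \<epsilon>" for h
      using has_sum_add[OF has_sum_cmult_right[OF c[OF that], of "fst p"] shift[OF c[OF that]]]
      by (simp add: case_prod_unfold distrib_left distrib_right mult_ac)
    then show "\<exists>c. \<exists>\<epsilon>>0. \<forall>h. norm h < \<epsilon> \<longrightarrow>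
      ((\<lambda>(j, k). (fst h ^ j * snd h ^ k) *\<^sub>R c j k) has_sum fst (p + h) * f (p + h)) UNIV"
      using \<epsilon> by (intro exI[of _ "\<lambda>j k. fst p * c j k + (if j = 0 then 0 else c (j - 1) k)"] exI[of _ \<epsilon>]) auto
    have "((\<lambda>(j, k). (fst h ^ j * snd h ^ k) * (snd p * c j k + (if k = 0 then 0 else c j (k - 1))))
        has_sum snd (p + h) * f (p + h)) UNIV" if "norm h < \<epsilon>" for h
    proof -
      have "((\<lambda>(k, j). (snd h ^ k * fst h ^ j) * c j k) has_sum f (p + h)) UNIV"
        using c[OF that] has_sum_swap_index[of "\<lambda>k j. (snd h ^ k * fst h ^ j) * c j k"]
        by (simp add: mult_ac)
      from shift[OF this]
      have "((\<lambda>(j, k). (fst h ^ j * snd h ^ k) * (if k = 0 then 0 else c j (k - 1))) has_sum snd h * f (p + h)) UNIV"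
        using has_sum_swap_index[of "\<lambda>k j. (snd h ^ k * fst h ^ j) * (if k = 0 then 0 else c j (k - 1))"]
        by (simp add: mult_ac)
      from has_sum_add[OF has_sum_cmult_right[OF c[OF that], of "snd p"] this]
      show ?thesis
        by (simp add: case_prod_unfold distrib_left distrib_right mult_ac)
    qed
    then show "\<exists>c. \<exists>\<epsilon>>0. \<forall>h. norm h < \<epsilon> \<longrightarrow>
      ((\<lambda>(j, k). (fst h ^ j * snd h ^ k) *\<^sub>R c j k) has_sum snd (p + h) * f (p + h)) UNIV"
      using \<epsilon> by (intro exI[of _ "\<lambda>j k. snd p * c j k + (if k = 0 then 0 else c j (k - 1))"] exI[of _ \<epsilon>]) auto
  qed
  then show "real_analytic_on U (\<lambda>x. fst x * f x)" "real_analytic_on U (\<lambda>x. snd x * f x)"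
    unfolding real_analytic_on_def by blast+
qed

lemma real_analytic_on_one: "real_analytic_on U (\<lambda>_. 1 :: real)"
  unfolding real_analytic_on_def
proof
  fix p :: "real \<times> real"
  have "((\<lambda>(j, k). (fst h ^ j * snd h ^ k) *\<^sub>R (if (j, k) = (0, 0) then 1 else 0 :: real)) has_sum 1) UNIV" for h :: "real \<times> real"
    by (rule iffD1[OF has_sum_cong_neutral, rotated -1, OF has_sum_finiteI[of "{(0, 0)}"]]) (auto split: if_splits)
  then show "\<exists>c. \<exists>\<epsilon>>0. \<forall>h :: real \<times> real. norm h < \<epsilon> \<longrightarrow>
      ((\<lambda>(j, k). (fst h ^ j * snd h ^ k) *\<^sub>R c j k) has_sum (1 :: real)) UNIV"
    by (intro exI[of _ "\<lambda>j k. if (j, k) = (0, 0) then 1 else 0"] exI[of _ 1]) auto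
qed

lemma regular_on_add:
  "open U \<Longrightarrow> regular_on r U f \<Longrightarrow> regular_on r U g \<Longrightarrow> regular_on r U (\<lambda>x. f x + g x)"
  by (cases r) (auto simp: regular_on_def intro: real_analytic_on_add smooth_on_add)

lemma regular_on_linear: "open U \<Longrightarrow> bounded_linear L \<Longrightarrow> regular_on r U L"
  by (cases r) (auto simp: regular_on_def intro: real_analytic_on_linear smooth_on_linear)

lemma regular_on_bounded_linear:
  "open U \<Longrightarrow> bounded_linear L \<Longrightarrow> regular_on r U f \<Longrightarrow> regular_on r U (\<lambda>x. L (f x))"
  by (cases r) (auto simp: regular_on_def intro: real_analytic_on_bounded_linear smooth_on_bounded_linear)

lemma regular_on_coordinate_power:
  assumes "open U"
  shows "regular_on r U (\<lambda>x. fst x ^ m)" and "regular_on r U (\<lambda>x. snd x ^ m)"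
proof -
  have "real_analytic_on U (\<lambda>x. fst x ^ m)" "real_analytic_on U (\<lambda>x. snd x ^ m)"
    by (induction m) (auto intro: real_analytic_on_one real_analytic_on_times_coordinate)
  then show "regular_on r U (\<lambda>x. fst x ^ m)" "regular_on r U (\<lambda>x. snd x ^ m)"
    using real_analytic_on_imp_smooth[OF assms]
    by (cases r; simp add: regular_on_def)+
qed

lemma regular_on_imp_smooth_component:
  fixes f :: "real \<times> real \<Rightarrow> 'b::real_normed_vector"
  assumes "open U" "regular_on r U f" "bounded_linear L"
  shows "smooth_on U (\<lambda>x. L (f x) :: real)"
  using regular_on_bounded_linear[OF assms(1,3,2)] real_analytic_on_imp_smooth[OF assms(1)]
  by (cases r) (auto simp: regular_on_def)

section \<open>Weighted homogeneous parts\<close>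

definition dilation :: "real \<Rightarrow> real \<Rightarrow> real \<times> real \<Rightarrow> real \<times> real" where
  "dilation m r x = (r * fst x, r powr m * snd x)"

definition weighted_line :: "real \<Rightarrow> real \<Rightarrow> (nat \<times> nat) set" where
  "weighted_line m b = {(j, k). real j + m * real k = b}"

definition weighted_part :: "real \<Rightarrow> real \<Rightarrow> (nat \<Rightarrow> nat \<Rightarrow> real) \<Rightarrow> real \<times> real \<Rightarrow> real" where
  "weighted_part m b c x = (\<Sum>(j, k)\<in>weighted_line m b. c j k * fst x ^ j * snd x ^ k)"

text \<open>The restriction of the weighted homogeneous part to the line \<open>x\<^sub>1 = 1\<close>, as a polynomial.  Nothing is
  lost: on a line of weights the exponent of \<open>x\<^sub>2\<close> determines the monomial.\<close>

definition weighted_slice :: "real \<Rightarrow> real \<Rightarrow> (nat \<Rightarrow> nat \<Rightarrow> real) \<Rightarrow> real poly" where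
  "weighted_slice m b c = (\<Sum>(j, k)\<in>weighted_line m b. monom (c j k) k)"

lemma weight_bounds:
  assumes "m \<ge> 1" "real j + m * real k \<le> b"
  shows "real j + real k \<le> b"
proof -
  have "1 * real k \<le> m * real k"
    using assms(1) by (intro mult_right_mono) auto
  then show ?thesis
    using assms(2) by simp
qed

lemma finite_weight_le: "m \<ge> 1 \<Longrightarrow> finite {(j, k). real j + m * real k \<le> b}"
proof (rule finite_subset[of _ "{..nat \<lfloor>b\<rfloor>} \<times> {..nat \<lfloor>b\<rfloor>}"])
  assume m: "m \<ge> 1"
  have "j \<le> nat \<lfloor>b\<rfloor> \<and> k \<le> nat \<lfloor>b\<rfloor>" if "real j + m * real k \<le> b" for j k
    using weight_bounds[OF m that] by (simp add: le_nat_floor)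
  then show "{(j, k). real j + m * real k \<le> b} \<subseteq> {..nat \<lfloor>b\<rfloor>} \<times> {..nat \<lfloor>b\<rfloor>}"
    by auto
qed simp

lemma finite_weighted_line: "m \<ge> 1 \<Longrightarrow> finite (weighted_line m b)"
  by (rule finite_subset[OF _ finite_weight_le[of m b]]) (auto simp: weighted_line_def)

text \<open>The minimum exists although the weight \<open>m\<close> is a real number, because only finitely many exponents lie
  below any given line.\<close>

lemma exists_minimal_weight:
  assumes "m \<ge> 1" "c j0 k0 \<noteq> (0::real)"
  obtains j k where "c j k \<noteq> 0" "real j + m * real k \<le> real j0 + m * real k0"
    "\<And>j' k'. c j' k' \<noteq> 0 \<Longrightarrow> real j + m * real k \<le> real j' + m * real k'"
proof -
  let ?w = "\<lambda>(j, k). real j + m * real k"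
  let ?S = "{(j, k). c j k \<noteq> 0 \<and> real j + m * real k \<le> real j0 + m * real k0}"
  have "finite ?S"
    by (rule finite_subset[OF _ finite_weight_le[OF assms(1), of "real j0 + m * real k0"]]) auto
  moreover have "?S \<noteq> {}"
    using assms(2) by auto
  ultimately obtain p where "p \<in> ?S" "\<forall>q\<in>?S. ?w p \<le> ?w q"
    using ex_min_if_finite[of "?w ` ?S"] by (metis (no_types, lifting) arg_min_if_finite(1) arg_min_least)
  then show ?thesis
    using that[of "fst p" "snd p"] by (fastforce simp: case_prod_unfold)
qed

lemma poly_weighted_slice: "poly (weighted_slice m b c) t = weighted_part m b c (1, t)"
  by (simp add: weighted_slice_def weighted_part_def poly_sum poly_monom case_prod_unfold)

lemma coeff_weighted_slice:
  assumes "m \<ge> 1" "real j + m * real k = b"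
  shows "coeff (weighted_slice m b c) k = c j k"
proof -
  have "coeff (weighted_slice m b c) k = (\<Sum>(j', k')\<in>weighted_line m b. if k' = k then c j' k' else 0)"
    by (simp add: weighted_slice_def coeff_sum case_prod_unfold)
  also have "\<dots> = (\<Sum>(j', k')\<in>{(j, k)}. if k' = k then c j' k' else 0)"
    using assms by (intro sum.mono_neutral_right finite_weighted_line) (auto simp: weighted_line_def split: if_splits)
  finally show ?thesis
    by simp
qed

lemma coeff_weighted_slice_nonzero:
  assumes "m \<ge> 1" "coeff (weighted_slice m b c) k \<noteq> 0"
  obtains j where "real j + m * real k = b" "c j k \<noteq> 0"
proof -
  have "\<exists>j. real j + m * real k = b \<and> c j k \<noteq> 0"
  proof (rule ccontr)
    assume "\<not> ?thesis"
    then have "coeff (monom (c (fst p) (snd p)) (snd p)) k = 0" if "p \<in> weighted_line m b" for p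
      using that by (auto simp: weighted_line_def)
    then have "coeff (weighted_slice m b c) k = 0"
      unfolding weighted_slice_def coeff_sum case_prod_unfold by (intro sum.neutral) blast
    with assms(2) show False
      by simp
  qed
  then show ?thesis
    using that by blast
qed

lemma weighted_part_eq_0:
  assumes "m \<ge> 1" "\<And>t. weighted_part m b c (1, t) = 0" "real j + m * real k = b"
  shows "c j k = 0"
proof -
  have "weighted_slice m b c = 0"
    using assms(2) poly_weighted_slice poly_all_0_iff_0 by metis
  then show ?thesis
    using coeff_weighted_slice[OF assms(1,3), of c] by simp
qed

lemma tendsto_powr_at_right_0: "a > 0 \<Longrightarrow> ((\<lambda>r::real. r powr a) \<longlongrightarrow> 0) (at_right 0)"
  by (rule tendsto_zero_powrI[where b = a])
    (auto intro: eventually_at_right_less[THEN eventually_mono] tendsto_ident_at)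

lemma norm_dilation_le:
  assumes "m \<ge> 1" "0 < r" "r < 1"
  shows "norm (dilation m r x) \<le> 2 * r * norm x"
proof -
  have "r powr m \<le> r powr 1"
    using assms by (intro powr_mono') auto
  then have "r powr m * \<bar>snd x\<bar> \<le> r * norm x"
    using assms norm_snd_le[of "snd x" "fst x"] by (intro mult_mono) auto
  moreover have "r * \<bar>fst x\<bar> \<le> r * norm x"
    using assms norm_fst_le[of "fst x" "snd x"] by (intro mult_left_mono) auto
  moreover have "norm (dilation m r x) \<le> r * \<bar>fst x\<bar> + r powr m * \<bar>snd x\<bar>"
    using norm_Pair_le[of "r * fst x" "r powr m * snd x"] assms
    by (simp add: dilation_def abs_mult)
  ultimately show ?thesis
    by linarith
qed

lemma eventually_at_right_0_less_1: "eventually (\<lambda>r::real. 0 < r \<and> r < 1) (at_right 0)"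
  by (simp add: eventually_at_right_field) (use zero_less_one in blast)

lemma bigo_along_dilation:
  assumes m: "m \<ge> 1" and R: "R \<in> O[nhds 0](\<lambda>x. norm x ^ N)" and b: "b < real N"
    and X: "(X \<longlongrightarrow> x) (at_right 0)"
  shows "((\<lambda>r. r powr (- b) * R (dilation m r (X r))) \<longlongrightarrow> (0::real)) (at_right 0)"
proof -
  obtain C where "C > 0" and C: "\<forall>\<^sub>F x in nhds 0. norm (R x) \<le> C * norm (norm x ^ N)"
    using landau_o.bigE[OF R] by blast
  have lim: "((\<lambda>r. 2 * r * norm (X r)) \<longlongrightarrow> 2 * 0 * norm x) (at_right 0)"
    by (intro tendsto_intros X)
  have "((\<lambda>r. dilation m r (X r)) \<longlongrightarrow> 0) (at_right 0)"
  proof (rule Lim_null_comparison)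
    show "\<forall>\<^sub>F r in at_right 0. norm (dilation m r (X r)) \<le> 2 * r * norm (X r)"
      using eventually_at_right_0_less_1 by eventually_elim (use norm_dilation_le[OF m] in auto)
    show "((\<lambda>r. 2 * r * norm (X r)) \<longlongrightarrow> 0) (at_right 0)"
      using lim by simp
  qed
  then have C': "\<forall>\<^sub>F r in at_right 0. norm (R (dilation m r (X r))) \<le> C * norm (norm (dilation m r (X r)) ^ N)"
    using C by (rule eventually_compose_filterlim[rotated])
  have "\<forall>\<^sub>F r in at_right 0. norm (r powr (- b) * R (dilation m r (X r))) \<le> r powr (real N - b) * (C * (2 * norm (X r)) ^ N)"
    using C' eventually_at_right_0_less_1
  proof eventually_elim
    case (elim r)
    have "norm (dilation m r (X r)) ^ N \<le> (2 * r * norm (X r)) ^ N"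
      using norm_dilation_le[OF m] elim by (intro power_mono) auto
    then have "C * norm (norm (dilation m r (X r)) ^ N) \<le> C * (2 * r * norm (X r)) ^ N"
      using \<open>C > 0\<close> by simp
    with elim have "norm (R (dilation m r (X r))) \<le> C * (2 * r * norm (X r)) ^ N"
      by linarith
    then have "norm (r powr (- b) * R (dilation m r (X r))) \<le> r powr (- b) * (C * (2 * r * norm (X r)) ^ N)"
      unfolding norm_mult by (intro mult_mono) auto
    also have "\<dots> = (r powr (- b) * r powr real N) * (C * (2 * norm (X r)) ^ N)"
      using elim by (simp add: powr_realpow power_mult_distrib mult_ac)
    also have "r powr (- b) * r powr real N = r powr (real N - b)"
      by (simp add: powr_add[symmetric])
    finally show ?case .
  qed
  moreover have "((\<lambda>r. r powr (real N - b) * (C * (2 * norm (X r)) ^ N)) \<longlongrightarrow> 0 * (C * (2 * norm x) ^ N)) (at_right 0)"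
    using b by (intro tendsto_intros X tendsto_powr_at_right_0) auto
  ultimately show ?thesis
    by (simp add: Lim_null_comparison)
qed

text \<open>Under the dilation by \<open>r\<close> a monomial of weight \<open>w\<close> acquires the factor \<open>r\<^sup>w\<close>, so that after division by
  \<open>r\<^sup>b\<close> only weight \<open>b\<close> survives.  The argument \<open>X\<close> may vary with \<open>r\<close>: this is what makes the
  statement applicable to compositions.\<close>

lemma weighted_limit:
  assumes f: "expansion f c" and m: "m \<ge> 1"
    and supp: "\<And>j k. c j k \<noteq> 0 \<Longrightarrow> b \<le> real j + m * real k"
    and X: "(X \<longlongrightarrow> x) (at_right 0)"
  shows "((\<lambda>r. r powr (- b) * f (dilation m r (X r))) \<longlongrightarrow> weighted_part m b c x) (at_right 0)"
proof -
  define N where "N = nat \<lceil>b\<rceil> + 1"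
  have N: "b < real N"
    by (simp add: N_def) linarith
  define R where "R x = f x - taylor_sum c N x" for x
  have R: "((\<lambda>r. r powr (- b) * R (dilation m r (X r))) \<longlongrightarrow> 0) (at_right 0)"
    by (rule bigo_along_dilation[OF m _ N X]) (use f in \<open>simp add: expansion_def R_def[abs_def]\<close>)
  have mono: "((\<lambda>r. r powr (real j + m * real k - b) * (c j k * fst (X r) ^ j * snd (X r) ^ k)) \<longlongrightarrow>
      (if (j, k) \<in> weighted_line m b then c j k * fst x ^ j * snd x ^ k else 0)) (at_right 0)" for j k
  proof (cases "c j k = 0 \<or> (j, k) \<in> weighted_line m b")
    case True
    have lim: "((\<lambda>r. c j k * fst (X r) ^ j * snd (X r) ^ k) \<longlongrightarrow> c j k * fst x ^ j * snd x ^ k) (at_right 0)"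
      by (intro tendsto_intros X)
    have ev: "\<forall>\<^sub>F r in at_right 0. r powr (real j + m * real k - b) * (c j k * fst (X r) ^ j * snd (X r) ^ k)
        = c j k * fst (X r) ^ j * snd (X r) ^ k"
      using eventually_at_right_0_less_1
      by eventually_elim (use True in \<open>auto simp: weighted_line_def\<close>)
    from iffD2[OF tendsto_cong[OF ev] lim]
    have "((\<lambda>r. r powr (real j + m * real k - b) * (c j k * fst (X r) ^ j * snd (X r) ^ k)) \<longlongrightarrow> c j k * fst x ^ j * snd x ^ k) (at_right 0)" .
    then show ?thesis
      using True by (auto split: if_splits)
  next
    case False
    then have "real j + m * real k - b > 0"
      using supp[of j k] by (auto simp: weighted_line_def)
    then have "((\<lambda>r. r powr (real j + m * real k - b) * (c j k * fst (X r) ^ j * snd (X r) ^ k)) \<longlongrightarrow>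
        0 * (c j k * fst x ^ j * snd x ^ k)) (at_right 0)"
      by (intro tendsto_intros X tendsto_powr_at_right_0)
    then show ?thesis
      using False by simp
  qed
  have "((\<lambda>r. (\<Sum>(j, k)\<in>{(j, k). j + k < N}. r powr (real j + m * real k - b) * (c j k * fst (X r) ^ j * snd (X r) ^ k))
       + r powr (- b) * R (dilation m r (X r))) \<longlongrightarrow>
     (\<Sum>(j, k)\<in>{(j, k). j + k < N}. if (j, k) \<in> weighted_line m b then c j k * fst x ^ j * snd x ^ k else 0) + 0) (at_right 0)"
    unfolding case_prod_beta
    by (intro tendsto_add tendsto_sum R mono)
  moreover have "(\<Sum>(j, k)\<in>{(j, k). j + k < N}. if (j, k) \<in> weighted_line m b then c j k * fst x ^ j * snd x ^ k else 0)
     = weighted_part m b c x"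
  proof -
    have "j + k < N" if "(j, k) \<in> weighted_line m b" for j k
      using weight_bounds[OF m, of j k b] that N by (auto simp: weighted_line_def)
    then have "weighted_line m b \<subseteq> {(j, k). j + k < N}"
      by auto
    then show ?thesis
      unfolding weighted_part_def
      by (intro sum.mono_neutral_cong_right finite_total_degree_less) auto
  qed
  moreover have "\<forall>\<^sub>F r in at_right 0. (\<Sum>(j, k)\<in>{(j, k). j + k < N}. r powr (real j + m * real k - b) * (c j k * fst (X r) ^ j * snd (X r) ^ k))
       + r powr (- b) * R (dilation m r (X r)) = r powr (- b) * f (dilation m r (X r))"
    using eventually_at_right_0_less_1
  proof eventually_elim
    case (elim r)
    have rescale: "r powr (- b) * (c j k * fst (dilation m r (X r)) ^ j * snd (dilation m r (X r)) ^ k) =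
        r powr (real j + m * real k - b) * (c j k * fst (X r) ^ j * snd (X r) ^ k)" for j k
    proof -
      have "r powr (real j + m * real k - b) = r powr (- b) * r powr real j * r powr (m * real k)"
        by (simp add: powr_add[symmetric] algebra_simps)
      also have "\<dots> = r powr (- b) * r ^ j * (r powr m) ^ k"
        using elim by (simp add: powr_realpow powr_powr[symmetric])
      finally show ?thesis
        by (simp add: dilation_def power_mult_distrib)
    qed
    have "r powr (- b) * taylor_sum c N (dilation m r (X r))
        = (\<Sum>(j, k)\<in>{(j, k). j + k < N}. r powr (real j + m * real k - b) * (c j k * fst (X r) ^ j * snd (X r) ^ k))"
      unfolding sum_distrib_left case_prod_beta rescale ..
    then show ?case
      unfolding R_def right_diff_distrib by simp
  qed
  ultimately show ?thesis
    by (simp add: tendsto_cong)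
qed

text \<open>A nonzero part of a weight \<open>b' < b\<close> would be the limit of \<open>r powr (b - b')\<close> times a convergent quantity,
  hence 0.\<close>

lemma weighted_limit_converse:
  assumes f: "expansion f c" and m: "m \<ge> 1"
    and lim: "\<And>x. ((\<lambda>r. r powr (- b) * f (dilation m r x)) \<longlongrightarrow> L x) (at_right 0)"
  shows "c j k \<noteq> 0 \<Longrightarrow> b \<le> real j + m * real k" and "weighted_part m b c x = L x"
proof -
  show supp: "b \<le> real j + m * real k" if nz: "c j k \<noteq> 0" for j k
  proof (rule ccontr)
    assume small: "\<not> ?thesis"
    obtain j' k' where jk: "c j' k' \<noteq> 0" "real j' + m * real k' \<le> real j + m * real k"
      "\<And>i l. c i l \<noteq> 0 \<Longrightarrow> real j' + m * real k' \<le> real i + m * real l"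
      using exists_minimal_weight[of m c, OF m nz] by blast
    define b' where "b' = real j' + m * real k'"
    have b': "b' < b"
      using jk(2) small by (simp add: b'_def)
    have "weighted_part m b' c x = 0" for x
    proof (rule tendsto_unique)
      show "((\<lambda>r. r powr (- b') * f (dilation m r x)) \<longlongrightarrow> weighted_part m b' c x) (at_right 0)"
        by (rule weighted_limit[OF f m]) (use jk(3) in \<open>auto simp: b'_def\<close>)
      have "((\<lambda>r. r powr (b - b') * (r powr (- b) * f (dilation m r x))) \<longlongrightarrow> 0 * L x) (at_right 0)"
        by (intro tendsto_mult tendsto_powr_at_right_0 lim) (use b' in auto)
      then show "((\<lambda>r. r powr (- b') * f (dilation m r x)) \<longlongrightarrow> 0) (at_right 0)"
        by (simp add: mult.assoc[symmetric] powr_add[symmetric])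
    qed simp
    then have "c j' k' = 0"
      by (rule weighted_part_eq_0[OF m, of b' c j' k']) (simp add: b'_def)
    with jk(1) show False ..
  qed
  show "weighted_part m b c x = L x"
    by (rule tendsto_unique[OF _ weighted_limit[OF f m supp] lim]) auto
qed

lemma expansion_bigo_imp_coeff_0:
  assumes f: "expansion f c" and O: "f \<in> O[nhds 0](\<lambda>x. norm x ^ K)" and "j + k < K"
  shows "c j k = 0"
proof (rule ccontr)
  assume "c j k \<noteq> 0"
  have "((\<lambda>r. r powr (- (real j + real k + 1 / 2)) * f (dilation 1 r x)) \<longlongrightarrow> 0) (at_right 0)" for x
    using assms(3) by (intro bigo_along_dilation[OF _ O]) auto
  from weighted_limit_converse(1)[OF f order_refl this \<open>c j k \<noteq> 0\<close>]
  show False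
    by simp
qed

lemma expansion_imp_bigo:
  assumes "expansion f c" "\<And>j k. j + k < K \<Longrightarrow> c j k = 0"
  shows "f \<in> O[nhds 0](\<lambda>x. norm x ^ K)"
proof -
  have "taylor_sum c K x = 0" for x :: "real \<times> real"
    by (rule sum.neutral) (use assms(2) in auto)
  then show ?thesis
    using assms(1) unfolding expansion_def by (metis (no_types, lifting) diff_zero landau_o.big.cong_ex(1) ext)
qed

lemma expansion_diff:
  assumes "expansion f c" "expansion g d"
  shows "expansion (\<lambda>x. f x - g x) (\<lambda>j k. c j k - d j k)"
  unfolding expansion_def
proof
  fix N
  have "(\<lambda>x. (f x - taylor_sum c N x)
      - (g x - taylor_sum d N x)) \<in> O[nhds 0](\<lambda>x. norm x ^ N)"
    by (rule sum_in_bigo) (use assms in \<open>auto simp: expansion_def\<close>)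
  then show "(\<lambda>x. f x - g x - taylor_sum (\<lambda>j k. c j k - d j k) N x) \<in> O[nhds 0](\<lambda>x. norm x ^ N)"
    by (simp add: case_prod_unfold left_diff_distrib sum_subtractf algebra_simps)
qed

lemma expansion_unique:
  assumes "expansion f c" "expansion f d"
  shows "c = d"
proof (intro ext)
  fix j k
  have "expansion (\<lambda>x. 0) (\<lambda>j k. c j k - d j k)"
    using expansion_diff[OF assms] by simp
  from expansion_bigo_imp_coeff_0[OF this, of "j + k + 1" j k]
  show "c j k = d j k"
    by simp
qed

lemma expansion_finite_sum:
  assumes "finite A"
  shows "expansion (\<lambda>x. \<Sum>(j, k)\<in>A. c j k * fst x ^ j * snd x ^ k) (\<lambda>j k. if (j, k) \<in> A then c j k else 0)"
  unfolding expansion_def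
proof
  fix N
  let ?m = "\<lambda>x (j, k). c j k * fst x ^ j * snd x ^ k :: real"
  have eq: "(\<Sum>(j, k)\<in>A. c j k * fst x ^ j * snd x ^ k)
      - taylor_sum (\<lambda>j k. if (j, k) \<in> A then c j k else 0) N x
      = (\<Sum>jk\<in>A - {(j, k). j + k < N}. ?m x jk)" for x :: "real \<times> real"
  proof -
    have "taylor_sum (\<lambda>j k. if (j, k) \<in> A then c j k else 0) N x
        = (\<Sum>jk\<in>A \<inter> {(j, k). j + k < N}. ?m x jk)"
      by (rule sum.mono_neutral_cong_right[OF finite_total_degree_less]) (auto split: if_splits)
    moreover have "sum (?m x) A = sum (?m x) (A \<inter> {(j, k). j + k < N}) + sum (?m x) (A - {(j, k). j + k < N})"
      using sum.Int_Diff[OF assms] by blast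
    ultimately show ?thesis
      by simp
  qed
  have "(\<lambda>x. \<Sum>jk\<in>A - {(j, k). j + k < N}. ?m x jk) \<in> O[nhds 0](\<lambda>x. norm x ^ N)"
  proof (rule big_sum_in_bigo)
    fix jk assume "jk \<in> A - {(j, k). j + k < N}"
    then obtain j k where jk: "jk = (j, k)" "N \<le> j + k"
      by (cases jk) auto
    have ev: "eventually (\<lambda>x. norm x < 1) (nhds (0 :: real \<times> real))"
      using eventually_nhds_in_open[of "ball 0 1" "0 :: real \<times> real"] by simp
    show "(\<lambda>x. ?m x jk) \<in> O[nhds 0](\<lambda>x. norm x ^ N)"
    proof (rule bigoI[of _ "\<bar>c j k\<bar>"], use ev in eventually_elim)
      case (elim x)
      have "\<bar>fst x\<bar> ^ j * \<bar>snd x\<bar> ^ k \<le> norm x ^ (j + k)"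
        by (rule mult_power_le_norm_power) simp
      also have "\<dots> \<le> norm x ^ N"
        using elim jk(2) by (intro power_decreasing) auto
      finally have "\<bar>c j k\<bar> * (\<bar>fst x\<bar> ^ j * \<bar>snd x\<bar> ^ k) \<le> \<bar>c j k\<bar> * norm x ^ N"
        by (rule mult_left_mono) auto
      then show ?case
        by (simp add: jk(1) abs_mult power_abs)
    qed
  qed
  then show "(\<lambda>x. (\<Sum>(j, k)\<in>A. c j k * fst x ^ j * snd x ^ k)
      - taylor_sum (\<lambda>j k. if (j, k) \<in> A then c j k else 0) N x)
      \<in> O[nhds 0](\<lambda>x. norm x ^ N)"
    by (simp only: eq)
qed

lemma taylor_coeff_eqI:
  fixes f :: "real \<times> real \<Rightarrow> real"
  assumes "open U" "p \<in> U" "smooth_on U f" "expansion (\<lambda>h. f (p + h)) c"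
  shows "taylor_coeff f p = c"
  using expansion_unique[OF taylor_expansion[OF assms(1-3)] assms(4)] .

text \<open>The transformation rule for weighted parts under a change of variables \<open>\<phi>\<close> whose rescalings converge
  to \<open>\<Phi>\<close>.  Convergence of the rescaled \<open>g\<close> yields at once that its support lies above the line of
  weight \<open>b\<close> and what its weighted part is.\<close>

lemma weighted_part_compose:
  assumes f: "expansion f c" and g: "expansion g d" and m: "m \<ge> 1"
    and supp: "\<And>j k. c j k \<noteq> 0 \<Longrightarrow> b \<le> real j + m * real k"
    and gf: "eventually (\<lambda>y. g y = f (\<phi> y)) (nhds 0)"
    and \<Phi>: "\<And>y. ((\<lambda>r. (fst (\<phi> (dilation m r y)) / r, snd (\<phi> (dilation m r y)) / r powr m)) \<longlongrightarrow> \<Phi> y) (at_right 0)"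
  shows "d j k \<noteq> 0 \<Longrightarrow> b \<le> real j + m * real k" and "weighted_part m b d y = weighted_part m b c (\<Phi> y)"
proof -
  have lim: "((\<lambda>r. r powr (- b) * g (dilation m r y)) \<longlongrightarrow> weighted_part m b c (\<Phi> y)) (at_right 0)" for y
  proof -
    have "((\<lambda>r. dilation m r y) \<longlongrightarrow> 0) (at_right 0)"
    proof (rule Lim_null_comparison)
      show "\<forall>\<^sub>F r in at_right 0. norm (dilation m r y) \<le> 2 * r * norm y"
        using eventually_at_right_0_less_1 by eventually_elim (use norm_dilation_le[OF m] in auto)
      have "((\<lambda>r. 2 * r * norm y) \<longlongrightarrow> 2 * 0 * norm y) (at_right 0)"
        by (intro tendsto_intros)
      then show "((\<lambda>r. 2 * r * norm y) \<longlongrightarrow> 0) (at_right 0)"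
        by simp
    qed
    then have "\<forall>\<^sub>F r in at_right 0. g (dilation m r y) = f (\<phi> (dilation m r y))"
      using gf by (rule eventually_compose_filterlim[rotated])
    then have "\<forall>\<^sub>F r in at_right 0. r powr (- b) * f (dilation m r (fst (\<phi> (dilation m r y)) / r, snd (\<phi> (dilation m r y)) / r powr m))
        = r powr (- b) * g (dilation m r y)"
      using eventually_at_right_0_less_1
    proof eventually_elim
      case (elim r)
      have "dilation m r (fst x / r, snd x / r powr m) = x" for x
        using elim by (simp add: dilation_def)
      then show ?case
        using elim by simp
    qed
    with weighted_limit[OF f m supp \<Phi>[of y]] show ?thesis
      by (simp add: tendsto_cong)
  qed
  show "d j k \<noteq> 0 \<Longrightarrow> b \<le> real j + m * real k"
    using weighted_limit_converse(1)[OF g m lim] .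
  show "weighted_part m b d y = weighted_part m b c (\<Phi> y)"
    using weighted_limit_converse(2)[OF g m lim] .
qed

section \<open>The Newton polyhedron and its distance\<close>

abbreviation quadrants :: "(nat \<times> nat) set \<Rightarrow> (real \<times> real) set" where
  "quadrants S \<equiv> (\<Union>(j, k)\<in>S. {(t1, t2). real j \<le> t1 \<and> real k \<le> t2})"

lemma convex_newton_polyhedron: "convex (newton_polyhedron f)"
  by (simp add: newton_polyhedron_def convex_convex_hull)

lemma support_in_newton_polyhedron:
  "(j, k) \<in> taylor_support f \<Longrightarrow> (real j, real k) \<in> newton_polyhedron f"
  unfolding newton_polyhedron_def by (rule hull_inc) auto

lemma newton_polyhedron_upward:
  assumes "x \<in> newton_polyhedron f" "fst x \<le> fst y" "snd x \<le> snd y"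
  shows "y \<in> newton_polyhedron f"
proof -
  let ?Q = "quadrants (taylor_support f)"
  have "(+) (y - x) ` ?Q \<subseteq> ?Q"
  proof
    fix z assume "z \<in> (+) (y - x) ` ?Q"
    then obtain j k w where "(j, k) \<in> taylor_support f" "real j \<le> fst w" "real k \<le> snd w" "z = y - x + w"
      by auto
    then have "(j, k) \<in> taylor_support f" "real j \<le> fst z" "real k \<le> snd z"
      using assms(2,3) by auto
    then show "z \<in> ?Q"
      by (cases z) auto
  qed
  then have "convex hull ((+) (y - x) ` ?Q) \<subseteq> convex hull ?Q"
    by (rule hull_mono)
  then have "(+) (y - x) ` (convex hull ?Q) \<subseteq> convex hull ?Q"
    by (simp only: convex_hull_translation)
  then have "(y - x) + x \<in> convex hull ?Q"
    using assms(1) unfolding newton_polyhedron_def by blast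
  then show ?thesis
    by (simp add: newton_polyhedron_def)
qed

lemma newton_polyhedron_halfspace:
  assumes "a1 \<ge> 0" "a2 \<ge> 0" "\<And>j k. (j, k) \<in> taylor_support f \<Longrightarrow> b \<le> a1 * real j + a2 * real k"
    and x: "x \<in> newton_polyhedron f"
  shows "b \<le> a1 * fst x + a2 * snd x"
proof -
  have "quadrants (taylor_support f) \<subseteq> {x. (a1, a2) \<bullet> x \<ge> b}"
  proof
    fix t assume "t \<in> quadrants (taylor_support f)"
    then obtain j k where jk: "(j, k) \<in> taylor_support f" "real j \<le> fst t" "real k \<le> snd t"
      by auto
    have "a1 * real j + a2 * real k \<le> a1 * fst t + a2 * snd t"
      using jk assms(1,2) by (intro add_mono mult_left_mono)
    then show "t \<in> {x. (a1, a2) \<bullet> x \<ge> b}"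
      using assms(3)[OF jk(1)] by (simp add: inner_prod_def)
  qed
  then have "newton_polyhedron f \<subseteq> {x. (a1, a2) \<bullet> x \<ge> b}"
    unfolding newton_polyhedron_def by (rule hull_minimal) (rule convex_halfspace_ge)
  then show ?thesis
    using x by (auto simp: inner_prod_def)
qed

lemma newton_polyhedron_nonneg:
  assumes "x \<in> newton_polyhedron f"
  shows "0 \<le> fst x" "0 \<le> snd x"
  using newton_polyhedron_halfspace[of 1 0 f 0 x] newton_polyhedron_halfspace[of 0 1 f 0 x] assms by auto

lemma supporting_functional_nonneg:
  assumes "finite_type f" "\<And>x. x \<in> newton_polyhedron f \<Longrightarrow> b \<le> a \<bullet> x"
  shows "0 \<le> fst a" "0 \<le> snd a"
proof -
  obtain j k where "(j, k) \<in> taylor_support f"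
    using assms(1) by (auto simp: finite_type_def)
  then have x: "(real j, real k) \<in> newton_polyhedron f"
    by (rule support_in_newton_polyhedron)
  have nonneg: "0 \<le> s" if "\<And>t. t \<ge> 0 \<Longrightarrow> b \<le> y + s * t" for s y :: real
  proof (rule ccontr)
    assume s: "\<not> 0 \<le> s"
    have "b \<le> y + s * ((\<bar>y - b\<bar> + 1) / (- s))"
      using s by (intro that divide_nonneg_nonneg) auto
    also have "\<dots> = y - (\<bar>y - b\<bar> + 1)"
      using s by (simp add: field_simps)
    finally show False
      by linarith
  qed
  show "0 \<le> fst a"
  proof (rule nonneg[of "a \<bullet> (real j, real k)"])
    fix t :: real assume "t \<ge> 0"
    have "b \<le> a \<bullet> (real j + t, real k)"
      by (rule assms(2), rule newton_polyhedron_upward[OF x]) (use \<open>t \<ge> 0\<close> in auto)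
    then show "b \<le> a \<bullet> (real j, real k) + fst a * t"
      by (simp add: inner_prod_def algebra_simps)
  qed
  show "0 \<le> snd a"
  proof (rule nonneg[of "a \<bullet> (real j, real k)"])
    fix t :: real assume "t \<ge> 0"
    have "b \<le> a \<bullet> (real j, real k + t)"
      by (rule assms(2), rule newton_polyhedron_upward[OF x]) (use \<open>t \<ge> 0\<close> in auto)
    then show "b \<le> a \<bullet> (real j, real k) + snd a * t"
      by (simp add: inner_prod_def algebra_simps)
  qed
qed

text \<open>The polyhedron is closed under increasing the coordinates, so the diagonal enters its interior
  immediately after it has entered its closure; this is why the distance is well defined.\<close>

lemma diagonal_threshold:
  assumes above: "\<And>t. t > d \<Longrightarrow> (t, t) \<in> newton_polyhedron f"
    and below: "\<And>t. t < d \<Longrightarrow> (t, t) \<notin> newton_polyhedron f"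
  shows "newton_distance f = d" "(d, d) \<in> closure (newton_polyhedron f)"
    "(d, d) \<notin> interior (newton_polyhedron f)" "interior (newton_polyhedron f) \<noteq> {}"
proof -
  let ?N = "newton_polyhedron f"
  have int: "(t, t) \<in> interior ?N" if t: "t > d" for t
  proof -
    obtain s where s: "d < s" "s < t"
      using dense[OF t] by blast
    have "open ({s<..} \<times> {s<..} :: (real \<times> real) set)"
      by (intro open_Times) auto
    moreover have "{s<..} \<times> {s<..} \<subseteq> ?N"
      using newton_polyhedron_upward[OF above[OF s(1)]] by auto
    ultimately show ?thesis
      using s(2) by (auto intro: interiorI)
  qed
  have ext: "(t, t) \<notin> closure ?N" if t: "t < d" for t
  proof -
    obtain s where s: "t < s" "s < d"
      using dense[OF t] by blast
    have "open ({..<s} \<times> {..<s} :: (real \<times> real) set)"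
      by (intro open_Times) auto
    moreover have "({..<s} \<times> {..<s}) \<inter> ?N = {}"
    proof -
      have "(s, s) \<in> ?N" if "x \<in> ?N" "fst x < s" "snd x < s" for x
        by (rule newton_polyhedron_upward[OF that(1)]) (use that in auto)
      then show ?thesis
        using below[OF s(2)] by auto
    qed
    ultimately have "({..<s} \<times> {..<s}) \<inter> closure ?N = {}"
      using open_Int_closure_eq_empty by metis
    then show ?thesis
      using s(1) by auto
  qed
  have dist: "dist (d + s, d + s) (d, d) \<le> 2 * \<bar>s\<bar>" for s
    using norm_Pair_le[of s s] by (simp add: dist_norm)
  show cl: "(d, d) \<in> closure ?N"
    unfolding closure_approachable
  proof (intro allI impI)
    fix e :: real assume "e > 0"
    then have "(d + e / 3, d + e / 3) \<in> ?N" "dist (d + e / 3, d + e / 3) (d, d) < e"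
      using above[of "d + e / 3"] dist[of "e / 3"] by auto
    then show "\<exists>y\<in>?N. dist y (d, d) < e"
      by blast
  qed
  show not_int: "(d, d) \<notin> interior ?N"
  proof
    assume "(d, d) \<in> interior ?N"
    then obtain e where e: "e > 0" "ball (d, d) e \<subseteq> ?N"
      using mem_interior by blast
    then have "(d + - e / 3, d + - e / 3) \<in> ?N"
      using dist[of "- e / 3"] by (intro subsetD[OF e(2)]) (auto simp: dist_commute)
    then show False
      using below[of "d - e / 3"] e(1) by simp
  qed
  show "interior ?N \<noteq> {}"
    using int[of "d + 1"] by auto
  have "t = d" if "(t, t) \<in> frontier ?N" for t
    using that int[of t] ext[of t] linorder_less_linear[of t d] unfolding frontier_def by blast
  moreover have "(d, d) \<in> frontier ?N"
    using cl not_int by (simp add: frontier_def)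
  ultimately show "newton_distance f = d"
    unfolding newton_distance_def by (rule the_equality[rotated])
qed

lemma newton_distance_threshold:
  assumes "finite_type f"
  shows "t > newton_distance f \<Longrightarrow> (t, t) \<in> newton_polyhedron f"
    and "t < newton_distance f \<Longrightarrow> (t, t) \<notin> newton_polyhedron f"
proof -
  let ?T = "{t. (t, t) \<in> newton_polyhedron f}"
  obtain j k where jk: "(j, k) \<in> taylor_support f"
    using assms by (auto simp: finite_type_def)
  have "(real (max j k), real (max j k)) \<in> newton_polyhedron f"
    by (rule newton_polyhedron_upward[OF support_in_newton_polyhedron[OF jk]]) auto
  then have ne: "?T \<noteq> {}"
    by auto
  have bdd: "bdd_below ?T"
    by (rule bdd_belowI[of _ 0]) (use newton_polyhedron_nonneg(1) in fastforce)
  have above: "(t, t) \<in> newton_polyhedron f" if t: "t > Inf ?T" for t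
  proof -
    obtain s where "s \<in> ?T" "s < t"
      using t cInf_less_iff[OF ne bdd] by blast
    then show ?thesis
      using newton_polyhedron_upward[of "(s, s)" f "(t, t)"] by auto
  qed
  have below: "(t, t) \<notin> newton_polyhedron f" if "t < Inf ?T" for t
    using that cInf_lower[OF _ bdd, of t] by auto
  have nd: "newton_distance f = Inf ?T"
    by (rule diagonal_threshold(1)[OF above below])
  show "t > newton_distance f \<Longrightarrow> (t, t) \<in> newton_polyhedron f"
    unfolding nd by (rule above)
  show "t < newton_distance f \<Longrightarrow> (t, t) \<notin> newton_polyhedron f"
    unfolding nd by (rule below)
qed

lemma newton_distance_ge:
  assumes f: "finite_type f" and a: "a1 \<ge> 0" "a2 \<ge> 0" "a1 + a2 > 0"
    and supp: "\<And>j k. (j, k) \<in> taylor_support f \<Longrightarrow> D * (a1 + a2) \<le> a1 * real j + a2 * real k"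
  shows "D \<le> newton_distance f"
proof (rule ccontr)
  assume "\<not> ?thesis"
  then obtain t where t: "newton_distance f < t" "t < D"
    using dense not_le by blast
  have "D * (a1 + a2) \<le> a1 * t + a2 * t"
    using newton_polyhedron_halfspace[OF a(1,2) supp newton_distance_threshold(1)[OF f t(1)]] by simp
  also have "\<dots> = t * (a1 + a2)"
    by (simp add: algebra_simps)
  finally show False
    using t(2) a(3) by simp
qed

lemma newton_distance_nonneg: "finite_type f \<Longrightarrow> 0 \<le> newton_distance f"
  by (rule newton_distance_ge[of f 1 0]) auto

text \<open>A separating line for \<open>(D\<^sub>1, D\<^sub>1)\<close> with \<open>D < D\<^sub>1 < d(f)\<close> may be parallel to an axis; the slack
  \<open>D\<^sub>1 - D\<close> pays for tilting it so that both weights become positive.\<close>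

lemma separating_weight:
  assumes f: "finite_type f" and D: "D < newton_distance f"
  obtains a1 a2 where "a1 > 0" "a2 > 0"
    "\<And>j k. (j, k) \<in> taylor_support f \<Longrightarrow> D * (a1 + a2) \<le> a1 * real j + a2 * real k"
proof -
  \<comment> \<open>Midway between \<open>D\<close> and the distance in the only case that needs an argument, \<open>D > 0\<close>.\<close>
  define D1 where "D1 = (max D 0 + newton_distance f) / 2"
  show ?thesis
  proof (cases "D \<le> 0")
    case True
    then have "D * (1 + 1) \<le> 1 * real j + 1 * real k" for j k
      by (auto intro: order_trans[of _ 0])
    then show ?thesis
      using that[of 1 1] by auto
  next
    case False
    then have D1: "D < D1" "D1 < newton_distance f" "0 < D1"
      using D by (auto simp: D1_def)
    have "\<exists>a b. a \<noteq> 0 \<and> (\<forall>x\<in>{(D1, D1)}. a \<bullet> x \<le> b) \<and> (\<forall>x\<in>newton_polyhedron f. b \<le> a \<bullet> x)"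
    proof (rule separating_hyperplane_sets)
      show "newton_polyhedron f \<noteq> {}"
        using f support_in_newton_polyhedron by (fastforce simp: finite_type_def)
    qed (use newton_distance_threshold(2)[OF f D1(2)] convex_newton_polyhedron in auto)
    then obtain a b where a: "a \<noteq> 0" "a \<bullet> (D1, D1) \<le> b" "\<And>x. x \<in> newton_polyhedron f \<Longrightarrow> b \<le> a \<bullet> x"
      by blast
    have nn: "0 \<le> fst a" "0 \<le> snd a"
      using supporting_functional_nonneg[OF f a(3)] by auto
    define s where "s = fst a + snd a"
    have s: "s > 0"
      using nn a(1) by (cases a) (auto simp: s_def zero_prod_def)
    \<comment> \<open>Chosen such that \<open>D (s + 2 e) = D\<^sub>1 s\<close>.\<close>
    define e where "e = (D1 - D) / D * s / 2"
    have e: "e > 0"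
      using D1 False s by (simp add: e_def)
    show ?thesis
    proof (rule that[of "fst a + e" "snd a + e"])
      fix j k assume jk: "(j, k) \<in> taylor_support f"
      have "D1 * s \<le> a \<bullet> (real j, real k)"
        using a(2) a(3)[OF support_in_newton_polyhedron[OF jk]]
        by (simp add: inner_prod_def s_def algebra_simps)
      moreover have "D * (fst a + e + (snd a + e)) = D1 * s"
        using False by (simp add: e_def s_def field_simps)
      moreover have "a \<bullet> (real j, real k) \<le> (fst a + e) * real j + (snd a + e) * real k"
        using e by (simp add: inner_prod_def algebra_simps)
      ultimately show "D * (fst a + e + (snd a + e)) \<le> (fst a + e) * real j + (snd a + e) * real k"
        by linarith
    qed (use nn e in auto)
  qed
qed

text \<open>Dickson's lemma in dimension two: the points not above a chosen \<open>(j\<^sub>0, k\<^sub>0)\<close> lie on finitely many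
  vertical and horizontal lines, each of which has a lowest point.\<close>

lemma finite_dominating_subset:
  fixes S :: "(nat \<times> nat) set"
  obtains T where "T \<subseteq> S" "finite T" "\<And>j k. (j, k) \<in> S \<Longrightarrow> \<exists>(j', k')\<in>T. j' \<le> j \<and> k' \<le> k"
proof (cases "S = {}")
  case False
  then obtain j0 k0 where jk0: "(j0, k0) \<in> S"
    by auto
  define A where "A = (\<lambda>j. (j, LEAST k. (j, k) \<in> S)) ` {j. j < j0 \<and> (\<exists>k. (j, k) \<in> S)}"
  define B where "B = (\<lambda>k. (LEAST j. (j, k) \<in> S, k)) ` {k. k < k0 \<and> (\<exists>j. (j, k) \<in> S)}"
  show ?thesis
  proof (rule that[of "insert (j0, k0) (A \<union> B)"])
    show "insert (j0, k0) (A \<union> B) \<subseteq> S"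
      using jk0 by (auto simp: A_def B_def intro: LeastI)
    show "finite (insert (j0, k0) (A \<union> B))"
      by (simp add: A_def B_def)
    fix j k assume jk: "(j, k) \<in> S"
    consider "j < j0" | "k < k0" | "j0 \<le> j" "k0 \<le> k"
      by linarith
    then show "\<exists>(j', k')\<in>insert (j0, k0) (A \<union> B). j' \<le> j \<and> k' \<le> k"
    proof cases
      case 1
      then have "(j, LEAST k. (j, k) \<in> S) \<in> A"
        using jk by (auto simp: A_def)
      moreover have "(LEAST k. (j, k) \<in> S) \<le> k"
        using jk by (rule Least_le)
      ultimately show ?thesis
        by blast
    next
      case 2
      then have "(LEAST j. (j, k) \<in> S, k) \<in> B"
        using jk by (auto simp: B_def)
      moreover have "(LEAST j. (j, k) \<in> S) \<le> j"
        using jk by (rule Least_le)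
      ultimately show ?thesis
        by blast
    qed auto
  qed
qed (use that in blast)

text \<open>By Dickson's lemma the polyhedron is the sum of a polytope and the positive quadrant.\<close>

lemma closed_newton_polyhedron: "closed (newton_polyhedron f)"
proof -
  obtain T where T: "T \<subseteq> taylor_support f" "finite T"
    "\<And>j k. (j, k) \<in> taylor_support f \<Longrightarrow> \<exists>(j', k')\<in>T. j' \<le> j \<and> k' \<le> k"
    using finite_dominating_subset by blast
  define V where "V = (\<lambda>(j, k). (real j, real k)) ` T"
  define Q :: "(real \<times> real) set" where "Q = {0..} \<times> {0..}"
  have "quadrants (taylor_support f) = (\<Union>x\<in>V. \<Union>y\<in>Q. {x + y})"
  proof (intro equalityI subsetI)
    fix x assume "x \<in> quadrants (taylor_support f)"
    then obtain j k where jk: "(j, k) \<in> taylor_support f" "real j \<le> fst x" "real k \<le> snd x"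
      by auto
    then obtain j' k' where T': "(j', k') \<in> T" "j' \<le> j" "k' \<le> k"
      using T(3) by blast
    have "x = (real j', real k') + (x - (real j', real k'))" "x - (real j', real k') \<in> Q"
      using jk T' by (auto simp: Q_def mem_Times_iff)
    moreover have "(real j', real k') \<in> V"
      using T'(1) by (force simp: V_def)
    ultimately show "x \<in> (\<Union>x\<in>V. \<Union>y\<in>Q. {x + y})"
      by blast
  next
    fix x assume "x \<in> (\<Union>x\<in>V. \<Union>y\<in>Q. {x + y})"
    then show "x \<in> quadrants (taylor_support f)"
      using T(1) by (force simp: V_def Q_def)
  qed
  also have "\<dots> = V + Q"
    by (auto simp: set_plus_def)
  finally have "newton_polyhedron f = convex hull V + convex hull Q"
    by (simp add: newton_polyhedron_def convex_hull_set_plus)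
  also have "convex hull Q = Q"
    unfolding Q_def by (intro hull_same convex_Times) auto
  also have "convex hull V + Q = (\<Union>x\<in>convex hull V. \<Union>y\<in>Q. {x + y})"
    by (auto simp: set_plus_def)
  finally show ?thesis
    using compact_closed_sums[of "convex hull V" Q] finite_imp_compact_convex_hull[of V] T(2)
    by (auto simp: V_def Q_def closed_Times)
qed

section \<open>The principal face\<close>

lemma edge_unique:
  fixes N :: "(real \<times> real) set"
  assumes "convex N" "F edge_of N" "G edge_of N" "x \<in> F" "x \<in> G" "\<not> x extreme_point_of N"
  shows "F = G"
proof (rule ccontr)
  assume "F \<noteq> G"
  have FG: "F face_of N" "G face_of N" "aff_dim F = 1" "aff_dim G = 1"
    using assms(2,3) by (auto simp: edge_of_def)
  have face: "(F \<inter> G) face_of N"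
    using FG by (intro face_of_Int)
  have "F \<inter> G \<noteq> F \<or> F \<inter> G \<noteq> G"
    using \<open>F \<noteq> G\<close> by auto
  moreover have "(F \<inter> G) face_of F" "(F \<inter> G) face_of G"
    using face_of_subset[OF face] FG face_of_imp_subset by blast+
  ultimately have "aff_dim (F \<inter> G) < 1"
    using face_of_aff_dim_lt[of F "F \<inter> G"] face_of_aff_dim_lt[of G "F \<inter> G"] FG face_of_imp_convex by metis
  moreover have "aff_dim (F \<inter> G) \<noteq> -1"
    using assms(4,5) aff_dim_empty[of "F \<inter> G"] by auto
  ultimately have "aff_dim (F \<inter> G) = 0"
    using aff_dim_geq[of "F \<inter> G"] by linarith
  then obtain y where "F \<inter> G = {y}"
    using aff_dim_eq_0 by blast
  then have "F \<inter> G = {x}"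
    using assms(4,5) by auto
  then show False
    using face assms(6) face_of_singleton by metis
qed

lemma principal_face_eq_edge:
  assumes F: "F edge_of newton_polyhedron f" "(newton_distance f, newton_distance f) \<in> F"
    and "\<not> (newton_distance f, newton_distance f) extreme_point_of newton_polyhedron f"
  shows "principal_face f = F"
proof -
  have "newton_face f G \<and> (newton_distance f, newton_distance f) \<in> G \<longleftrightarrow> G = F" for G
    using edge_unique[OF convex_newton_polyhedron, of G f F] assms by (auto simp: newton_face_def)
  then show ?thesis
    unfolding principal_face_def is_arg_min_def by (simp only:) (rule the_equality, auto)
qed

lemma principal_face_eq_vertex:
  assumes ext: "(newton_distance f, newton_distance f) extreme_point_of newton_polyhedron f"
  shows "principal_face f = {(newton_distance f, newton_distance f)}"
proof -
  let ?d = "(newton_distance f, newton_distance f)"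
  have d: "newton_face f {?d}"
    using ext by (auto simp: newton_face_def)
  have cases: "G = {?d} \<or> aff_dim G = 1" if "newton_face f G" "?d \<in> G" for G
    using that by (auto simp: newton_face_def edge_of_def)
  show ?thesis
    unfolding principal_face_def is_arg_min_def
  proof (rule the_equality)
    show "(newton_face f {?d} \<and> ?d \<in> {?d}) \<and> (\<nexists>y. (newton_face f y \<and> ?d \<in> y) \<and> aff_dim y < aff_dim {?d})"
      using d cases by force
    show "G = {?d}" if "(newton_face f G \<and> ?d \<in> G) \<and> (\<nexists>y. (newton_face f y \<and> ?d \<in> y) \<and> aff_dim y < aff_dim G)" for G
    proof (rule ccontr)
      assume "G \<noteq> {?d}"
      then have "aff_dim G = 1"
        using cases that by blast
      then have "aff_dim {?d} < aff_dim G"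
        by simp
      with that d show False
        by blast
    qed
  qed
qed

text \<open>The combinatorial form of the condition that the principal face is a compact edge on the line
  \<open>\<kappa>\<^sub>1 t\<^sub>1 + \<kappa>\<^sub>2 t\<^sub>2 = 1\<close>: the support lies above this line, which meets the diagonal at
  \<open>1 / (\<kappa>\<^sub>1 + \<kappa>\<^sub>2)\<close>, and has points on it strictly on both sides of the diagonal.\<close>

definition has_principal_edge :: "(real \<times> real \<Rightarrow> real) \<Rightarrow> real \<Rightarrow> real \<Rightarrow> bool" where
  "has_principal_edge f \<kappa>1 \<kappa>2 \<longleftrightarrow> 0 < \<kappa>1 \<and> 0 < \<kappa>2 \<and>
     (\<forall>(j, k)\<in>taylor_support f. 1 \<le> \<kappa>1 * real j + \<kappa>2 * real k) \<and>
     (\<exists>(j, k)\<in>taylor_support f. \<kappa>1 * real j + \<kappa>2 * real k = 1 \<and> real j * (\<kappa>1 + \<kappa>2) < 1) \<and>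
     (\<exists>(j, k)\<in>taylor_support f. \<kappa>1 * real j + \<kappa>2 * real k = 1 \<and> real k * (\<kappa>1 + \<kappa>2) < 1)"

lemma has_principal_edgeI:
  fixes n B :: nat
  assumes "0 < n" "0 < B"
    and supp: "\<And>j k. (j, k) \<in> taylor_support f \<Longrightarrow> real B \<le> real j + real n * real k"
    and 1: "(j1, k1) \<in> taylor_support f" "real j1 + real n * real k1 = real B" "real j1 * (1 + real n) < real B"
    and 2: "(j2, k2) \<in> taylor_support f" "real j2 + real n * real k2 = real B" "real k2 * (1 + real n) < real B"
  shows "has_principal_edge f (1 / real B) (real n / real B)"
proof -
  have line: "1 / real B * real j + real n / real B * real k = (real j + real n * real k) / real B" for j k
    by (simp add: add_divide_distrib)
  have sum: "1 / real B + real n / real B = (1 + real n) / real B"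
    by (simp add: add_divide_distrib)
  have "\<forall>(j, k)\<in>taylor_support f. 1 \<le> (real j + real n * real k) / real B"
    using supp \<open>0 < B\<close> by (auto simp: field_simps)
  moreover have "\<exists>(j, k)\<in>taylor_support f. (real j + real n * real k) / real B = 1 \<and> real j * ((1 + real n) / real B) < 1"
    by (rule bexI[OF _ 1(1)]) (use 1(2,3) \<open>0 < B\<close> in \<open>simp add: field_simps\<close>)
  moreover have "\<exists>(j, k)\<in>taylor_support f. (real j + real n * real k) / real B = 1 \<and> real k * ((1 + real n) / real B) < 1"
    by (rule bexI[OF _ 2(1)]) (use 2(2,3) \<open>0 < B\<close> in \<open>simp add: field_simps\<close>)
  ultimately show ?thesis
    unfolding has_principal_edge_def line sum using assms(1,2) by simp
qed

lemma has_principal_edge_imp_finite_type: "has_principal_edge f \<kappa>1 \<kappa>2 \<Longrightarrow> finite_type f"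
  by (auto simp: has_principal_edge_def finite_type_def)

lemma has_principal_edge_endpoints:
  assumes "has_principal_edge f \<kappa>1 \<kappa>2"
  obtains j1 k1 j2 k2 where "(j1, k1) \<in> taylor_support f" "\<kappa>1 * real j1 + \<kappa>2 * real k1 = 1"
    "real j1 < 1 / (\<kappa>1 + \<kappa>2)" "1 / (\<kappa>1 + \<kappa>2) < real k1"
    "(j2, k2) \<in> taylor_support f" "\<kappa>1 * real j2 + \<kappa>2 * real k2 = 1"
    "real k2 < 1 / (\<kappa>1 + \<kappa>2)" "1 / (\<kappa>1 + \<kappa>2) < real j2"
proof -
  have \<kappa>: "0 < \<kappa>1" "0 < \<kappa>2"
    using assms by (auto simp: has_principal_edge_def)
  have other: "1 / (a + b) < y" if "a > 0" "b > 0" "a * x + b * y = 1" "x * (a + b) < 1" for a b x y :: real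
  proof -
    have "a * (x * (a + b)) < a * 1"
      using that by (intro mult_strict_left_mono)
    moreover have "b * (y * (a + b)) = (a * x + b * y) * (a + b) - a * (x * (a + b))"
      by (simp add: algebra_simps)
    ultimately have "b * 1 < b * (y * (a + b))"
      using that(3) by simp
    then have "1 < y * (a + b)"
      using that(2) mult_less_cancel_left_pos by blast
    then show ?thesis
      using that(1,2) by (simp add: field_simps)
  qed
  obtain j1 k1 where 1: "(j1, k1) \<in> taylor_support f" "\<kappa>1 * real j1 + \<kappa>2 * real k1 = 1" "real j1 * (\<kappa>1 + \<kappa>2) < 1"
    using assms by (auto simp: has_principal_edge_def)
  obtain j2 k2 where 2: "(j2, k2) \<in> taylor_support f" "\<kappa>1 * real j2 + \<kappa>2 * real k2 = 1" "real k2 * (\<kappa>1 + \<kappa>2) < 1"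
    using assms by (auto simp: has_principal_edge_def)
  show ?thesis
  proof (rule that[OF 1(1,2) _ _ 2(1,2)])
    show "1 / (\<kappa>1 + \<kappa>2) < real k1"
      using other[OF \<kappa> 1(2,3)] .
    show "1 / (\<kappa>1 + \<kappa>2) < real j2"
      using other[OF \<kappa>(2,1), of "real k2" "real j2"] 2(2,3) by (simp add: add.commute)
    show "real j1 < 1 / (\<kappa>1 + \<kappa>2)" "real k2 < 1 / (\<kappa>1 + \<kappa>2)"
      using 1(3) 2(3) \<kappa> by (auto simp: field_simps)
  qed
qed

text \<open>The point of the diagonal lies in the open segment between two support points on the line, so it is
  not a vertex, and the intersection of the polyhedron with the line is the only edge through it.\<close>

lemma has_principal_edge_geometry:
  assumes E: "has_principal_edge f \<kappa>1 \<kappa>2"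
  shows "newton_distance f = 1 / (\<kappa>1 + \<kappa>2)"
    and "principal_face f = newton_polyhedron f \<inter> {t. \<kappa>1 * fst t + \<kappa>2 * snd t = 1}"
    and "condition_a f"
    and "principal_line f \<mu>1 \<mu>2 \<longleftrightarrow> \<mu>1 = \<kappa>1 \<and> \<mu>2 = \<kappa>2"
proof -
  let ?N = "newton_polyhedron f"
  have \<kappa>: "0 < \<kappa>1" "0 < \<kappa>2" and supp: "\<And>j k. (j, k) \<in> taylor_support f \<Longrightarrow> 1 \<le> \<kappa>1 * real j + \<kappa>2 * real k"
    using E by (auto simp: has_principal_edge_def)
  define d where "d = 1 / (\<kappa>1 + \<kappa>2)"
  have line_d: "\<kappa>1 * d + \<kappa>2 * d = 1"
    using \<kappa> by (simp add: d_def add_divide_distrib[symmetric])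
  obtain j1 k1 j2 k2 where v: "(j1, k1) \<in> taylor_support f" "\<kappa>1 * real j1 + \<kappa>2 * real k1 = 1" "real j1 < d" "d < real k1"
    and w: "(j2, k2) \<in> taylor_support f" "\<kappa>1 * real j2 + \<kappa>2 * real k2 = 1" "real k2 < d" "d < real j2"
    using has_principal_edge_endpoints[OF E] unfolding d_def by metis
  define V W :: "real \<times> real" where VW: "V = (real j1, real k1)" "W = (real j2, real k2)"
  have VWN: "V \<in> ?N" "W \<in> ?N"
    using v(1) w(1) by (auto simp: VW support_in_newton_polyhedron)
  define u where "u = (d - real j1) / (real j2 - real j1)"
  have u: "0 < u" "u < 1"
    using v(3) w(4) by (auto simp: u_def)
  have fst_d: "(1 - u) * real j1 + u * real j2 = d"
  proof -
    have "u * (real j2 - real j1) = d - real j1"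
      using v(3) w(4) by (simp add: u_def)
    then show ?thesis
      by (simp add: algebra_simps)
  qed
  moreover have "(1 - u) * real k1 + u * real k2 = d"
  proof -
    have "\<kappa>2 * ((1 - u) * real k1 + u * real k2)
        = (1 - u) * (\<kappa>1 * real j1 + \<kappa>2 * real k1) + u * (\<kappa>1 * real j2 + \<kappa>2 * real k2)
          - \<kappa>1 * ((1 - u) * real j1 + u * real j2)"
      by (simp add: algebra_simps)
    also have "\<dots> = \<kappa>2 * d"
      unfolding v(2) w(2) fst_d using line_d by simp
    finally show ?thesis
      using \<kappa>(2) by simp
  qed
  ultimately have dd: "(d, d) = (1 - u) *\<^sub>R V + u *\<^sub>R W"
    by (simp add: VW)
  have ddN: "(d, d) \<in> ?N"
    unfolding dd using convexD_alt[OF convex_newton_polyhedron VWN] u by simp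
  have "(d, d) \<in> open_segment V W"
    using dd u v(3,4) w(3,4) by (auto simp: in_segment VW)
  then have not_ext: "\<not> (d, d) extreme_point_of ?N"
    using VWN by (auto simp: extreme_point_of_def)
  show nd: "newton_distance f = 1 / (\<kappa>1 + \<kappa>2)"
    unfolding d_def[symmetric]
  proof (rule diagonal_threshold(1))
    show "(t, t) \<in> ?N" if "t > d" for t
      using newton_polyhedron_upward[OF ddN] that by auto
    show "(t, t) \<notin> ?N" if "t < d" for t
    proof
      assume "(t, t) \<in> ?N"
      from newton_polyhedron_halfspace[OF _ _ supp this] \<kappa> have "1 \<le> \<kappa>1 * t + \<kappa>2 * t"
        by simp
      moreover have "\<kappa>1 * t + \<kappa>2 * t < \<kappa>1 * d + \<kappa>2 * d"
        using \<kappa> that by (intro add_strict_mono mult_strict_left_mono)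
      ultimately show False
        using line_d by simp
    qed
  qed
  define F where "F = ?N \<inter> {t. \<kappa>1 * fst t + \<kappa>2 * snd t = 1}"
  have F_eq: "F = ?N \<inter> {t. (\<kappa>1, \<kappa>2) \<bullet> t = 1}"
    by (auto simp: F_def inner_prod_def)
  have face: "F face_of ?N"
    unfolding F_eq
    by (rule face_of_Int_supporting_hyperplane_ge[OF convex_newton_polyhedron])
      (use newton_polyhedron_halfspace[OF _ _ supp] \<kappa> in \<open>simp add: inner_prod_def\<close>)
  have VWF: "V \<in> F" "W \<in> F" "(d, d) \<in> F"
    using VWN ddN v(2) w(2) line_d by (auto simp: F_def VW)
  have "aff_dim F \<le> aff_dim {t. (\<kappa>1, \<kappa>2) \<bullet> t = 1}"
    unfolding F_eq by (rule aff_dim_subset) auto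
  also have "\<dots> = 1"
    using \<kappa> by (simp add: aff_dim_hyperplane zero_prod_def)
  finally have "aff_dim F \<le> 1" .
  moreover have "aff_dim {V, W} \<le> aff_dim F"
    by (rule aff_dim_subset) (use VWF in auto)
  moreover have "aff_dim {V, W} = 1"
    using v(3) w(4) by (auto simp: aff_dim_2 VW)
  ultimately have edge: "F edge_of ?N"
    using face by (simp add: edge_of_def)
  have pf: "principal_face f = F"
    by (rule principal_face_eq_edge[OF edge]) (use VWF(3) not_ext nd in \<open>auto simp: d_def\<close>)
  then show "principal_face f = ?N \<inter> {t. \<kappa>1 * fst t + \<kappa>2 * snd t = 1}"
    by (simp add: F_def)
  have "compact F"
    unfolding compact_eq_bounded_closed
  proof
    show "closed F"
      unfolding F_eq by (intro closed_Int closed_newton_polyhedron closed_hyperplane)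
    have "norm t \<le> 1 / \<kappa>1 + 1 / \<kappa>2" if "t \<in> F" for t
    proof -
      have t: "0 \<le> fst t" "0 \<le> snd t" "\<kappa>1 * fst t + \<kappa>2 * snd t = 1"
        using that newton_polyhedron_nonneg[of t f] by (auto simp: F_def)
      then have "0 \<le> \<kappa>1 * fst t" "0 \<le> \<kappa>2 * snd t"
        using \<kappa> by auto
      then have "\<kappa>1 * fst t \<le> 1" "\<kappa>2 * snd t \<le> 1"
        using t(3) by linarith+
      then have "fst t \<le> 1 / \<kappa>1" "snd t \<le> 1 / \<kappa>2"
        using \<kappa> by (auto simp: field_simps)
      then show ?thesis
        using norm_Pair_le[of "fst t" "snd t"] t by simp
    qed
    then show "bounded F"
      by (rule boundedI)
  qed
  then show "condition_a f"
    using edge pf by (simp add: condition_a_def)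
  show "principal_line f \<mu>1 \<mu>2 \<longleftrightarrow> \<mu>1 = \<kappa>1 \<and> \<mu>2 = \<kappa>2"
  proof
    assume "principal_line f \<mu>1 \<mu>2"
    then have eq: "\<mu>1 * real j1 + \<mu>2 * real k1 = 1" "\<mu>1 * real j2 + \<mu>2 * real k2 = 1"
      using VWF pf by (auto simp: principal_line_def VW)
    have "real j1 * real k2 < real j2 * real k1"
      using v(3,4) w(3,4) by (intro mult_strict_mono) auto
    moreover have "(\<mu>1 - \<kappa>1) * (real j1 * real k2 - real j2 * real k1) =
        (\<mu>1 * real j1 + \<mu>2 * real k1 - (\<kappa>1 * real j1 + \<kappa>2 * real k1)) * real k2
        - (\<mu>1 * real j2 + \<mu>2 * real k2 - (\<kappa>1 * real j2 + \<kappa>2 * real k2)) * real k1"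
      "(\<mu>2 - \<kappa>2) * (real j1 * real k2 - real j2 * real k1) =
        (\<mu>1 * real j2 + \<mu>2 * real k2 - (\<kappa>1 * real j2 + \<kappa>2 * real k2)) * real j1
        - (\<mu>1 * real j1 + \<mu>2 * real k1 - (\<kappa>1 * real j1 + \<kappa>2 * real k1)) * real j2"
      by (simp_all add: algebra_simps)
    ultimately show "\<mu>1 = \<kappa>1 \<and> \<mu>2 = \<kappa>2"
      unfolding eq v(2) w(2) by auto
  qed (use \<kappa> pf in \<open>auto simp: principal_line_def F_def\<close>)
qed

text \<open>Points of the line outside of the principal face do not belong to the support, so the sum may be taken
  over the whole line.\<close>

lemma has_principal_edge_principal_part:
  assumes E: "has_principal_edge f \<kappa>1 \<kappa>2"
  shows "finite {(j, k). \<kappa>1 * real j + \<kappa>2 * real k = 1}"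
    and "principal_part f x =
      (\<Sum>(j, k)\<in>{(j, k). \<kappa>1 * real j + \<kappa>2 * real k = 1}. taylor_coeff f 0 j k * fst x ^ j * snd x ^ k)"
proof -
  let ?L = "{(j, k). \<kappa>1 * real j + \<kappa>2 * real k = 1}"
  have \<kappa>: "0 < \<kappa>1" "0 < \<kappa>2"
    using E by (auto simp: has_principal_edge_def)
  show fin: "finite ?L"
  proof (rule finite_subset[of _ "{..nat \<lfloor>1 / \<kappa>1\<rfloor>} \<times> {..nat \<lfloor>1 / \<kappa>2\<rfloor>}"])
    have "j \<le> nat \<lfloor>1 / \<kappa>1\<rfloor> \<and> k \<le> nat \<lfloor>1 / \<kappa>2\<rfloor>" if jk: "\<kappa>1 * real j + \<kappa>2 * real k = 1" for j k
    proof -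
      have "0 \<le> \<kappa>1 * real j" "0 \<le> \<kappa>2 * real k"
        using \<kappa> by auto
      then have "\<kappa>1 * real j \<le> 1" "\<kappa>2 * real k \<le> 1"
        using jk by linarith+
      then have "real j \<le> 1 / \<kappa>1" "real k \<le> 1 / \<kappa>2"
        using \<kappa> by (auto simp: field_simps)
      then show ?thesis
        by (simp add: le_nat_floor)
    qed
    then show "?L \<subseteq> {..nat \<lfloor>1 / \<kappa>1\<rfloor>} \<times> {..nat \<lfloor>1 / \<kappa>2\<rfloor>}"
      by auto
  qed simp
  let ?P = "{(j, k). (real j, real k) \<in> principal_face f}"
  have sub: "?P \<subseteq> ?L"
    by (auto simp: has_principal_edge_geometry(2)[OF E])
  then have "principal_part f x = (\<Sum>(j, k)\<in>?P. taylor_coeff f 0 j k * fst x ^ j * snd x ^ k)"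
    unfolding principal_part_def using fin finite_subset by (intro infsum_finite) blast
  also have "\<dots> = (\<Sum>(j, k)\<in>?L. taylor_coeff f 0 j k * fst x ^ j * snd x ^ k)"
  proof (rule sum.mono_neutral_left[OF fin sub])
    have "taylor_coeff f 0 j k = 0" if "(j, k) \<in> ?L - ?P" for j k
    proof (rule ccontr)
      assume "taylor_coeff f 0 j k \<noteq> 0"
      then have "(real j, real k) \<in> newton_polyhedron f"
        by (intro support_in_newton_polyhedron) (simp add: taylor_support_def)
      with that show False
        by (simp add: has_principal_edge_geometry(2)[OF E])
    qed
    then have "taylor_coeff f 0 (fst i) (snd i) = 0" if "i \<in> ?L - ?P" for i
      using that by (cases i) simp
    then show "\<forall>i\<in>?L - ?P. (case i of (j, k) \<Rightarrow> taylor_coeff f 0 j k * fst x ^ j * snd x ^ k) = 0"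
      by (simp add: case_prod_unfold)
  qed
  finally show "principal_part f x = (\<Sum>(j, k)\<in>?L. taylor_coeff f 0 j k * fst x ^ j * snd x ^ k)" .
qed

text \<open>A supporting line at the point of the diagonal cuts out the principal face.  Compactness excludes
  weights equal to 0, for which the face would contain a half-line.  The end points of the edge lie in
  the support and, the point of the diagonal not being a vertex, on different sides of it.\<close>

lemma condition_a_imp_has_principal_edge:
  assumes f: "finite_type f" and a: "condition_a f"
  obtains \<kappa>1 \<kappa>2 where "has_principal_edge f \<kappa>1 \<kappa>2"
proof -
  let ?N = "newton_polyhedron f"
  define d where "d = newton_distance f"
  have dN: "(d, d) \<in> ?N" and d_not_int: "(d, d) \<notin> interior ?N" and int: "interior ?N \<noteq> {}"
    using diagonal_threshold[OF newton_distance_threshold[OF f]] closed_newton_polyhedron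
    by (auto simp: d_def)
  have not_ext: "\<not> (d, d) extreme_point_of ?N"
  proof
    assume "(d, d) extreme_point_of ?N"
    then have "principal_face f = {(d, d)}"
      using principal_face_eq_vertex[of f] by (simp add: d_def)
    then show False
      using a by (simp add: condition_a_def edge_of_def)
  qed
  obtain a where a0: "a \<noteq> 0" and supp: "\<And>y. y \<in> ?N \<Longrightarrow> a \<bullet> (d, d) \<le> a \<bullet> y"
    using supporting_hyperplane_relative_frontier[OF convex_newton_polyhedron, of "(d, d)" f]
      dN d_not_int rel_interior_nonempty_interior[OF int] closure_subset by (metis subsetD)
  define F where "F = ?N \<inter> {t. a \<bullet> t = a \<bullet> (d, d)}"
  have face: "F face_of ?N"
    unfolding F_def by (rule face_of_Int_supporting_hyperplane_ge[OF convex_newton_polyhedron supp])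
  have dF: "(d, d) \<in> F"
    using dN by (simp add: F_def)
  have "aff_dim F \<le> aff_dim {t. a \<bullet> t = a \<bullet> (d, d)}"
    unfolding F_def by (rule aff_dim_subset) auto
  also have "\<dots> = 1"
    using a0 by (simp add: aff_dim_hyperplane)
  finally have "aff_dim F \<le> 1" .
  moreover have "aff_dim F \<noteq> -1"
    using dF aff_dim_empty[of F] by auto
  moreover have "aff_dim F \<noteq> 0"
  proof
    assume "aff_dim F = 0"
    then have "F = {(d, d)}"
      using dF aff_dim_eq_0[of F] by auto
    then show False
      using face not_ext face_of_singleton by metis
  qed
  ultimately have edge: "F edge_of ?N"
    using face aff_dim_geq[of F] by (simp add: edge_of_def)
  have pf: "principal_face f = F"
    by (rule principal_face_eq_edge[OF edge]) (use dF not_ext in \<open>auto simp: d_def\<close>)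
  then have F: "compact F" "bounded F" "convex F"
    using a face face_of_imp_convex compact_imp_bounded by (auto simp: condition_a_def)
  have nn: "0 \<le> fst a" "0 \<le> snd a"
    using supporting_functional_nonneg[OF f supp] by auto
  obtain B where B: "\<And>t. t \<in> F \<Longrightarrow> norm t \<le> B"
    using F(2) by (auto simp: bounded_iff)
  have d0: "0 \<le> d"
    using newton_distance_nonneg[OF f] by (simp add: d_def)
  have B0: "0 \<le> B"
    using B[OF dF] norm_ge_zero order_trans by blast
  have pos: "0 < fst a" "0 < snd a"
  proof -
    have "fst a \<noteq> 0"
    proof
      assume "fst a = 0"
      then have "(d + (B + 1), d) \<in> F"
        using newton_polyhedron_upward[OF dN, of "(d + (B + 1), d)"] B0 by (simp add: F_def inner_prod_def)
      from B[OF this] show False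
        using norm_fst_le[of "d + (B + 1)" d] d0 B0 by simp
    qed
    moreover have "snd a \<noteq> 0"
    proof
      assume "snd a = 0"
      then have "(d, d + (B + 1)) \<in> F"
        using newton_polyhedron_upward[OF dN, of "(d, d + (B + 1))"] B0 by (simp add: F_def inner_prod_def)
      from B[OF this] show False
        using norm_snd_le[of "d + (B + 1)" d] d0 B0 by simp
    qed
    ultimately show "0 < fst a" "0 < snd a"
      using nn by auto
  qed
  have dpos: "0 < d"
  proof (rule ccontr)
    assume "\<not> 0 < d"
    then have "d = 0"
      using d0 by simp
    have "t = (0, 0)" if "t \<in> F" for t
    proof -
      have t: "0 \<le> fst t" "0 \<le> snd t" "fst a * fst t + snd a * snd t = 0"
        using that newton_polyhedron_nonneg[of t f] \<open>d = 0\<close> by (auto simp: F_def inner_prod_def)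
      moreover have "0 \<le> fst a * fst t" "0 \<le> snd a * snd t"
        using t pos by auto
      ultimately have "fst a * fst t = 0" "snd a * snd t = 0"
        by linarith+
      then show ?thesis
        using pos by (auto simp: prod_eq_iff)
    qed
    then have "F \<subseteq> {(0, 0)}"
      by blast
    then have "F = {(0, 0)}"
      using dF by blast
    then show False
      using edge by (simp add: edge_of_def)
  qed
  define \<kappa>1 \<kappa>2 where \<kappa>_def: "\<kappa>1 = fst a / ((fst a + snd a) * d)" "\<kappa>2 = snd a / ((fst a + snd a) * d)"
  have \<kappa>: "0 < \<kappa>1" "0 < \<kappa>2" "\<kappa>1 + \<kappa>2 = 1 / d"
    using pos dpos by (auto simp: \<kappa>_def add_divide_distrib[symmetric])
  have inner_a: "\<kappa>1 * fst t + \<kappa>2 * snd t = (a \<bullet> t) / (a \<bullet> (d, d))" for t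
    using pos dpos by (simp add: \<kappa>_def inner_prod_def add_divide_distrib distrib_right)
  have ad: "a \<bullet> (d, d) > 0"
    using pos dpos by (simp add: inner_prod_def add_pos_pos)
  have supp': "1 \<le> \<kappa>1 * fst t + \<kappa>2 * snd t" if "t \<in> ?N" for t
    using supp[OF that] ad by (simp add: inner_a)
  have F_line: "\<kappa>1 * fst t + \<kappa>2 * snd t = 1" if "t \<in> F" for t
    using that ad by (auto simp: inner_a F_def)
  have extreme_in_support: "\<exists>j k. (j, k) \<in> taylor_support f \<and> v = (real j, real k)" if "v extreme_point_of F" for v
  proof -
    have v: "v extreme_point_of ?N" "v \<in> F"
      using that extreme_point_of_face[OF face] by auto
    have "v \<in> quadrants (taylor_support f)"
      using v(1) unfolding newton_polyhedron_def by (rule extreme_point_of_convex_hull)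
    then obtain j k where jk: "(j, k) \<in> taylor_support f" "real j \<le> fst v" "real k \<le> snd v"
      by auto
    have le: "\<kappa>1 * real j \<le> \<kappa>1 * fst v" "\<kappa>2 * real k \<le> \<kappa>2 * snd v"
      using jk \<kappa> by auto
    moreover have "1 \<le> \<kappa>1 * real j + \<kappa>2 * real k"
      using supp'[OF support_in_newton_polyhedron[OF jk(1)]] by simp
    ultimately have "\<kappa>1 * real j = \<kappa>1 * fst v" "\<kappa>2 * real k = \<kappa>2 * snd v"
      using F_line[OF v(2)] by linarith+
    then have "v = (real j, real k)"
      using \<kappa> by (simp add: prod_eq_iff)
    then show ?thesis
      using jk(1) by blast
  qed
  have side: "\<exists>v. v extreme_point_of F \<and> e \<bullet> v < d" if e: "e = (1, 0) \<or> e = (0, 1)" for e :: "real \<times> real"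
  proof (rule ccontr)
    assume no: "\<not> ?thesis"
    have "F = convex hull {x. x extreme_point_of F}"
      by (rule Krein_Milman_Minkowski[OF F(1,3)])
    also have "\<dots> \<subseteq> {x. e \<bullet> x \<ge> d}"
      by (rule hull_minimal) (use no in \<open>auto simp: not_less convex_halfspace_ge\<close>)
    finally have ge: "\<And>x. x \<in> F \<Longrightarrow> e \<bullet> x \<ge> d"
      by auto
    have "(F \<inter> {x. e \<bullet> x = d}) face_of F"
      by (rule face_of_Int_supporting_hyperplane_ge[OF F(3) ge])
    then have "(F \<inter> {x. e \<bullet> x = d}) face_of ?N"
      using face face_of_trans by blast
    moreover have "F \<inter> {x. e \<bullet> x = d} = {(d, d)}"
    proof -
      have "x = (d, d)" if "x \<in> F" "e \<bullet> x = d" for x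
      proof -
        have "\<kappa>1 * fst x + \<kappa>2 * snd x = \<kappa>1 * d + \<kappa>2 * d"
          using F_line[OF that(1)] F_line[OF dF] by simp
        then show ?thesis
          using e that(2) \<kappa> by (cases x) (auto simp: inner_prod_def)
      qed
      then have "F \<inter> {x. e \<bullet> x = d} \<subseteq> {(d, d)}"
        by blast
      moreover have "e \<bullet> (d, d) = d"
        using e by (auto simp: inner_prod_def)
      ultimately show ?thesis
        using dF by blast
    qed
    ultimately show False
      using not_ext face_of_singleton by metis
  qed
  obtain v where v: "v extreme_point_of F" "fst v < d"
    using side[of "(1, 0)"] by (auto simp: inner_prod_def)
  obtain w where w: "w extreme_point_of F" "snd w < d"
    using side[of "(0, 1)"] by (auto simp: inner_prod_def)
  obtain j1 k1 where jk1: "(j1, k1) \<in> taylor_support f" "v = (real j1, real k1)"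
    using extreme_in_support[OF v(1)] by blast
  obtain j2 k2 where jk2: "(j2, k2) \<in> taylor_support f" "w = (real j2, real k2)"
    using extreme_in_support[OF w(1)] by blast
  have "has_principal_edge f \<kappa>1 \<kappa>2"
    unfolding has_principal_edge_def
  proof (intro conjI)
    show "\<forall>(j, k)\<in>taylor_support f. 1 \<le> \<kappa>1 * real j + \<kappa>2 * real k"
      using supp'[OF support_in_newton_polyhedron] by auto
    have "\<kappa>1 * real j1 + \<kappa>2 * real k1 = 1" "\<kappa>1 * real j2 + \<kappa>2 * real k2 = 1"
      using F_line v(1) w(1) jk1(2) jk2(2) by (auto simp: extreme_point_of_def)
    moreover have "real j1 * (\<kappa>1 + \<kappa>2) < 1" "real k2 * (\<kappa>1 + \<kappa>2) < 1"
      using v(2) w(2) jk1(2) jk2(2) dpos by (auto simp: \<kappa>(3))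
    ultimately show "\<exists>(j, k)\<in>taylor_support f. \<kappa>1 * real j + \<kappa>2 * real k = 1 \<and> real j * (\<kappa>1 + \<kappa>2) < 1"
      "\<exists>(j, k)\<in>taylor_support f. \<kappa>1 * real j + \<kappa>2 * real k = 1 \<and> real k * (\<kappa>1 + \<kappa>2) < 1"
      using jk1(1) jk2(1) by (auto intro: bexI[of _ "(j1, k1)"] bexI[of _ "(j2, k2)"])
  qed (use \<kappa> in auto)
  then show ?thesis
    by (rule that)
qed

section \<open>Changes of coordinates and weighted parts\<close>

text \<open>The limit of \<open>D\<^sub>r\<^sup>-\<^sup>1 \<circ> (u, v) \<circ> D\<^sub>r\<close>, where \<open>p\<close> and \<open>e\<close> are the Taylor coefficients of \<open>u\<close> and \<open>v\<close>.\<close>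

definition leading_map :: "real \<Rightarrow> (nat \<Rightarrow> nat \<Rightarrow> real) \<Rightarrow> (nat \<Rightarrow> nat \<Rightarrow> real) \<Rightarrow> real \<times> real \<Rightarrow> real \<times> real" where
  "leading_map m p e y = (weighted_part m 1 p y, weighted_part m m e y)"

lemma leading_map_limit:
  assumes u: "expansion u p" and v: "expansion v e" and m: "m \<ge> 1"
    and p: "p 0 0 = 0" and e: "\<And>j. real j < m \<Longrightarrow> e j 0 = 0"
  shows "((\<lambda>r. (u (dilation m r y) / r, v (dilation m r y) / r powr m)) \<longlongrightarrow> leading_map m p e y) (at_right 0)"
proof -
  have "1 \<le> real j + m * real k" if "p j k \<noteq> 0" for j k
  proof (cases "k = 0")
    case True
    then show ?thesis
      using that p by (cases j) auto
  next
    case False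
    then have "1 * 1 \<le> m * real k"
      using m by (intro mult_mono) auto
    then show ?thesis
      by simp
  qed
  then have 1: "((\<lambda>r. r powr (- 1) * u (dilation m r y)) \<longlongrightarrow> weighted_part m 1 p y) (at_right 0)"
    by (rule weighted_limit[OF u m _ tendsto_const])
  have "m \<le> real j + m * real k" if "e j k \<noteq> 0" for j k
  proof (cases "k = 0")
    case True
    then show ?thesis
      using that e[of j] by force
  next
    case False
    then have "m * 1 \<le> m * real k"
      using m by (intro mult_left_mono) auto
    then show ?thesis
      by simp
  qed
  then have 2: "((\<lambda>r. r powr (- m) * v (dilation m r y)) \<longlongrightarrow> weighted_part m m e y) (at_right 0)"
    by (rule weighted_limit[OF v m _ tendsto_const])
  have "\<forall>\<^sub>F r in at_right 0. (r powr (- 1) * u (dilation m r y), r powr (- m) * v (dilation m r y))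
      = (u (dilation m r y) / r, v (dilation m r y) / r powr m)"
    using eventually_at_right_0_less_1
    by eventually_elim (simp add: powr_minus divide_inverse)
  from iffD1[OF tendsto_cong[OF this] tendsto_Pair[OF 1 2]] show ?thesis
    by (simp add: leading_map_def)
qed

text \<open>Only the linear terms and one pure power of \<open>y\<^sub>1\<close> have low enough weight to survive.  The pure power
  \<open>y\<^sub>1\<^sup>m\<close> occurs only if \<open>m\<close> is an integer; otherwise \<open>E = 0\<close>.\<close>

lemma leading_map_eq:
  assumes m: "m \<ge> 1"
  obtains E N where "\<And>n. real n = m \<Longrightarrow> E = e n 0 \<and> N = n"
    "\<And>y. leading_map m p e y = (p 1 0 * fst y + (if m = 1 then p 0 1 else 0) * snd y, e 0 1 * snd y + E * fst y ^ N)"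
proof -
  have line1: "weighted_line m 1 = (if m = 1 then {(1, 0), (0, 1)} else {(1, 0)})"
  proof -
    have "(j, k) = (1, 0) \<or> (m = 1 \<and> (j, k) = (0, 1))" if jk: "real j + m * real k = 1" for j k
    proof (cases k)
      case (Suc l)
      have "0 \<le> m * real l"
        using m by simp
      moreover have "m + (real j + m * real l) = 1"
        using jk Suc by (simp add: algebra_simps)
      ultimately have "m * real l = 0" "real j = 0" "m = 1"
        using m of_nat_0_le_iff[of j] by linarith+
      then show ?thesis
        using Suc by simp
    qed (use jk in auto)
    then show ?thesis
      by (auto simp: weighted_line_def)
  qed
  have line2: "weighted_line m m = insert (0, 1) {(n, 0) |n. real n = m}"
  proof -
    have "(j, k) = (0, 1) \<or> (k = 0 \<and> real j = m)" if jk: "real j + m * real k = m" for j k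
    proof (cases k)
      case (Suc l)
      have "0 \<le> m * real l"
        using m by simp
      moreover have "real j + m * real l = 0"
        using jk Suc by (simp add: algebra_simps)
      ultimately have "m * real l = 0" "real j = 0"
        using of_nat_0_le_iff[of j] by linarith+
      then show ?thesis
        using Suc m by simp
    qed (use jk in auto)
    then show ?thesis
      by (auto simp: weighted_line_def)
  qed
  have P1: "weighted_part m 1 p y = p 1 0 * fst y + (if m = 1 then p 0 1 else 0) * snd y" for y
    by (simp add: weighted_part_def line1)
  show ?thesis
  proof (cases "\<exists>n. real n = m")
    case True
    then obtain n where n: "real n = m"
      by blast
    then have "weighted_line m m = {(0, 1), (n, 0)}"
      by (auto simp: line2)
    then have "weighted_part m m e y = e 0 1 * snd y + e n 0 * fst y ^ n" for y
      by (simp add: weighted_part_def)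
    with P1 n show ?thesis
      by (intro that[of "e n 0" n]) (auto simp: leading_map_def)
  next
    case False
    then have "weighted_line m m = {(0, 1)}"
      by (auto simp: line2)
    then have "weighted_part m m e y = e 0 1 * snd y + 0 * fst y ^ 0" for y
      by (simp add: weighted_part_def)
    with P1 False show ?thesis
      by (intro that[of 0 0]) (auto simp: leading_map_def)
  qed
qed

text \<open>For \<open>m = 1\<close> the leading map is the derivative of \<open>(u, v)\<close> at the origin; for \<open>m > 1\<close> it is triangular,
  since the coefficient of \<open>y\<^sub>1\<close> in \<open>v\<close> vanishes and the determinant is the product of the diagonal
  coefficients.\<close>

lemma leading_map_inverse:
  assumes m: "m \<ge> 1" and det: "p 1 0 * e 0 1 - p 0 1 * e 1 0 \<noteq> (0 :: real)"
    and e: "\<And>j. real j < m \<Longrightarrow> e j 0 = 0"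
  obtains \<Psi>1 \<Psi>2 where "\<And>x. leading_map m p e (\<Psi>1 x, \<Psi>2 x) = x"
    "\<And>y. (\<Psi>1 (leading_map m p e y), \<Psi>2 (leading_map m p e y)) = y"
    "\<And>x. \<Psi>1 differentiable (at x)" "\<And>x. \<Psi>2 differentiable (at x)"
proof -
  obtain E N where EN: "\<And>n. real n = m \<Longrightarrow> E = e n 0 \<and> N = n"
    "\<And>y. leading_map m p e y = (p 1 0 * fst y + (if m = 1 then p 0 1 else 0) * snd y, e 0 1 * snd y + E * fst y ^ N)"
    using leading_map_eq[OF m, of e p] by blast
  show ?thesis
  proof (cases "m = 1")
    case True
    then have "E = e 1 0" "N = 1"
      using EN(1)[of 1] by auto
    then have L: "leading_map m p e y = (p 1 0 * fst y + p 0 1 * snd y, e 0 1 * snd y + e 1 0 * fst y)" for y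
      using EN(2) True by simp
    define \<Delta> where "\<Delta> = p 1 0 * e 0 1 - p 0 1 * e 1 0"
    have \<Delta>: "\<Delta> \<noteq> 0"
      using det by (simp add: \<Delta>_def)
    define \<Psi>1 where "\<Psi>1 x = (e 0 1 * fst x - p 0 1 * snd x) / \<Delta>" for x :: "real \<times> real"
    define \<Psi>2 where "\<Psi>2 x = (p 1 0 * snd x - e 1 0 * fst x) / \<Delta>" for x :: "real \<times> real"
    show ?thesis
    proof (rule that)
      fix x :: "real \<times> real"
      have "p 1 0 * (e 0 1 * fst x - p 0 1 * snd x) + p 0 1 * (p 1 0 * snd x - e 1 0 * fst x) = \<Delta> * fst x"
        "e 0 1 * (p 1 0 * snd x - e 1 0 * fst x) + e 1 0 * (e 0 1 * fst x - p 0 1 * snd x) = \<Delta> * snd x"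
        by (simp_all add: \<Delta>_def algebra_simps)
      then show "leading_map m p e (\<Psi>1 x, \<Psi>2 x) = x"
        using \<Delta> unfolding L \<Psi>1_def \<Psi>2_def by (simp add: prod_eq_iff add_divide_distrib[symmetric])
      have "e 0 1 * (p 1 0 * fst x + p 0 1 * snd x) - p 0 1 * (e 0 1 * snd x + e 1 0 * fst x) = \<Delta> * fst x"
        "p 1 0 * (e 0 1 * snd x + e 1 0 * fst x) - e 1 0 * (p 1 0 * fst x + p 0 1 * snd x) = \<Delta> * snd x"
        by (simp_all add: \<Delta>_def algebra_simps)
      then show "(\<Psi>1 (leading_map m p e x), \<Psi>2 (leading_map m p e x)) = x"
        using \<Delta> unfolding L \<Psi>1_def \<Psi>2_def by (simp add: prod_eq_iff)
      show "\<Psi>1 differentiable (at x)" "\<Psi>2 differentiable (at x)"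
        unfolding \<Psi>1_def[abs_def] \<Psi>2_def[abs_def]
        by (intro derivative_intros bounded_linear_imp_differentiable[OF bounded_linear_fst]
            bounded_linear_imp_differentiable[OF bounded_linear_snd] \<Delta>)+
    qed
  next
    case False
    then have "e 1 0 = 0"
      using e[of 1] m by simp
    then have e01: "e 0 1 \<noteq> 0" and p: "p 1 0 \<noteq> 0"
      using det by auto
    have L: "leading_map m p e y = (p 1 0 * fst y, e 0 1 * snd y + E * fst y ^ N)" for y
      using EN(2) False by simp
    define \<Psi>1 where "\<Psi>1 x = fst x / p 1 0" for x :: "real \<times> real"
    define \<Psi>2 where "\<Psi>2 x = (snd x - E * (fst x / p 1 0) ^ N) / e 0 1" for x :: "real \<times> real"
    show ?thesis
    proof (rule that)
      fix x :: "real \<times> real"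
      show "leading_map m p e (\<Psi>1 x, \<Psi>2 x) = x"
        using p e01 unfolding L \<Psi>1_def \<Psi>2_def by (simp add: prod_eq_iff)
      show "(\<Psi>1 (leading_map m p e x), \<Psi>2 (leading_map m p e x)) = x"
        using p e01 unfolding L \<Psi>1_def \<Psi>2_def by (simp add: prod_eq_iff)
      show "\<Psi>1 differentiable (at x)" "\<Psi>2 differentiable (at x)"
        unfolding \<Psi>1_def[abs_def] \<Psi>2_def[abs_def]
        by (intro derivative_intros bounded_linear_imp_differentiable[OF bounded_linear_fst]
            bounded_linear_imp_differentiable[OF bounded_linear_snd] p e01)+
    qed
  qed
qed

text \<open>Orders of vanishing are expressed by growth, which is invariant under Lipschitz changes of variables.\<close>

abbreviation vanishes_to :: "(real \<times> real \<Rightarrow> real) \<Rightarrow> real \<times> real \<Rightarrow> nat \<Rightarrow> bool" where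
  "vanishes_to F q K \<equiv> (\<lambda>h. F (q + h)) \<in> O[nhds 0](\<lambda>h. norm h ^ K)"

lemma continuous_bigo_1:
  fixes F :: "real \<times> real \<Rightarrow> real"
  assumes "isCont F q"
  shows "(\<lambda>h. F (q + h)) \<in> O[nhds 0](\<lambda>_. 1)"
proof -
  have "isCont (\<lambda>h. F (q + h)) 0"
    by (rule isCont_o2[where g = F]) (use assms in \<open>auto intro: continuous_intros\<close>)
  then have "((\<lambda>h. F (q + h)) \<longlongrightarrow> F (q + 0)) (nhds 0)"
    using tendsto_at_iff_tendsto_nhds[of "\<lambda>h. F (q + h)" 0] unfolding isCont_def by blast
  then have "((\<lambda>h. F (q + h)) \<longlongrightarrow> F q) (nhds 0)"
    by simp
  then have "\<forall>\<^sub>F h in nhds 0. dist (F (q + h)) (F q) < 1"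
    by (rule tendstoD) simp
  then have "\<forall>\<^sub>F h in nhds 0. norm (F (q + h)) \<le> (\<bar>F q\<bar> + 1) * norm (1 :: real)"
    by eventually_elim (auto simp: dist_real_def)
  then show ?thesis
    by (rule bigoI)
qed

lemma differentiable_bigo_norm:
  fixes F :: "real \<times> real \<Rightarrow> real"
  assumes "F differentiable (at q)" "F q = 0"
  shows "(\<lambda>h. F (q + h)) \<in> O[nhds 0](\<lambda>h. norm h)"
proof -
  obtain F' where F': "(F has_derivative F') (at q)"
    using assms(1) by (auto simp: differentiable_def)
  obtain B where B: "\<And>h. norm (F' h) \<le> norm h * B"
    using bounded_linear.bounded[OF has_derivative_bounded_linear[OF F']] by blast
  obtain \<delta> where \<delta>: "\<delta> > 0" "\<And>y. norm (y - q) < \<delta> \<Longrightarrow> norm (F y - F q - F' (y - q)) \<le> 1 * norm (y - q)"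
    using F' unfolding has_derivative_at_alt using zero_less_one by blast
  have "eventually (\<lambda>h. norm h < \<delta>) (nhds (0 :: real \<times> real))"
    using eventually_nhds_in_open[of "ball 0 \<delta>" "0 :: real \<times> real"] \<delta>(1) by simp
  then have "\<forall>\<^sub>F h in nhds 0. norm (F (q + h)) \<le> (B + 1) * norm (norm h)"
  proof eventually_elim
    case (elim h)
    have "\<bar>F (q + h) - F' h\<bar> \<le> norm h"
      using \<delta>(2)[of "q + h"] elim assms(2) by simp
    moreover have "\<bar>F' h\<bar> \<le> B * norm h"
      using B[of h] by (simp add: mult.commute)
    ultimately show ?case
      by (simp add: algebra_simps)
  qed
  then show ?thesis
    by (rule bigoI)
qed

text \<open>If every monomial contains \<open>x\<^sub>2\<^sup>K\<close>, the part vanishes to order \<open>K\<close> along \<open>x\<^sub>2 = 0\<close>, in whatever coordinates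
  this curve is expressed.\<close>

lemma weighted_part_bigo:
  fixes \<Psi>1 \<Psi>2 :: "real \<times> real \<Rightarrow> real"
  assumes m: "m \<ge> 1" and \<Psi>1: "isCont \<Psi>1 q" and \<Psi>2: "\<Psi>2 differentiable (at q)" "\<Psi>2 q = 0"
    and K: "\<And>j k. real j + m * real k = b \<Longrightarrow> c j k \<noteq> 0 \<Longrightarrow> K \<le> k"
  shows "(\<lambda>h. weighted_part m b c (\<Psi>1 (q + h), \<Psi>2 (q + h))) \<in> O[nhds 0](\<lambda>h. norm h ^ K)"
  unfolding weighted_part_def
proof (rule big_sum_in_bigo)
  fix jk assume "jk \<in> weighted_line m b"
  then obtain j k where jk: "jk = (j, k)" "real j + m * real k = b"
    by (auto simp: weighted_line_def)
  have "(\<lambda>h. c j k * \<Psi>1 (q + h) ^ j * \<Psi>2 (q + h) ^ k) \<in> O[nhds 0](\<lambda>h. norm h ^ K)"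
  proof (cases "c j k = 0")
    case False
    then have k: "k = (k - K) + K"
      using K[OF jk(2)] by simp
    have "isCont \<Psi>2 q"
      using \<Psi>2(1) by (rule differentiable_imp_continuous_within)
    then have "isCont (\<lambda>x. c j k * \<Psi>1 x ^ j * \<Psi>2 x ^ (k - K)) q"
      using \<Psi>1 by (intro continuous_intros)
    from continuous_bigo_1[OF this]
    have "(\<lambda>h. c j k * \<Psi>1 (q + h) ^ j * \<Psi>2 (q + h) ^ (k - K)) \<in> O[nhds 0](\<lambda>_. 1)" .
    moreover have "(\<lambda>h. \<Psi>2 (q + h) ^ K) \<in> O[nhds 0](\<lambda>h. norm h ^ K)"
      by (intro landau_o.big_power differentiable_bigo_norm \<Psi>2)
    ultimately have "(\<lambda>h. (c j k * \<Psi>1 (q + h) ^ j * \<Psi>2 (q + h) ^ (k - K)) * \<Psi>2 (q + h) ^ K) \<in> O[nhds 0](\<lambda>h. 1 * norm h ^ K)"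
      by (rule landau_o.big.mult)
    moreover have "(c j k * \<Psi>1 (q + h) ^ j * \<Psi>2 (q + h) ^ (k - K)) * \<Psi>2 (q + h) ^ K = c j k * \<Psi>1 (q + h) ^ j * \<Psi>2 (q + h) ^ k" for h
      by (subst (3) k) (simp only: power_add mult.assoc)
    ultimately show ?thesis
      by simp
  qed simp
  then show "(\<lambda>h. case jk of (j, k) \<Rightarrow> c j k * fst (\<Psi>1 (q + h), \<Psi>2 (q + h)) ^ j * snd (\<Psi>1 (q + h), \<Psi>2 (q + h)) ^ k)
      \<in> O[nhds 0](\<lambda>h. norm h ^ K)"
    by (simp add: jk(1))
qed

text \<open>If a change of coordinates raises the order of \<open>f\<close> with respect to some weight beyond the bound that
  the distance \<open>d\<close> of \<open>f\<close> imposes, then \<open>f\<close> has a weighted part, of integral weight \<open>n\<close>, with a root of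
  high order off the axes.  The weight \<open>n\<close> is the order of contact of the image of the
  \<open>y\<^sub>1\<close>-axis with the \<open>x\<^sub>1\<close>-axis, and the root is the leading term of that image.\<close>

lemma coordinate_change_forces_root:
  assumes f: "expansion f c" and g: "expansion g c'"
    and gf: "eventually (\<lambda>y. g y = f (u y, v y)) (nhds 0)"
    and u: "expansion u p" and v: "expansion v e" and p0: "p 0 0 = 0" and "e 0 0 = 0"
    and det: "p 1 0 * e 0 1 - p 0 1 * e 1 0 \<noteq> 0" and p: "p 1 0 \<noteq> 0"
    and m: "m \<ge> 1" and g_supp: "\<And>j k. c' j k \<noteq> 0 \<Longrightarrow> D * (1 + m) \<le> real j + m * real k"
    and f_supp: "\<And>m. m \<ge> 1 \<Longrightarrow> \<exists>j k. c j k \<noteq> 0 \<and> real j + m * real k \<le> d * (1 + m)"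
    and dD: "d < D"
  obtains n B q K where "n \<ge> (1 :: nat)" "\<And>j k. c j k \<noteq> 0 \<Longrightarrow> real B \<le> real j + real n * real k"
    "\<exists>j k. c j k \<noteq> 0 \<and> real j + real n * real k = real B"
    "fst q \<noteq> 0" "snd q \<noteq> 0" "D < real K" "n * K \<le> B" "real B \<le> d * (1 + real n)"
    "vanishes_to (weighted_part (real n) (real B) c) q K"
proof -
  have compose: "weighted_part l b c' y = weighted_part l b c (leading_map l p e y)"
    if "l \<ge> 1" "\<And>j. real j < l \<Longrightarrow> e j 0 = 0" "\<And>j k. c j k \<noteq> 0 \<Longrightarrow> b \<le> real j + l * real k" for l b y
    using weighted_part_compose(2)[OF f g that(1,3), where \<phi> = "\<lambda>y. (u y, v y)" and \<Phi> = "leading_map l p e"]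
      gf leading_map_limit[OF u v that(1) p0 that(2)] by auto
  show ?thesis
  proof (cases "\<exists>j. real j < m \<and> e j 0 \<noteq> 0")
    case False
    then have e: "\<And>j. real j < m \<Longrightarrow> e j 0 = 0"
      by blast
    obtain j1 k1 where 1: "c j1 k1 \<noteq> 0" "real j1 + m * real k1 \<le> d * (1 + m)"
      using f_supp[OF m] by blast
    obtain j k where jk: "c j k \<noteq> 0" "real j + m * real k \<le> real j1 + m * real k1"
      "\<And>i l. c i l \<noteq> 0 \<Longrightarrow> real j + m * real k \<le> real i + m * real l"
      using exists_minimal_weight[of m c, OF m 1(1)] by blast
    define b where "b = real j + m * real k"
    have "d * (1 + m) < D * (1 + m)"
      using dD m by (intro mult_strict_right_mono) auto
    then have b: "b < D * (1 + m)"
      using jk(2) 1(2) by (simp add: b_def)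
    \<comment> \<open>The support of \<open>g\<close> lies strictly above the line of weight \<open>b\<close>, on which \<open>f\<close> has a monomial.\<close>
    have "weighted_part m b c' y = 0" for y
      unfolding weighted_part_def
    proof (rule sum.neutral, clarify)
      fix i l assume "(i, l) \<in> weighted_line m b"
      then have "c' i l = 0"
        using g_supp[of i l] b by (fastforce simp: weighted_line_def)
      then show "c' i l * fst y ^ i * snd y ^ l = 0"
        by simp
    qed
    moreover obtain \<Psi>1 \<Psi>2 where "\<And>x. leading_map m p e (\<Psi>1 x, \<Psi>2 x) = x"
      using leading_map_inverse[of m p e, OF m det e] by metis
    ultimately have "weighted_part m b c x = 0" for x
      using compose[OF m e, of b "(\<Psi>1 x, \<Psi>2 x)"] jk(3) by (simp add: b_def)
    then have "c j k = 0"
      by (rule weighted_part_eq_0[OF m]) (simp add: b_def)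
    with jk(1) show ?thesis ..
  next
    case True
    define n where "n = (LEAST j. e j 0 \<noteq> 0)"
    have e: "\<And>j. real j < real n \<Longrightarrow> e j 0 = 0" and en: "e n 0 \<noteq> 0" and nm: "real n < m"
    proof -
      obtain j where j: "real j < m" "e j 0 \<noteq> 0"
        using True by blast
      show "e n 0 \<noteq> 0"
        unfolding n_def using j(2) by (rule LeastI)
      have "n \<le> j"
        unfolding n_def using j(2) by (rule Least_le)
      then show "real n < m"
        using j(1) by simp
      show "e j 0 = 0" if "real j < real n" for j
        using that not_less_Least[of j "\<lambda>j. e j 0 \<noteq> 0"] by (auto simp: n_def)
    qed
    have n: "n \<ge> 1"
      using en \<open>e 0 0 = 0\<close> by (cases n) auto
    then have n1: "real n \<ge> 1"
      by simp
    obtain j1 k1 where 1: "c j1 k1 \<noteq> 0" "real j1 + real n * real k1 \<le> d * (1 + real n)"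
      using f_supp[OF n1] by blast
    obtain j k where jk: "c j k \<noteq> 0" "real j + real n * real k \<le> real j1 + real n * real k1"
      "\<And>i l. c i l \<noteq> 0 \<Longrightarrow> real j + real n * real k \<le> real i + real n * real l"
      using exists_minimal_weight[of "real n" c, OF n1 1(1)] by blast
    define B where "B = j + n * k"
    have B: "real B = real j + real n * real k"
      by (simp add: B_def)
    have Bd: "real B \<le> d * (1 + real n)"
      using jk(2) 1(2) by (simp add: B)
    obtain \<Psi>1 \<Psi>2 where \<Psi>: "\<And>x. leading_map (real n) p e (\<Psi>1 x, \<Psi>2 x) = x"
      "\<And>y. (\<Psi>1 (leading_map (real n) p e y), \<Psi>2 (leading_map (real n) p e y)) = y"
      "\<And>x. \<Psi>1 differentiable (at x)" "\<And>x. \<Psi>2 differentiable (at x)"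
      using leading_map_inverse[of "real n" p e, OF n1 det e] by metis
    have comp: "weighted_part (real n) (real B) c' y = weighted_part (real n) (real B) c (leading_map (real n) p e y)" for y
      by (rule compose[OF n1 e]) (use jk(3) in \<open>auto simp: B\<close>)
    \<comment> \<open>Subtract the equation of the line of weight \<open>B\<close> for \<open>n\<close> from the inequality for \<open>m\<close>.\<close>
    have k_gt: "D < real k'" if "c' j' k' \<noteq> 0" "real j' + real n * real k' = real B" for j' k'
    proof -
      have "d * (1 + real n) < D * (1 + real n)"
        using dD by (intro mult_strict_right_mono) auto
      then have "(m - real n) * D < (m - real n) * real k'"
        using g_supp[OF that(1)] that(2) Bd by (simp add: algebra_simps)
      then show ?thesis
        using nm by simp
    qed
    define S where "S k' \<longleftrightarrow> (\<exists>j'. real j' + real n * real k' = real B \<and> c' j' k' \<noteq> 0)" for k'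
    have "\<exists>k'. S k'"
    proof (rule ccontr)
      assume no: "\<not> ?thesis"
      have "weighted_part (real n) (real B) c' y = 0" for y
        unfolding weighted_part_def
        by (rule sum.neutral) (use no in \<open>auto simp: S_def weighted_line_def\<close>)
      then have "weighted_part (real n) (real B) c x = 0" for x
        using comp[of "(\<Psi>1 x, \<Psi>2 x)"] \<Psi>(1) by simp
      then have "c j k = 0"
        by (rule weighted_part_eq_0[OF n1]) (simp add: B)
      with jk(1) show False ..
    qed
    define K where "K = (LEAST k'. S k')"
    have "S K"
      unfolding K_def using \<open>\<exists>k'. S k'\<close> by (rule LeastI_ex)
    then obtain j' where j': "real j' + real n * real K = real B" "c' j' K \<noteq> 0"
      by (auto simp: S_def)
    have K_le: "K \<le> k'" if "S k'" for k'
      unfolding K_def using that by (rule Least_le)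
    define q where "q = leading_map (real n) p e (1, 0)"
    have q\<Psi>: "\<Psi>1 q = 1" "\<Psi>2 q = 0"
      using \<Psi>(2)[of "(1, 0)"] by (auto simp: q_def)
    obtain E N where EN: "\<And>n'. real n' = real n \<Longrightarrow> E = e n' 0 \<and> N = n'"
      "\<And>y. leading_map (real n) p e y = (p 1 0 * fst y + (if real n = 1 then p 0 1 else 0) * snd y, e 0 1 * snd y + E * fst y ^ N)"
      using leading_map_eq[OF n1, of e p] by blast
    have q: "q = (p 1 0, e n 0)"
      using EN(1)[of n] EN(2)[of "(1, 0)"] by (simp add: q_def)
    show ?thesis
    proof (rule that[of n B q K])
      show "D < real K"
        using k_gt[OF j'(2,1)] .
      have "real (j' + n * K) = real B"
        using j'(1) by simp
      then have "j' + n * K = B"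
        using of_nat_eq_iff by blast
      then show "n * K \<le> B"
        by simp
      have "(\<lambda>h. weighted_part (real n) (real B) c' (\<Psi>1 (q + h), \<Psi>2 (q + h))) \<in> O[nhds 0](\<lambda>h. norm h ^ K)"
      proof (rule weighted_part_bigo[OF n1])
        show "isCont \<Psi>1 q"
          using \<Psi>(3) by (rule differentiable_imp_continuous_within)
        show "K \<le> k'" if "real j' + real n * real k' = real B" "c' j' k' \<noteq> 0" for j' k'
          using that by (intro K_le) (auto simp: S_def)
      qed (use \<Psi>(4) q\<Psi> in auto)
      moreover have "weighted_part (real n) (real B) c' (\<Psi>1 x, \<Psi>2 x) = weighted_part (real n) (real B) c x" for x
        using comp \<Psi>(1) by simp
      ultimately show "vanishes_to (weighted_part (real n) (real B) c) q K"
        by simp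
      show "\<exists>j k. c j k \<noteq> 0 \<and> real j + real n * real k = real B"
        using jk(1) B by metis
    qed (use n jk(3) Bd q en p in \<open>auto simp: B\<close>)
  qed
qed

section \<open>Roots of weighted homogeneous polynomials\<close>

lemma weighted_part_homogeneous:
  assumes "x1 \<noteq> 0"
  shows "weighted_part (real n) (real B) c (x1, x2)
    = x1 ^ B * poly (weighted_slice (real n) (real B) c) (x2 / x1 ^ n)"
proof -
  have "c j k * x1 ^ j * x2 ^ k = x1 ^ B * (c j k * (x2 / x1 ^ n) ^ k)"
    if "(j, k) \<in> weighted_line (real n) (real B)" for j k
  proof -
    have "real (j + n * k) = real B"
      using that by (simp add: weighted_line_def)
    then have "B = j + n * k"
      using of_nat_eq_iff by metis
    then show ?thesis
      using assms by (simp add: power_add power_mult power_divide)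
  qed
  then show ?thesis
    unfolding poly_weighted_slice weighted_part_def sum_distrib_left
    by (intro sum.cong) auto
qed

lemma order_ge_of_bigo:
  fixes s :: "real poly"
  assumes "s \<noteq> 0" and O: "(\<lambda>t. poly s (\<alpha> + t)) \<in> O[nhds 0](\<lambda>t. \<bar>t\<bar> ^ K)"
  shows "K \<le> order \<alpha> s"
proof (rule ccontr)
  assume less: "\<not> ?thesis"
  define l where "l = order \<alpha> s"
  have l: "l < K"
    using less by (simp add: l_def)
  obtain w where w: "s = [:- \<alpha>, 1:] ^ l * w" "\<not> [:- \<alpha>, 1:] dvd w"
    using order_decomp[OF \<open>s \<noteq> 0\<close>, of \<alpha>] by (auto simp: l_def)
  obtain C where C: "\<forall>\<^sub>F t in nhds 0. norm (poly s (\<alpha> + t)) \<le> C * norm (\<bar>t\<bar> ^ K)"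
    using landau_o.bigE[OF O] by blast
  have ev: "\<forall>\<^sub>F t in at 0. norm (poly w (\<alpha> + t)) \<le> C * \<bar>t\<bar> ^ (K - l)"
    unfolding eventually_at_filter using C
  proof eventually_elim
    case (elim t)
    show ?case
    proof
      assume t: "t \<noteq> 0"
      have "\<bar>t\<bar> ^ l * \<bar>poly w (\<alpha> + t)\<bar> = \<bar>poly s (\<alpha> + t)\<bar>"
        by (simp add: w(1) abs_mult power_abs)
      also have "\<dots> \<le> C * \<bar>t\<bar> ^ K"
        using elim by simp
      also have "\<dots> = \<bar>t\<bar> ^ l * (C * \<bar>t\<bar> ^ (K - l))"
        using l by (simp add: power_add[symmetric])
      finally show "t \<in> UNIV \<longrightarrow> norm (poly w (\<alpha> + t)) \<le> C * \<bar>t\<bar> ^ (K - l)"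
        using t by simp
    qed
  qed
  have "((\<lambda>t. C * \<bar>t\<bar> ^ (K - l)) \<longlongrightarrow> C * \<bar>0\<bar> ^ (K - l)) (at 0)"
    by (intro tendsto_intros)
  then have "((\<lambda>t. C * \<bar>t\<bar> ^ (K - l)) \<longlongrightarrow> 0) (at 0)"
    using l by (simp add: zero_power)
  from Lim_null_comparison[OF ev this] have lim0: "((\<lambda>t. poly w (\<alpha> + t)) \<longlongrightarrow> 0) (at 0)" .
  have "((\<lambda>t. poly w (\<alpha> + t)) \<longlongrightarrow> poly w (\<alpha> + 0)) (at 0)"
    by (intro tendsto_intros)
  from tendsto_unique[OF _ this lim0] have "poly w \<alpha> = 0"
    by simp
  then show False
    using w(2) by (simp add: poly_eq_0_iff_dvd)
qed

lemma order_slice_ge: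
  assumes s: "weighted_slice (real n) (real B) c \<noteq> 0" and q: "fst q \<noteq> 0"
    and O: "vanishes_to (weighted_part (real n) (real B) c) q K"
  shows "K \<le> order (snd q / fst q ^ n) (weighted_slice (real n) (real B) c)"
proof (rule order_ge_of_bigo[OF s])
  let ?s = "weighted_slice (real n) (real B) c"
  have "((\<lambda>t. (0, fst q ^ n * t)) \<longlongrightarrow> (0, fst q ^ n * 0)) (nhds 0)"
    by (intro tendsto_intros filterlim_ident)
  then have "filterlim (\<lambda>t. (0, fst q ^ n * t)) (nhds 0) (nhds 0)"
    by (simp add: zero_prod_def)
  from landau_o.big.compose[OF O this]
  have "(\<lambda>t. weighted_part (real n) (real B) c (q + (0, fst q ^ n * t))) \<in> O[nhds 0](\<lambda>t. norm (0 :: real, fst q ^ n * t) ^ K)" .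
  moreover have "weighted_part (real n) (real B) c (q + (0, fst q ^ n * t)) = fst q ^ B * poly ?s (snd q / fst q ^ n + t)" for t
    using weighted_part_homogeneous[OF q, of n B c "snd q + fst q ^ n * t"] q
    by (cases q) (simp add: add_divide_distrib)
  moreover have "norm (0 :: real, fst q ^ n * t) ^ K = (\<bar>fst q ^ n\<bar> ^ K) * \<bar>t\<bar> ^ K" for t
    by (simp add: norm_Pair abs_mult) (simp add: power_mult_distrib)
  ultimately show "(\<lambda>t. poly ?s (snd q / fst q ^ n + t)) \<in> O[nhds 0](\<lambda>t. \<bar>t\<bar> ^ K)"
    using q by simp
qed

lemma bigo_of_order_slice:
  assumes K: "K \<le> order \<alpha> (weighted_slice (real n) (real B) c)" and q: "fst q \<noteq> 0" "\<alpha> = snd q / fst q ^ n"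
  shows "vanishes_to (weighted_part (real n) (real B) c) q K"
proof -
  let ?s = "weighted_slice (real n) (real B) c"
  have "[:- \<alpha>, 1:] ^ K dvd ?s"
    using K by (cases "?s = 0") (auto simp: order_divides)
  then obtain w where w: "?s = [:- \<alpha>, 1:] ^ K * w"
    by (rule dvdE)
  define F where "F x = snd x / fst x ^ n - \<alpha>" for x :: "real \<times> real"
  have F: "F differentiable (at q)" "F q = 0"
    using q unfolding F_def[abs_def]
    by (auto intro!: derivative_intros bounded_linear_imp_differentiable[OF bounded_linear_fst]
            bounded_linear_imp_differentiable[OF bounded_linear_snd])
  have "isCont (\<lambda>x. fst x ^ B * poly w (snd x / fst x ^ n)) q"
    using q by (intro continuous_intros) auto
  from landau_o.big.mult[OF continuous_bigo_1[OF this] landau_o.big_power[OF differentiable_bigo_norm[OF F], of K]]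
  have O: "(\<lambda>h. fst (q + h) ^ B * poly w (snd (q + h) / fst (q + h) ^ n) * F (q + h) ^ K) \<in> O[nhds 0](\<lambda>h. norm h ^ K)"
    by simp
  have "isCont (\<lambda>h. fst (q + h)) 0"
    by (intro continuous_intros)
  then have "((\<lambda>h. fst (q + h)) \<longlongrightarrow> fst (q + 0)) (nhds 0)"
    using tendsto_at_iff_tendsto_nhds[of "\<lambda>h. fst (q + h)" 0] unfolding isCont_def by blast
  then have "\<forall>\<^sub>F h in nhds 0. fst (q + h) \<noteq> 0"
    using tendsto_imp_eventually_ne[of "\<lambda>h. fst (q + h)" "fst (q + 0)" "nhds 0" 0] q by simp
  then have "\<forall>\<^sub>F h in nhds 0. fst (q + h) ^ B * poly w (snd (q + h) / fst (q + h) ^ n) * F (q + h) ^ K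
      = weighted_part (real n) (real B) c (q + h)"
  proof eventually_elim
    case (elim h)
    have "weighted_part (real n) (real B) c (q + h) = fst (q + h) ^ B * poly ?s (snd (q + h) / fst (q + h) ^ n)"
      using weighted_part_homogeneous[OF elim, of n B c "snd (q + h)"] by (simp only: prod.collapse)
    then show ?case
      by (simp add: w F_def mult_ac)
  qed
  from landau_o.big.in_cong[OF this] O show ?thesis
    by blast
qed

text \<open>Let \<open>l\<close> be the multiplicity of 0 as a root of the slice \<open>s\<close>.  Then \<open>degree s \<ge> l + K\<close>, where
  \<open>K > d \<ge> B / (1 + n)\<close>.  So the monomial of degree \<open>degree s\<close> in \<open>x\<^sub>2\<close> lies strictly above the diagonal, and
  the one of degree \<open>l\<close>, since \<open>n l \<le> B - n K\<close>, strictly below it.\<close>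

lemma has_principal_edge_of_root:
  assumes supp: "\<And>j k. (j, k) \<in> taylor_support f \<Longrightarrow> real B \<le> real j + real n * real k"
    and n: "n \<ge> 1" and nK: "n * K \<le> B" and Bd: "real B \<le> d * (1 + real n)" and dK: "d < real K"
    and s: "weighted_slice (real n) (real B) (taylor_coeff f 0) \<noteq> 0" and \<alpha>: "\<alpha> \<noteq> 0"
    and K: "K \<le> order \<alpha> (weighted_slice (real n) (real B) (taylor_coeff f 0))"
  shows "has_principal_edge f (1 / real B) (real n / real B)" "0 < B"
proof -
  let ?s = "weighted_slice (real n) (real B) (taylor_coeff f 0)"
  have n1: "real n \<ge> 1"
    using n by simp
  have "0 \<le> d * (1 + real n)"
    using Bd of_nat_0_le_iff order_trans by blast
  then have "0 \<le> d"
    using n1 by (simp add: zero_le_mult_iff)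
  then have "K > 0"
    using dK by (cases K) auto
  then have "0 < n * K"
    using n by simp
  then show B: "0 < B"
    using nK by linarith
  define l where "l = order 0 ?s"
  obtain w where w: "?s = [:- 0, 1:] ^ l * w" "\<not> [:- 0, 1:] dvd w"
    using order_decomp[OF s, of 0] by (auto simp: l_def)
  have X: "[:- 0, 1:] ^ l = (monom 1 l :: real poly)"
    by (simp add: monom_altdef)
  have w0: "w \<noteq> 0" "coeff w 0 \<noteq> 0"
    using s w poly_eq_0_iff_dvd[of w 0] poly_0_coeff_0[of w] by auto
  have "K \<le> order \<alpha> w"
  proof -
    have "order \<alpha> ?s = order \<alpha> ([:- 0, 1:] ^ l) + order \<alpha> w"
      using s w(1) order_mult by metis
    moreover have "order \<alpha> ([:- 0, 1:] ^ l) = 0"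
      using \<alpha> by (intro order_0I) simp
    ultimately show ?thesis
      using K by simp
  qed
  then have "K \<le> degree w"
    using order_degree[OF w0(1), of \<alpha>] by linarith
  moreover have "degree ?s = l + degree w"
    unfolding w(1) X using w0 by (simp add: degree_mult_eq degree_monom_eq monom_eq_0_iff)
  ultimately have deg: "l + K \<le> degree ?s"
    by simp
  have "coeff ?s l \<noteq> 0"
    using w0(2) unfolding w(1) X by (simp add: coeff_monom_mult)
  then obtain j2 where j2: "real j2 + real n * real l = real B" "taylor_coeff f 0 j2 l \<noteq> 0"
    using coeff_weighted_slice_nonzero[OF n1] by blast
  have "coeff ?s (degree ?s) \<noteq> 0"
    using s by simp
  then obtain j1 where j1: "real j1 + real n * real (degree ?s) = real B" "taylor_coeff f 0 j1 (degree ?s) \<noteq> 0"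
    using coeff_weighted_slice_nonzero[OF n1] by blast
  have "d * (1 + real n) < real K * (1 + real n)"
    using dK n1 by (intro mult_strict_right_mono) auto
  then have KB: "real B < real K * (1 + real n)"
    using Bd by linarith
  have degB: "real n * real l + real n * real K \<le> real n * real (degree ?s)"
    unfolding distrib_left[symmetric] using deg n1 by (intro mult_left_mono) auto
  have "0 \<le> real n * real l"
    by simp
  have top: "real j1 * (1 + real n) < real B"
  proof -
    have "real j1 \<le> real B - real n * real K"
      using j1(1) degB \<open>0 \<le> real n * real l\<close> by linarith
    then have "real j1 * (1 + real n) \<le> (real B - real n * real K) * (1 + real n)"
      by (intro mult_right_mono) auto
    also have "\<dots> = real B + real n * (real B - real K * (1 + real n))"
      by (simp add: algebra_simps)
    also have "\<dots> < real B"
      using KB n1 by (simp add: mult_pos_neg)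
    finally show ?thesis .
  qed
  have bot: "real l * (1 + real n) < real B"
  proof -
    have "real n * real l \<le> real B - real n * real K"
      using j1(1) degB of_nat_0_le_iff[of j1] by linarith
    then have "real n * real l * (1 + real n) \<le> (real B - real n * real K) * (1 + real n)"
      by (intro mult_right_mono) auto
    also have "\<dots> = real B + real n * (real B - real K * (1 + real n))"
      by (simp add: algebra_simps)
    also have "\<dots> < real B"
      using KB n1 by (simp add: mult_pos_neg)
    also have "\<dots> \<le> real n * real B"
      using n1 mult_right_mono[of 1 "real n" "real B"] by simp
    finally have "real n * (real l * (1 + real n)) < real n * real B"
      by (simp add: mult.assoc)
    then show ?thesis
      using n1 by simp
  qed
  show "has_principal_edge f (1 / real B) (real n / real B)"
    by (rule has_principal_edgeI[of n B f j1 "degree ?s" j2 l])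
      (use n B supp j1 j2 top bot in \<open>auto simp: taylor_support_def\<close>)
qed

section \<open>Germs and the interchange of the coordinates\<close>

definition smooth_germ :: "(real \<times> real \<Rightarrow> real) \<Rightarrow> bool" where
  "smooth_germ f \<longleftrightarrow> (\<exists>U. open U \<and> 0 \<in> U \<and> smooth_on U f)"

lemma smooth_germ_expansion: "smooth_germ f \<Longrightarrow> expansion f (taylor_coeff f 0)"
  unfolding smooth_germ_def using taylor_expansion[of _ 0 f] by auto

lemma smooth_germ_taylor_coeff: "smooth_germ f \<Longrightarrow> expansion f c \<Longrightarrow> taylor_coeff f 0 = c"
  using expansion_unique smooth_germ_expansion by blast

lemma taylor_coeff_0_0: "taylor_coeff f p 0 0 = f p"
  by (simp add: taylor_coeff_def partial_deriv_0)

lemma smooth_germ_compose: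
  assumes "smooth_germ f" "smooth_germ u" "smooth_germ v" "u 0 = 0" "v 0 = 0"
  shows "smooth_germ (\<lambda>x. f (u x, v x))"
proof -
  obtain Uf Uu Uv where U: "open Uf" "0 \<in> Uf" "smooth_on Uf f" "open Uu" "0 \<in> Uu" "smooth_on Uu u"
    "open Uv" "0 \<in> Uv" "smooth_on Uv v"
    using assms(1-3) by (auto simp: smooth_germ_def)
  define W where "W = (Uu \<inter> Uv) \<inter> (\<lambda>x. (u x, v x)) -` Uf"
  have "continuous_on (Uu \<inter> Uv) (\<lambda>x. (u x, v x))"
    using smooth_on_continuous[OF U(6)] smooth_on_continuous[OF U(9)]
    by (intro continuous_on_Pair) (auto intro: continuous_on_subset)
  then have W: "open W"
    unfolding W_def using U by (intro continuous_open_preimage) auto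
  have "smooth_on W (\<lambda>x. f (u x, v x))"
    by (rule smooth_on_compose[OF W _ _ U(3)]) (use U W in \<open>auto simp: W_def intro: smooth_on_subset\<close>)
  moreover have "0 \<in> W"
    using U assms(4,5) by (simp add: W_def zero_prod_def)
  ultimately show ?thesis
    using W by (auto simp: smooth_germ_def)
qed

lemma smooth_germ_fst: "smooth_germ fst" and smooth_germ_snd: "smooth_germ snd"
  unfolding smooth_germ_def using smooth_on_linear[OF open_UNIV] bounded_linear_fst bounded_linear_snd by blast+

lemma smooth_germ_swap: "smooth_germ f \<Longrightarrow> smooth_germ (f \<circ> prod.swap)"
  using smooth_germ_compose[OF _ smooth_germ_snd smooth_germ_fst, of f] by (simp add: o_def prod.swap_def)

lemma filterlim_swap: "filterlim prod.swap (nhds 0) (nhds (0 :: real \<times> real))"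
proof -
  have "((\<lambda>x :: real \<times> real. (snd x, fst x)) \<longlongrightarrow> (snd (0 :: real \<times> real), fst (0 :: real \<times> real))) (nhds 0)"
    using tendsto_Pair[OF tendsto_snd[OF filterlim_ident] tendsto_fst[OF filterlim_ident]] .
  then show ?thesis
    by (simp add: prod.swap_def[abs_def] flip: zero_prod_def)
qed

lemma norm_swap: "norm (prod.swap x) = norm (x :: real \<times> real)"
  by (cases x) (simp add: norm_Pair add.commute)

lemma expansion_swap:
  assumes "expansion f c"
  shows "expansion (f \<circ> prod.swap) (\<lambda>j k. c k j)"
  unfolding expansion_def
proof
  fix N
  have "(\<lambda>x. f x - taylor_sum c N x) \<in> O[nhds 0](\<lambda>x. norm x ^ N)"
    using assms unfolding expansion_def by blast
  from landau_o.big.compose[OF this filterlim_swap]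
  have "(\<lambda>x. f (prod.swap x) - taylor_sum c N (prod.swap x)) \<in> O[nhds 0](\<lambda>x. norm x ^ N)"
    by (simp only: norm_swap)
  moreover have "taylor_sum c N (prod.swap x) = taylor_sum (\<lambda>j k. c k j) N x" for x
    by (rule sum.reindex_bij_witness[of _ prod.swap prod.swap]) auto
  ultimately show "(\<lambda>x. (f \<circ> prod.swap) x - taylor_sum (\<lambda>j k. c k j) N x) \<in> O[nhds 0](\<lambda>x. norm x ^ N)"
    by simp
qed

text \<open>This contains the symmetry of mixed derivatives and is obtained from the uniqueness of expansions.\<close>

lemma taylor_coeff_swap:
  assumes "smooth_germ f"
  shows "taylor_coeff (f \<circ> prod.swap) 0 j k = taylor_coeff f 0 k j"
  using smooth_germ_taylor_coeff[OF smooth_germ_swap[OF assms] expansion_swap[OF smooth_germ_expansion[OF assms]]]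
  by simp

lemma taylor_support_swap:
  "smooth_germ f \<Longrightarrow> (j, k) \<in> taylor_support (f \<circ> prod.swap) \<longleftrightarrow> (k, j) \<in> taylor_support f"
  by (simp add: taylor_support_def taylor_coeff_swap)

lemma finite_type_swap: "smooth_germ f \<Longrightarrow> finite_type f \<Longrightarrow> finite_type (f \<circ> prod.swap)"
  unfolding finite_type_def using taylor_support_swap by fastforce

lemma has_principal_edge_swap:
  assumes "smooth_germ f" "has_principal_edge f \<kappa>1 \<kappa>2"
  shows "has_principal_edge (f \<circ> prod.swap) \<kappa>2 \<kappa>1"
proof -
  have "\<exists>(j, k)\<in>taylor_support (f \<circ> prod.swap). P j k" if "\<exists>(j, k)\<in>taylor_support f. P k j" for P
    using that taylor_support_swap[OF assms(1)] by fastforce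
  moreover have "\<forall>(j, k)\<in>taylor_support (f \<circ> prod.swap). P j k" if "\<forall>(j, k)\<in>taylor_support f. P k j" for P
    using that taylor_support_swap[OF assms(1)] by fastforce
  ultimately show ?thesis
    using assms(2) unfolding has_principal_edge_def by (simp add: add.commute)
qed

lemma newton_distance_swap:
  assumes f: "smooth_germ f" "finite_type f"
  shows "newton_distance (f \<circ> prod.swap) = newton_distance f"
proof -
  have le: "newton_distance f \<le> newton_distance (f \<circ> prod.swap)" if f: "smooth_germ f" "finite_type f" for f
  proof (rule dense_le)
    fix D assume "D < newton_distance f"
    then obtain a1 a2 where a: "a1 > 0" "a2 > 0"
      "\<And>j k. (j, k) \<in> taylor_support f \<Longrightarrow> D * (a1 + a2) \<le> a1 * real j + a2 * real k"
      using separating_weight[OF f(2)] by blast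
    show "D \<le> newton_distance (f \<circ> prod.swap)"
      by (rule newton_distance_ge[OF finite_type_swap[OF f], of a2 a1])
        (use a in \<open>auto simp: taylor_support_swap[OF f(1)] add.commute\<close>)
  qed
  have "f \<circ> prod.swap \<circ> prod.swap = f"
    by (simp add: comp_assoc)
  then show ?thesis
    using le[OF f] le[OF smooth_germ_swap[OF f(1)] finite_type_swap[OF f]] by simp
qed

lemma exists_support_below_distance:
  assumes f: "finite_type f" and m: "m \<ge> 1"
  shows "\<exists>j k. taylor_coeff f 0 j k \<noteq> 0 \<and> real j + m * real k \<le> newton_distance f * (1 + m)"
proof -
  obtain j0 k0 where "taylor_coeff f 0 j0 k0 \<noteq> 0"
    using f by (auto simp: finite_type_def taylor_support_def)
  from exists_minimal_weight[of m "taylor_coeff f 0", OF m this]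
  obtain j k where jk: "taylor_coeff f 0 j k \<noteq> 0"
    "\<And>j' k'. taylor_coeff f 0 j' k' \<noteq> 0 \<Longrightarrow> real j + m * real k \<le> real j' + m * real k'"
    by metis
  have "(real j + m * real k) / (1 + m) \<le> newton_distance f"
    by (rule newton_distance_ge[OF f, of 1 m]) (use m jk(2) in \<open>auto simp: taylor_support_def\<close>)
  then show ?thesis
    using jk(1) m by (auto simp: field_simps)
qed

section \<open>Coordinates of larger distance\<close>

text \<open>What a coordinate system of distance larger than \<open>D\<close> reveals about \<open>f\<close>.  The upper bound for \<open>K\<close> is
  recorded because it bounds all distances \<open>d(f \<circ> \<phi>)\<close>, so that the supremum defining the height is
  a genuine one.\<close>

definition has_root_above :: "(real \<times> real \<Rightarrow> real) \<Rightarrow> nat \<Rightarrow> real \<Rightarrow> bool" where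
  "has_root_above f n D \<longleftrightarrow> (\<exists>\<kappa> q K. has_principal_edge f \<kappa> (real n * \<kappa>) \<and> fst q \<noteq> 0 \<and> snd q \<noteq> 0 \<and>
     D < real K \<and> real K \<le> 2 * newton_distance f \<and>
     vanishes_to (principal_part f) q K)"

lemma has_root_above_mono: "has_root_above f n D' \<Longrightarrow> D \<le> D' \<Longrightarrow> has_root_above f n D"
  unfolding has_root_above_def by (meson le_less_trans)

lemma principal_part_eq_weighted_part:
  assumes E: "has_principal_edge f (1 / real B) (real n / real B)" and "0 < B"
  shows "principal_part f = weighted_part (real n) (real B) (taylor_coeff f 0)"
proof -
  have "1 / real B * real j + real n / real B * real k = 1 \<longleftrightarrow> real j + real n * real k = real B" for j k
    using \<open>0 < B\<close> by (auto simp: field_simps)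
  then show ?thesis
    using has_principal_edge_principal_part(2)[OF E] by (simp add: fun_eq_iff weighted_part_def weighted_line_def)
qed

lemma coordinate_change_has_root_above:
  assumes f: "smooth_germ f" "finite_type f" and u: "smooth_germ u" "u 0 = 0" and v: "smooth_germ v" "v 0 = 0"
    and det: "taylor_coeff u 0 1 0 * taylor_coeff v 0 0 1 - taylor_coeff u 0 0 1 * taylor_coeff v 0 1 0 \<noteq> 0"
    and p: "taylor_coeff u 0 1 0 \<noteq> 0"
    and m: "m \<ge> 1" and g: "\<And>j k. taylor_coeff (\<lambda>x. f (u x, v x)) 0 j k \<noteq> 0 \<Longrightarrow> D * (1 + m) \<le> real j + m * real k"
    and D: "newton_distance f < D"
  shows "\<exists>n\<ge>1. has_root_above f n D"
proof -
  let ?c = "taylor_coeff f 0"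
  have uv0: "taylor_coeff u 0 0 0 = 0" "taylor_coeff v 0 0 0 = 0"
    using u(2) v(2) by (simp_all add: taylor_coeff_0_0)
  note root = coordinate_change_forces_root[OF smooth_germ_expansion[OF f(1)]
      smooth_germ_expansion[OF smooth_germ_compose[OF f(1) u(1) v(1) u(2) v(2)]] always_eventually[OF allI[OF refl]]
      smooth_germ_expansion[OF u(1)] smooth_germ_expansion[OF v(1)] uv0 det p m g
      exists_support_below_distance[OF f(2)] D]
  obtain n B q K where n: "n \<ge> (1 :: nat)" and supp: "\<And>j k. ?c j k \<noteq> 0 \<Longrightarrow> real B \<le> real j + real n * real k"
    and ex: "\<exists>j k. ?c j k \<noteq> 0 \<and> real j + real n * real k = real B"
    and q: "fst q \<noteq> 0" "snd q \<noteq> 0" and K: "D < real K" "n * K \<le> B" and B: "real B \<le> newton_distance f * (1 + real n)"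
    and O: "vanishes_to (weighted_part (real n) (real B) ?c) q K"
    by (rule root, assumption, assumption) (rule that)
  let ?s = "weighted_slice (real n) (real B) ?c"
  have "?s \<noteq> 0"
    using ex n coeff_weighted_slice[of "real n" _ _ "real B" ?c] by (metis coeff_0 of_nat_1 of_nat_le_iff)
  note ord = order_slice_ge[OF this q(1) O]
  have "has_principal_edge f (1 / real B) (real n / real B) \<and> 0 < B"
    using has_principal_edge_of_root[OF _ n K(2) B _ \<open>?s \<noteq> 0\<close> _ ord] supp q K(1) D
    by (auto simp: taylor_support_def)
  then have E: "has_principal_edge f (1 / real B) (real n / real B)" "0 < B"
    by auto
  have nd: "newton_distance f = real B / (1 + real n)"
    using has_principal_edge_geometry(1)[OF E(1)] by (simp add: add_divide_distrib[symmetric])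
  have "real n * real K \<le> real B"
    using K(2) by (metis of_nat_le_iff of_nat_mult)
  then have "real K * (1 + real n) \<le> 2 * real B"
  proof -
    have "1 * real K \<le> real n * real K"
      using n by (intro mult_right_mono) auto
    then show ?thesis
      using \<open>real n * real K \<le> real B\<close> by (simp add: algebra_simps)
  qed
  then have "real K \<le> 2 * newton_distance f"
    using n by (simp add: nd field_simps)
  then have "has_root_above f n D"
    unfolding has_root_above_def using E q K(1) O principal_part_eq_weighted_part[OF E]
    by (intro exI[of _ "1 / real B"] exI[of _ q] exI[of _ K]) auto
  then show ?thesis
    using n by blast
qed

text \<open>For the weight 1 the leading map is the invertible derivative, so the lowest homogeneous part of \<open>f\<close>
  cannot disappear.\<close>

lemma finite_type_compose:
  assumes f: "smooth_germ f" "finite_type f" and u: "smooth_germ u" "u 0 = 0" and v: "smooth_germ v" "v 0 = 0"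
    and det: "taylor_coeff u 0 1 0 * taylor_coeff v 0 0 1 - taylor_coeff u 0 0 1 * taylor_coeff v 0 1 0 \<noteq> 0"
  shows "finite_type (\<lambda>x. f (u x, v x))"
proof (rule ccontr)
  let ?g = "\<lambda>x. f (u x, v x)"
  have g: "smooth_germ ?g"
    using smooth_germ_compose[OF f(1) u(1) v(1) u(2) v(2)] .
  assume "\<not> finite_type ?g"
  then have 0: "taylor_coeff ?g 0 j k = 0" for j k
    by (auto simp: finite_type_def taylor_support_def)
  obtain j0 k0 where jk0: "taylor_coeff f 0 j0 k0 \<noteq> 0"
    using f(2) by (auto simp: finite_type_def taylor_support_def)
  obtain j k where jk: "taylor_coeff f 0 j k \<noteq> 0"
    "\<And>j' k'. taylor_coeff f 0 j' k' \<noteq> 0 \<Longrightarrow> real j + 1 * real k \<le> real j' + 1 * real k'"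
    using exists_minimal_weight[of 1 "taylor_coeff f 0", OF order_refl jk0] by metis
  define b where "b = real j + 1 * real k"
  have uv0: "taylor_coeff u 0 0 0 = 0" "taylor_coeff v 0 0 0 = 0"
    using u(2) v(2) by (simp_all add: taylor_coeff_0_0)
  have e: "taylor_coeff v 0 j 0 = 0" if "real j < 1" for j
    using that uv0(2) by simp
  have "weighted_part 1 b (taylor_coeff ?g 0) y
      = weighted_part 1 b (taylor_coeff f 0) (leading_map 1 (taylor_coeff u 0) (taylor_coeff v 0) y)" for y
  proof (rule weighted_part_compose(2)[OF smooth_germ_expansion[OF f(1)] smooth_germ_expansion[OF g], where \<phi> = "\<lambda>y. (u y, v y)"])
    show "((\<lambda>r. (fst (u (dilation 1 r y), v (dilation 1 r y)) / r, snd (u (dilation 1 r y), v (dilation 1 r y)) / r powr 1))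
        \<longlongrightarrow> leading_map 1 (taylor_coeff u 0) (taylor_coeff v 0) y) (at_right 0)" for y
      using leading_map_limit[OF smooth_germ_expansion[OF u(1)] smooth_germ_expansion[OF v(1)] order_refl uv0(1) e]
      unfolding fst_conv snd_conv .
  qed (use jk(2) in \<open>auto simp: b_def\<close>)
  then have "weighted_part 1 b (taylor_coeff f 0) (leading_map 1 (taylor_coeff u 0) (taylor_coeff v 0) y) = 0" for y
    by (simp add: weighted_part_def 0)
  moreover obtain \<Psi>1 \<Psi>2 where "\<And>x. leading_map 1 (taylor_coeff u 0) (taylor_coeff v 0) (\<Psi>1 x, \<Psi>2 x) = x"
    using leading_map_inverse[of 1 "taylor_coeff u 0" "taylor_coeff v 0", OF order_refl det e] by metis
  ultimately have "weighted_part 1 b (taylor_coeff f 0) x = 0" for x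
    by metis
  then have "taylor_coeff f 0 j k = 0"
    by (rule weighted_part_eq_0[OF order_refl]) (simp add: b_def)
  with jk(1) show False ..
qed

text \<open>Interchanging \<open>y\<^sub>1\<close> and \<open>y\<^sub>2\<close> makes the separating weight of the form \<open>(1, m)\<close> with \<open>m \<ge> 1\<close>; interchanging
  \<open>x\<^sub>1\<close> and \<open>x\<^sub>2\<close>, which replaces \<open>f\<close> by \<open>f \<circ> prod.swap\<close>, makes the coefficient of \<open>y\<^sub>1\<close> in the first
  component nonzero.\<close>

lemma larger_distance_has_root_above:
  assumes f: "smooth_germ f" "finite_type f" and u: "smooth_germ u" "u 0 = 0" and v: "smooth_germ v" "v 0 = 0"
    and det: "taylor_coeff u 0 1 0 * taylor_coeff v 0 0 1 - taylor_coeff u 0 0 1 * taylor_coeff v 0 1 0 \<noteq> 0"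
    and D: "newton_distance f \<le> D" "D < newton_distance (\<lambda>x. f (u x, v x))"
  shows "\<exists>h n. (h = f \<or> h = f \<circ> prod.swap) \<and> n \<ge> 1 \<and> has_root_above h n D"
proof -
  let ?g = "\<lambda>x. f (u x, v x)"
  have g: "smooth_germ ?g"
    using smooth_germ_compose[OF f(1) u(1) v(1) u(2) v(2)] .
  \<comment> \<open>The strict inequality between \<open>d(f)\<close> and the order of \<open>g\<close> is needed, but \<open>D = d(f)\<close> is allowed.\<close>
  obtain D' where D': "D < D'" "D' < newton_distance ?g"
    using dense[OF D(2)] by blast
  have one: "\<exists>h n. (h = f \<or> h = f \<circ> prod.swap) \<and> n \<ge> 1 \<and> has_root_above h n D'"
    if u: "smooth_germ u" "u 0 = 0" and v: "smooth_germ v" "v 0 = 0"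
      and det: "taylor_coeff u 0 1 0 * taylor_coeff v 0 0 1 - taylor_coeff u 0 0 1 * taylor_coeff v 0 1 0 \<noteq> 0"
      and m: "m \<ge> 1" and g: "\<And>j k. taylor_coeff (\<lambda>x. f (u x, v x)) 0 j k \<noteq> 0 \<Longrightarrow> D' * (1 + m) \<le> real j + m * real k" for u v m
  proof (cases "taylor_coeff u 0 1 0 = 0")
    case False
    then show ?thesis
      using coordinate_change_has_root_above[OF f u v det _ m g] D(1) D'(1) by force
  next
    case True
    have eq: "(\<lambda>x. (f \<circ> prod.swap) (v x, u x)) = (\<lambda>x. f (u x, v x))"
      by (simp add: fun_eq_iff)
    have "\<exists>n\<ge>1. has_root_above (f \<circ> prod.swap) n D'"
    proof (rule coordinate_change_has_root_above[OF smooth_germ_swap[OF f(1)] finite_type_swap[OF f] v u _ _ m])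
      show "taylor_coeff v 0 1 0 * taylor_coeff u 0 0 1 - taylor_coeff v 0 0 1 * taylor_coeff u 0 1 0 \<noteq> 0"
        "taylor_coeff v 0 1 0 \<noteq> 0"
        using det True by auto
      show "D' * (1 + m) \<le> real j + m * real k" if "taylor_coeff (\<lambda>x. (f \<circ> prod.swap) (v x, u x)) 0 j k \<noteq> 0" for j k
        using that g unfolding eq by blast
      show "newton_distance (f \<circ> prod.swap) < D'"
        using newton_distance_swap[OF f] D(1) D'(1) by simp
    qed
    then show ?thesis
      by blast
  qed
  have ft: "finite_type ?g"
    by (rule finite_type_compose[OF f u v det])
  obtain a1 a2 where a: "a1 > 0" "a2 > 0"
    "\<And>j k. (j, k) \<in> taylor_support ?g \<Longrightarrow> D' * (a1 + a2) \<le> a1 * real j + a2 * real k"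
    using separating_weight[OF ft D'(2)] by blast
  have "\<exists>h n. (h = f \<or> h = f \<circ> prod.swap) \<and> n \<ge> 1 \<and> has_root_above h n D'"
  proof (cases "a1 \<le> a2")
    case True
    show ?thesis
    proof (rule one[OF u v det, of "a2 / a1"])
      fix j k assume "taylor_coeff ?g 0 j k \<noteq> 0"
      then have "D' * (a1 + a2) / a1 \<le> (a1 * real j + a2 * real k) / a1"
        using a by (intro divide_right_mono) (auto simp: taylor_support_def)
      then show "D' * (1 + a2 / a1) \<le> real j + a2 / a1 * real k"
        using a(1) by (simp add: add_divide_distrib distrib_left)
    qed (use True a in simp)
  next
    case False
    have eq: "(\<lambda>x. f ((u \<circ> prod.swap) x, (v \<circ> prod.swap) x)) = ?g \<circ> prod.swap"
      by (simp add: fun_eq_iff)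
    show ?thesis
    proof (rule one[of "u \<circ> prod.swap" "v \<circ> prod.swap" "a1 / a2"])
      show "taylor_coeff (u \<circ> prod.swap) 0 1 0 * taylor_coeff (v \<circ> prod.swap) 0 0 1
          - taylor_coeff (u \<circ> prod.swap) 0 0 1 * taylor_coeff (v \<circ> prod.swap) 0 1 0 \<noteq> 0"
        using det by (simp add: taylor_coeff_swap u v algebra_simps)
      fix j k assume "taylor_coeff (\<lambda>x. f ((u \<circ> prod.swap) x, (v \<circ> prod.swap) x)) 0 j k \<noteq> 0"
      then have "taylor_coeff ?g 0 k j \<noteq> 0"
        unfolding eq taylor_coeff_swap[OF g] .
      then have "D' * (a1 + a2) / a2 \<le> (a1 * real k + a2 * real j) / a2"
        using a by (intro divide_right_mono) (auto simp: taylor_support_def)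
      then show "D' * (1 + a1 / a2) \<le> real j + a1 / a2 * real k"
        using a(2) by (simp add: add_divide_distrib distrib_left add.commute)
    qed (use False a u v in \<open>auto intro: smooth_germ_swap simp: zero_prod_def\<close>)
  qed
  then show ?thesis
    using has_root_above_mono[of _ _ D' D] D'(1) less_imp_le by blast
qed

section \<open>Orders of vanishing of the principal part\<close>

text \<open>The least total degree in \<^const>\<open>vanishing_order\<close> exists only if the Taylor series does not vanish;
  the bound \<open>b\<close> guarantees this.\<close>

lemma vanishing_order_bigo:
  fixes P :: "real \<times> real \<Rightarrow> real"
  assumes P: "smooth_on UNIV P"
    and bound: "\<And>K. vanishes_to P p K \<Longrightarrow> K \<le> b"
  shows "vanishing_order P p \<le> b"
    and "vanishes_to P p K \<Longrightarrow> K \<le> vanishing_order P p"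
proof -
  have ex: "expansion (\<lambda>h. P (p + h)) (taylor_coeff P p)"
    by (rule taylor_expansion[OF open_UNIV UNIV_I P])
  let ?Q = "\<lambda>n. \<exists>j k. j + k = n \<and> taylor_coeff P p j k \<noteq> 0"
  have nonflat: "\<exists>n. ?Q n"
  proof (rule ccontr)
    assume "\<not> ?thesis"
    then have "vanishes_to P p (b + 1)"
      by (intro expansion_imp_bigo[OF ex]) auto
    from bound[OF this] show False
      by simp
  qed
  have "taylor_coeff P p j k = 0" if "j + k < vanishing_order P p" for j k
    using not_less_Least[of "j + k" ?Q] that unfolding vanishing_order_def by blast
  then have "vanishes_to P p (vanishing_order P p)"
    by (rule expansion_imp_bigo[OF ex])
  then show "vanishing_order P p \<le> b"
    by (rule bound)
  assume O: "vanishes_to P p K"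
  obtain j k where "j + k = vanishing_order P p" "taylor_coeff P p j k \<noteq> 0"
    using LeastI_ex[OF nonflat] unfolding vanishing_order_def by blast
  then show "K \<le> vanishing_order P p"
    using expansion_bigo_imp_coeff_0[OF ex O, of j k] not_le by metis
qed

lemma smooth_on_monomial_sum:
  "smooth_on UNIV (\<lambda>x :: real \<times> real. \<Sum>(j, k)\<in>A. c j k * fst x ^ j * snd x ^ k)"
  unfolding case_prod_beta
  by (intro smooth_on_sum smooth_on_mult smooth_on_power smooth_on_const smooth_on_linear
      bounded_linear_fst bounded_linear_snd open_UNIV)

lemma order_0_le:
  fixes s :: "real poly"
  assumes "coeff s k \<noteq> 0"
  shows "order 0 s \<le> k"
proof -
  have "s \<noteq> 0"
    using assms by auto
  then obtain w where "s = [:- 0, 1:] ^ order 0 s * w"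
    using order_decomp[of s 0] by blast
  also have "[:- 0, 1:] ^ order 0 s = (monom 1 (order 0 s) :: real poly)"
    by (simp add: monom_altdef)
  finally have "coeff s k = coeff (monom 1 (order 0 s) * w) k"
    by (rule arg_cong)
  then show ?thesis
    using assms by (auto simp: coeff_monom_mult split: if_splits)
qed

lemma order_add_order_le_degree:
  fixes s :: "real poly"
  assumes "s \<noteq> 0" "a \<noteq> b"
  shows "order a s + order b s \<le> degree s"
proof -
  obtain w where w: "s = [:- a, 1:] ^ order a s * w"
    using order_decomp[OF assms(1), of a] by blast
  then have w0: "w \<noteq> 0"
    using assms(1) by auto
  have "order b s = order b ([:- a, 1:] ^ order a s) + order b w"
    using w assms(1) order_mult by metis
  moreover have "order b ([:- a, 1:] ^ order a s) = 0"
    using assms(2) by (intro order_0I) simp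
  moreover have "order b w \<le> degree w"
    using order_degree[OF w0] .
  moreover have "degree s = order a s + degree w"
    using arg_cong[OF w, of degree] w0 by (simp add: degree_mult_eq degree_linear_power)
  ultimately show ?thesis
    by simp
qed

text \<open>A weighted homogeneous polynomial of weight \<open>B\<close> for the weights \<open>(1, n)\<close> with monomials on both sides
  of the diagonal, which is met by the line of weight \<open>B\<close> at \<open>(d, d)\<close>.\<close>

context
  fixes n B :: nat and c :: "nat \<Rightarrow> nat \<Rightarrow> real" and j1 k1 j2 k2 :: nat and d :: real
  assumes n: "n \<ge> 1" and B: "B > 0" and d: "d = real B / (1 + real n)"
    and top: "c j1 k1 \<noteq> 0" "real j1 + real n * real k1 = real B" "real j1 < d"
    and bot: "c j2 k2 \<noteq> 0" "real j2 + real n * real k2 = real B" "real k2 < d"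
begin

abbreviation (input) "edge_part \<equiv> weighted_part (real n) (real B) c"
abbreviation (input) "edge_slice \<equiv> weighted_slice (real n) (real B) c"

lemma n_ge_1: "real n \<ge> 1"
  using n by simp

lemma edge_slice_nonzero: "edge_slice \<noteq> 0"
  using coeff_weighted_slice[OF n_ge_1 top(2), of c] top(1) by auto

lemma degree_edge_slice_le: "real n * real (degree edge_slice) \<le> real B"
proof -
  have "coeff edge_slice (degree edge_slice) \<noteq> 0"
    using edge_slice_nonzero by simp
  then obtain j where "real j + real n * real (degree edge_slice) = real B"
    using coeff_weighted_slice_nonzero[OF n_ge_1] by blast
  then show ?thesis
    by linarith
qed

lemma smooth_on_edge_part: "smooth_on UNIV edge_part"
  using smooth_on_monomial_sum[where A = "weighted_line (real n) (real B)" and c = c] by (simp add: weighted_part_def[abs_def])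

lemma vanishing_order_off_axis:
  assumes q: "fst q \<noteq> 0"
  shows "vanishing_order edge_part q = order (snd q / fst q ^ n) edge_slice"
    and "vanishes_to edge_part q K \<Longrightarrow> K \<le> order (snd q / fst q ^ n) edge_slice"
proof -
  show ge: "K \<le> order (snd q / fst q ^ n) edge_slice" if "vanishes_to edge_part q K" for K
    using order_slice_ge[OF edge_slice_nonzero q that] .
  show "vanishing_order edge_part q = order (snd q / fst q ^ n) edge_slice"
    using vanishing_order_bigo[OF smooth_on_edge_part, of q, OF ge]
      bigo_of_order_slice[OF order_refl q refl] by (simp add: order.antisym)
qed

text \<open>At a point of the \<open>x\<^sub>1\<close>-axis the order is at most the exponent of \<open>x\<^sub>2\<close> in any monomial that occurs,
  and similarly for the \<open>x\<^sub>2\<close>-axis; the two given monomials have small exponents.\<close>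

lemma vanishing_order_on_axes:
  assumes "q \<noteq> 0" "fst q = 0 \<or> snd q = 0"
  shows "real (vanishing_order edge_part q) < d"
proof (cases "fst q = 0")
  case False
  then have "vanishing_order edge_part q = order 0 edge_slice"
    using vanishing_order_off_axis(1)[OF False] assms(2) by simp
  also have "\<dots> \<le> k2"
    by (rule order_0_le) (use coeff_weighted_slice[OF n_ge_1 bot(2), of c] bot(1) in simp)
  finally show ?thesis
    using bot(3) by linarith
next
  case True
  then have q: "q = (0, snd q)" "snd q \<noteq> 0"
    using assms(1) by (auto simp: prod_eq_iff)
  define t where "t = (\<Sum>(j, k)\<in>weighted_line (real n) (real B). monom (c j k * snd q ^ k) j)"
  have poly_t: "poly t x = edge_part (q + (x, 0))" for x
    using True by (simp add: t_def weighted_part_def poly_sum poly_monom case_prod_unfold mult_ac)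
  have "coeff t j1 = (\<Sum>(j, k)\<in>weighted_line (real n) (real B). if j = j1 then c j k * snd q ^ k else 0)"
    by (simp add: t_def coeff_sum case_prod_unfold)
  also have "\<dots> = (\<Sum>(j, k)\<in>{(j1, k1)}. if j = j1 then c j k * snd q ^ k else 0)"
  proof (rule sum.mono_neutral_right[OF finite_weighted_line[OF n_ge_1]])
    show "\<forall>i\<in>weighted_line (real n) (real B) - {(j1, k1)}. (case i of (j, k) \<Rightarrow> if j = j1 then c j k * snd q ^ k else 0) = 0"
    proof
      fix i assume i: "i \<in> weighted_line (real n) (real B) - {(j1, k1)}"
      have "fst i \<noteq> j1"
      proof
        assume "fst i = j1"
        with i have "real j1 + real n * real (snd i) = real B" "snd i \<noteq> k1"
          by (auto simp: weighted_line_def)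
        moreover from this(1) have "real n * real (snd i) = real n * real k1"
          using top(2) by linarith
        ultimately show False
          using n by simp
      qed
      then show "(case i of (j, k) \<Rightarrow> if j = j1 then c j k * snd q ^ k else 0) = 0"
        by (simp add: case_prod_unfold)
    qed
  qed (use top(2) in \<open>simp add: weighted_line_def\<close>)
  finally have t: "coeff t j1 \<noteq> 0"
    using top(1) q(2) by simp
  then have "t \<noteq> 0"
    by auto
  have "K \<le> j1" if O: "vanishes_to edge_part q K" for K
  proof -
    have "((\<lambda>x :: real. (x, 0 :: real)) \<longlongrightarrow> (0, 0)) (nhds 0)"
      using tendsto_Pair[OF filterlim_ident tendsto_const] .
    then have "filterlim (\<lambda>x :: real. (x, 0 :: real)) (nhds 0) (nhds 0)"
      by (simp add: zero_prod_def)
    from landau_o.big.compose[OF O this]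
    have "(\<lambda>x. poly t (0 + x)) \<in> O[nhds 0](\<lambda>x. \<bar>x\<bar> ^ K)"
      by (simp add: poly_t norm_Pair)
    from order_ge_of_bigo[OF \<open>t \<noteq> 0\<close> this] show ?thesis
      using order_0_le[OF t] by simp
  qed
  from vanishing_order_bigo(1)[OF smooth_on_edge_part, of q, OF this] show ?thesis
    using top(3) by linarith
qed

lemma vanishing_order_bounded:
  assumes "q \<in> sphere 0 1"
  shows "vanishing_order edge_part q \<le> degree edge_slice + B"
proof (cases "fst q = 0")
  case True
  have "d \<le> real B"
    using B n by (simp add: d field_simps)
  moreover have "q \<noteq> 0"
    using assms by auto
  ultimately show ?thesis
    using vanishing_order_on_axes[of q] True by linarith
next
  case False
  then show ?thesis
    using vanishing_order_off_axis(1)[OF False] order_degree[OF edge_slice_nonzero] by (metis trans_le_add1)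
qed

abbreviation (input) "edge_max \<equiv> max_order_on_circle edge_part"

lemma finite_orders: "finite (vanishing_order edge_part ` sphere 0 1)"
  by (rule finite_subset[of _ "{..degree edge_slice + B}"]) (use vanishing_order_bounded in auto)

lemma max_order_attained: "\<exists>q\<in>sphere 0 1. vanishing_order edge_part q = edge_max"
proof -
  have "vanishing_order edge_part ` sphere 0 1 \<noteq> {}"
    by (auto intro!: exI[of _ "(1, 0)"] simp: norm_Pair)
  then have "edge_max \<in> vanishing_order edge_part ` sphere 0 1"
    unfolding max_order_on_circle_def using finite_orders
    by (simp add: cSup_eq_Max Max_in)
  then show ?thesis
    by auto
qed

lemma vanishing_order_le_max: "q \<in> sphere 0 1 \<Longrightarrow> vanishing_order edge_part q \<le> edge_max"
  unfolding max_order_on_circle_def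
  by (rule cSUP_upper) (use finite_orders in \<open>auto intro: bdd_above_finite\<close>)

text \<open>The curve \<open>x\<^sub>2 = a x\<^sub>1\<^sup>n\<close> leaves the origin and therefore meets the unit circle.\<close>

lemma order_edge_slice_le_max: "order a edge_slice \<le> edge_max"
proof -
  define F where "F x = x\<^sup>2 + (a * x ^ n)\<^sup>2" for x :: real
  have "\<exists>x\<ge>0. x \<le> 1 \<and> F x = 1"
  proof (rule IVT')
    show "F 0 \<le> 1" "1 \<le> F 1"
      using n by (auto simp: F_def power_0_left)
  qed (auto simp: F_def intro!: continuous_intros)
  then obtain x where x: "0 \<le> x" "F x = 1"
    by blast
  have "x \<noteq> 0"
    using x(2) n by (auto simp: F_def power_0_left)
  have "(x, a * x ^ n) \<in> sphere 0 1"
    using x(2) by (simp add: norm_Pair F_def)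
  from vanishing_order_le_max[OF this] show ?thesis
    using vanishing_order_off_axis(1)[of "(x, a * x ^ n)"] \<open>x \<noteq> 0\<close> by simp
qed

text \<open>Two roots of multiplicity exceeding \<open>d\<close> would give \<open>2 n d < n degree s \<le> B = (1 + n) d\<close>, which is
  impossible for \<open>n \<ge> 1\<close>.\<close>

lemma max_root_unique:
  assumes "order a edge_slice = edge_max" "order b edge_slice = edge_max" "d < real edge_max"
  shows "a = b"
proof (rule ccontr)
  assume "a \<noteq> b"
  then have "2 * edge_max \<le> degree edge_slice"
    using order_add_order_le_degree[OF edge_slice_nonzero, of a b] assms by simp
  then have "real n * (2 * real edge_max) \<le> real n * real (degree edge_slice)"
    by (intro mult_left_mono) auto
  also have "\<dots> \<le> real B"
    by (rule degree_edge_slice_le)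
  also have "real B = d * (1 + real n)"
    using n by (simp add: d)
  also have "\<dots> < real edge_max * (1 + real n)"
    using assms(3) n by (intro mult_strict_right_mono) auto
  finally have "real edge_max * (2 * real n) < real edge_max * (1 + real n)"
    by (simp add: algebra_simps)
  then have "2 * real n < 1 + real n"
    by (simp add: mult_less_cancel_left)
  then show False
    using n_ge_1 by simp
qed

lemma slice_poly_eq: "slice_poly edge_part = edge_slice"
  unfolding slice_poly_def
proof (rule the_equality)
  show "poly edge_slice = (\<lambda>t. edge_part (1, t))"
    by (simp add: fun_eq_iff poly_weighted_slice)
  then show "q = edge_slice" if "poly q = (\<lambda>t. edge_part (1, t))" for q
    using that poly_eq_poly_eq_iff by metis
qed

lemma nontrivial_max_root_iff:
  assumes "d < real edge_max"
  shows "nontrivial_max_root edge_part a \<longleftrightarrow> order a edge_slice = edge_max"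
proof -
  have "0 < d"
    using B by (simp add: d)
  then have M0: "edge_max \<noteq> 0"
    using assms by auto
  have "a \<noteq> 0" if "order a edge_slice = edge_max"
  proof
    assume "a = 0"
    have "order 0 edge_slice \<le> k2"
      by (rule order_0_le) (use coeff_weighted_slice[OF n_ge_1 bot(2), of c] bot(1) in simp)
    with that \<open>a = 0\<close> assms bot(3) show False
      by simp
  qed
  moreover have "poly edge_slice a = 0" if "order a edge_slice = edge_max"
    using that M0 order_root by metis
  ultimately show ?thesis
    by (auto simp: nontrivial_max_root_def slice_poly_eq)
qed

lemma unique_nontrivial_max_root:
  assumes "d < real edge_max"
  shows "\<exists>!a. nontrivial_max_root edge_part a"
proof -
  obtain q where q: "q \<in> sphere 0 1" "vanishing_order edge_part q = edge_max"
    using max_order_attained by blast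
  then have "fst q \<noteq> 0"
    using vanishing_order_on_axes[of q] assms by fastforce
  then have "order (snd q / fst q ^ n) edge_slice = edge_max"
    using vanishing_order_off_axis(1) q(2) by metis
  then show ?thesis
    using max_root_unique assms nontrivial_max_root_iff[OF assms] by metis
qed

lemma max_order_points_off_axes:
  assumes "d < real edge_max" "q \<in> sphere 0 1" "vanishing_order edge_part q = edge_max"
  shows "fst q \<noteq> 0 \<and> snd q \<noteq> 0"
  using vanishing_order_on_axes[of q] assms by fastforce

lemma expansion_edge_part: "expansion edge_part (\<lambda>j k. if (j, k) \<in> weighted_line (real n) (real B) then c j k else 0)"
  using expansion_finite_sum[OF finite_weighted_line[OF n_ge_1, of "real B"], where c = c] by (simp add: weighted_part_def[abs_def])

lemma taylor_coeff_edge_part: "taylor_coeff edge_part 0 j k = (if (j, k) \<in> weighted_line (real n) (real B) then c j k else 0)"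
  using taylor_coeff_eqI[OF open_UNIV UNIV_I smooth_on_edge_part, of 0] expansion_edge_part by simp

lemma has_principal_edge_edge_part: "has_principal_edge edge_part (1 / real B) (real n / real B)"
proof (rule has_principal_edgeI)
  have supp: "(j, k) \<in> taylor_support edge_part \<longleftrightarrow> real j + real n * real k = real B \<and> c j k \<noteq> 0" for j k
    by (simp add: taylor_support_def taylor_coeff_edge_part weighted_line_def)
  then show "(j1, k1) \<in> taylor_support edge_part" "(j2, k2) \<in> taylor_support edge_part"
    and "\<And>j k. (j, k) \<in> taylor_support edge_part \<Longrightarrow> real B \<le> real j + real n * real k"
    using top(1,2) bot(1,2) by auto
qed (use n B top bot in \<open>auto simp: d field_simps\<close>)

lemma principal_part_edge_part: "principal_part edge_part = edge_part"
  unfolding principal_part_eq_weighted_part[OF has_principal_edge_edge_part B]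
  by (auto simp: fun_eq_iff weighted_part_def taylor_coeff_edge_part intro!: sum.cong)

text \<open>The shear commutes with the dilations, so the sheared polynomial is weighted homogeneous of the same
  weight, and its slice is the translate of the original slice by \<open>a\<close>, divisible by the power of \<open>x\<^sub>2\<close>
  given by the multiplicity of \<open>a\<close>.\<close>

lemma shear_distance_ge:
  assumes "order a edge_slice = edge_max"
  shows "real edge_max \<le> newton_distance (\<lambda>x. edge_part (fst x, snd x + a * fst x ^ n))"
proof -
  let ?G = "\<lambda>x :: real \<times> real. edge_part (fst x, snd x + a * fst x ^ n)"
  have "smooth_on UNIV (\<lambda>x :: real \<times> real. snd x + a * fst x ^ n)"
    by (intro smooth_on_add smooth_on_mult smooth_on_power smooth_on_const smooth_on_linear
      bounded_linear_fst bounded_linear_snd open_UNIV)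
  then have G: "smooth_germ ?G"
    using smooth_on_edge_part n by (intro smooth_germ_compose smooth_germ_fst) (auto simp: smooth_germ_def)
  let ?C = "taylor_coeff ?G 0"
  have scale: "edge_part (dilation (real n) r x) = r ^ B * edge_part x" if "r > 0" for r x
  proof -
    have "c j k * (r * fst x) ^ j * (r ^ n * snd x) ^ k = r ^ B * (c j k * fst x ^ j * snd x ^ k)"
      if "(j, k) \<in> weighted_line (real n) (real B)" for j k
    proof -
      have "real (j + n * k) = real B"
        using that by (simp add: weighted_line_def)
      then have "B = j + n * k"
        using of_nat_eq_iff by metis
      then show ?thesis
        by (simp add: power_mult_distrib power_add power_mult)
    qed
    then show ?thesis
      unfolding weighted_part_def sum_distrib_left using that
      by (intro sum.cong) (auto simp: dilation_def powr_realpow)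
  qed
  have "((\<lambda>r. r powr (- real B) * ?G (dilation (real n) r x)) \<longlongrightarrow> ?G x) (at_right 0)" for x
  proof (rule tendsto_eventually)
    show "\<forall>\<^sub>F r in at_right 0. r powr (- real B) * ?G (dilation (real n) r x) = ?G x"
      using eventually_at_right_0_less_1
    proof eventually_elim
      case (elim r)
      have "(fst (dilation (real n) r x), snd (dilation (real n) r x) + a * fst (dilation (real n) r x) ^ n)
          = dilation (real n) r (fst x, snd x + a * fst x ^ n)"
        using elim by (simp add: dilation_def powr_realpow power_mult_distrib algebra_simps)
      then have "?G (dilation (real n) r x) = r ^ B * ?G x"
        using scale elim by simp
      moreover have "r powr (- real B) * r ^ B = 1"
        using elim by (simp add: powr_minus powr_realpow)
      ultimately show ?case
        by (simp add: mult.assoc[symmetric])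
    qed
  qed
  note G_part = weighted_limit_converse(2)[OF smooth_germ_expansion[OF G] n_ge_1 this]
  have "expansion (weighted_part (real n) (real B) ?C) (\<lambda>j k. if (j, k) \<in> weighted_line (real n) (real B) then ?C j k else 0)"
    using expansion_finite_sum[OF finite_weighted_line[OF n_ge_1, of "real B"], where c = ?C] by (simp add: weighted_part_def[abs_def])
  moreover have "weighted_part (real n) (real B) ?C = ?G"
    by (rule ext) (rule G_part)
  ultimately have "expansion ?G (\<lambda>j k. if (j, k) \<in> weighted_line (real n) (real B) then ?C j k else 0)"
    by (simp only:)
  then have C_line: "?C = (\<lambda>j k. if (j, k) \<in> weighted_line (real n) (real B) then ?C j k else 0)"
    by (rule expansion_unique[OF smooth_germ_expansion[OF G]])
  let ?t = "weighted_slice (real n) (real B) ?C"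
  obtain w where w: "edge_slice = [:- a, 1:] ^ edge_max * w"
    using order_decomp[OF edge_slice_nonzero, of a] assms by auto
  have "poly ?t x = poly (monom 1 edge_max * pcompose w [:a, 1:]) x" for x
  proof -
    have "poly ?t x = poly edge_slice (a + x)"
      by (simp add: poly_weighted_slice G_part add.commute)
    also have "\<dots> = x ^ edge_max * poly w (a + x)"
      by (simp add: w)
    finally show ?thesis
      by (simp add: poly_monom poly_pcompose)
  qed
  then have t: "?t = monom 1 edge_max * pcompose w [:a, 1:]"
    using poly_eq_poly_eq_iff by blast
  have "finite_type ?G"
  proof (rule ccontr)
    assume "\<not> finite_type ?G"
    then have "weighted_part (real n) (real B) ?C x = 0" for x
      by (simp add: finite_type_def taylor_support_def weighted_part_def case_prod_unfold)
    then have "poly edge_slice x = 0" for x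
      using G_part[of "(1, x - a)"] by (simp add: poly_weighted_slice)
    then show False
      using edge_slice_nonzero poly_all_0_iff_0 by blast
  qed
  then show ?thesis
  proof (rule newton_distance_ge[of _ 0 1])
    fix j k assume "(j, k) \<in> taylor_support ?G"
    then have jk: "?C j k \<noteq> 0"
      by (simp add: taylor_support_def)
    then have "(j, k) \<in> weighted_line (real n) (real B)"
      using fun_cong[OF fun_cong[OF C_line], of j k] by presburger
    then have "coeff ?t k \<noteq> 0"
      using coeff_weighted_slice[OF n_ge_1, of j k "real B" ?C] jk by (simp add: weighted_line_def)
    then show "real edge_max * (0 + 1) \<le> 0 * real j + 1 * real k"
      unfolding t by (auto simp: coeff_monom_mult split: if_splits)
  qed auto
qed

end

lemma principal_edge_data:
  assumes E: "has_principal_edge g \<kappa> (real n * \<kappa>)"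
  obtains B j1 k1 j2 k2 where "B > 0" "\<kappa> = 1 / real B"
    "taylor_coeff g 0 j1 k1 \<noteq> 0" "real j1 + real n * real k1 = real B" "real j1 < real B / (1 + real n)"
    "taylor_coeff g 0 j2 k2 \<noteq> 0" "real j2 + real n * real k2 = real B" "real k2 < real B / (1 + real n)"
    "newton_distance g = real B / (1 + real n)"
    "principal_part g = weighted_part (real n) (real B) (taylor_coeff g 0)"
proof -
  obtain j1 k1 j2 k2 where jk: "(j1, k1) \<in> taylor_support g" "\<kappa> * real j1 + real n * \<kappa> * real k1 = 1"
    "real j1 < 1 / (\<kappa> + real n * \<kappa>)"
    "(j2, k2) \<in> taylor_support g" "\<kappa> * real j2 + real n * \<kappa> * real k2 = 1" "real k2 < 1 / (\<kappa> + real n * \<kappa>)"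
    using has_principal_edge_endpoints[OF E] by metis
  define B where "B = j1 + n * k1"
  have "0 < \<kappa>"
    using E by (simp add: has_principal_edge_def)
  have \<kappa>B: "\<kappa> * real B = 1"
    using jk(2) by (simp add: B_def algebra_simps)
  then have B: "B > 0"
    by (cases B) auto
  have \<kappa>: "\<kappa> = 1 / real B"
    using \<kappa>B B by (simp add: field_simps)
  have "\<kappa> * (real j2 + real n * real k2) = \<kappa> * real B"
    using jk(5) \<kappa>B by (simp add: algebra_simps)
  then have 2: "real j2 + real n * real k2 = real B"
    using \<open>0 < \<kappa>\<close> by simp
  have d: "1 / (\<kappa> + real n * \<kappa>) = real B / (1 + real n)"
    unfolding \<kappa> by (simp add: add_divide_distrib[symmetric])
  have E': "has_principal_edge g (1 / real B) (real n / real B)"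
    using E by (simp add: \<kappa>)
  show ?thesis
    by (rule that[OF B \<kappa>, of j1 k1 j2 k2])
      (use jk 2 d has_principal_edge_geometry(1)[OF E] principal_part_eq_weighted_part[OF E' B] in
        \<open>auto simp: taylor_support_def B_def\<close>)
qed

text \<open>The facts about \<^const>\<open>weighted_part\<close> collected for the principal part of a function.\<close>

lemma principal_part_root_structure:
  assumes E: "has_principal_edge g \<kappa> (real n * \<kappa>)" and n: "n \<ge> 1"
  shows "smooth_on UNIV (principal_part g)" and "has_principal_edge (principal_part g) \<kappa> (real n * \<kappa>)"
    and "principal_part (principal_part g) = principal_part g"
    and "fst q \<noteq> 0 \<Longrightarrow> vanishes_to (principal_part g) q K \<Longrightarrow>
      K \<le> max_order_on_circle (principal_part g)"
    and "newton_distance g < real (max_order_on_circle (principal_part g)) \<Longrightarrow> condition_c g"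
    and "newton_distance g < real (max_order_on_circle (principal_part g)) \<Longrightarrow>
      \<exists>!a. nontrivial_max_root (principal_part g) a"
    and "newton_distance g < real (max_order_on_circle (principal_part g)) \<Longrightarrow>
      nontrivial_max_root (principal_part g) a \<Longrightarrow>
      real (max_order_on_circle (principal_part g)) \<le>
        newton_distance (\<lambda>x. principal_part g (fst x, snd x + a * fst x ^ n))"
proof -
  obtain B j1 k1 j2 k2 where B: "B > 0" and \<kappa>: "\<kappa> = 1 / real B"
    and top: "taylor_coeff g 0 j1 k1 \<noteq> 0" "real j1 + real n * real k1 = real B" "real j1 < real B / (1 + real n)"
    and bot: "taylor_coeff g 0 j2 k2 \<noteq> 0" "real j2 + real n * real k2 = real B" "real k2 < real B / (1 + real n)"
    and nd: "newton_distance g = real B / (1 + real n)"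
    and P: "principal_part g = weighted_part (real n) (real B) (taylor_coeff g 0)"
    using principal_edge_data[OF E] by metis
  note ctx = n B refl top bot
  let ?M = "max_order_on_circle (principal_part g)"
  show "smooth_on UNIV (principal_part g)"
    unfolding P by (rule smooth_on_edge_part[OF ctx])
  show "has_principal_edge (principal_part g) \<kappa> (real n * \<kappa>)"
    using has_principal_edge_edge_part[OF ctx] by (simp add: P \<kappa>)
  show "principal_part (principal_part g) = principal_part g"
    unfolding P by (rule principal_part_edge_part[OF ctx])
  show "K \<le> ?M" if "fst q \<noteq> 0" "vanishes_to (principal_part g) q K"
    using vanishing_order_off_axis(2)[OF ctx that[unfolded P]] order_edge_slice_le_max[OF ctx, of "snd q / fst q ^ n"]
    by (simp add: P)
  assume M: "newton_distance g < real ?M"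
  then have M': "real B / (1 + real n) < real (max_order_on_circle (weighted_part (real n) (real B) (taylor_coeff g 0)))"
    by (simp add: nd P)
  show "condition_c g"
    unfolding condition_c_def using max_order_points_off_axes[OF ctx M'] M by (simp add: P)
  show "\<exists>!a. nontrivial_max_root (principal_part g) a"
    unfolding P by (rule unique_nontrivial_max_root[OF ctx M'])
  assume "nontrivial_max_root (principal_part g) a"
  then have "order a (weighted_slice (real n) (real B) (taylor_coeff g 0))
      = max_order_on_circle (weighted_part (real n) (real B) (taylor_coeff g 0))"
    unfolding P nontrivial_max_root_iff[OF ctx M'] .
  then show "real ?M \<le> newton_distance (\<lambda>x. principal_part g (fst x, snd x + a * fst x ^ n))"
    unfolding P by (rule shear_distance_ge[OF ctx])
qed

section \<open>Normalizations\<close>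

lemma has_principal_edge_ratio:
  assumes "has_principal_edge f \<kappa> (real n * \<kappa>)" "has_principal_edge f \<mu>1 \<mu>2"
  shows "\<mu>1 = \<kappa> \<and> \<mu>2 = real n * \<kappa>"
  using has_principal_edge_geometry(4)[OF assms(1)] has_principal_edge_geometry(4)[OF assms(2)] by blast

lemma principal_part_swap:
  assumes f: "smooth_germ f" and E: "has_principal_edge f \<kappa>1 \<kappa>2"
  shows "principal_part (f \<circ> prod.swap) = principal_part f \<circ> prod.swap"
proof
  fix x
  have "principal_part (f \<circ> prod.swap) x
      = (\<Sum>(j, k)\<in>{(j, k). \<kappa>2 * real j + \<kappa>1 * real k = 1}. taylor_coeff f 0 k j * fst x ^ j * snd x ^ k)"
    using has_principal_edge_principal_part(2)[OF has_principal_edge_swap[OF f E]] by (simp add: taylor_coeff_swap[OF f])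
  also have "\<dots> = (\<Sum>(j, k)\<in>{(j, k). \<kappa>1 * real j + \<kappa>2 * real k = 1}. taylor_coeff f 0 j k * snd x ^ j * fst x ^ k)"
    by (rule sum.reindex_bij_witness[of _ prod.swap prod.swap]) (auto simp: add.commute)
  also have "\<dots> = (principal_part f \<circ> prod.swap) x"
    using has_principal_edge_principal_part(2)[OF E] by simp
  finally show "principal_part (f \<circ> prod.swap) x = (principal_part f \<circ> prod.swap) x" .
qed

lemma swap_swap: "f \<circ> prod.swap \<circ> prod.swap = f"
  by (simp add: comp_assoc)

lemma bigo_swap:
  assumes "vanishes_to P q K"
  shows "vanishes_to (P \<circ> prod.swap) (prod.swap q) K"
proof -
  have "(P \<circ> prod.swap) (prod.swap q + h) = P (q + prod.swap h)" for h
    by (cases q; cases h) simp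
  then show ?thesis
    using landau_o.big.compose[OF assms filterlim_swap] by (simp add: norm_swap)
qed

lemma has_root_above_swap:
  assumes f: "smooth_germ f" and root: "has_root_above f 1 D"
  shows "has_root_above (f \<circ> prod.swap) 1 D"
proof -
  obtain \<kappa> q K where E: "has_principal_edge f \<kappa> (real 1 * \<kappa>)" and q: "fst q \<noteq> 0" "snd q \<noteq> 0"
    and K: "D < real K" "real K \<le> 2 * newton_distance f"
    and O: "vanishes_to (principal_part f) q K"
    using root unfolding has_root_above_def by blast
  have "has_principal_edge (f \<circ> prod.swap) \<kappa> (real 1 * \<kappa>)"
    using has_principal_edge_swap[OF f E] by simp
  moreover have "newton_distance (f \<circ> prod.swap) = newton_distance f"
    using newton_distance_swap[OF f has_principal_edge_imp_finite_type[OF E]] .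
  ultimately show ?thesis
    unfolding has_root_above_def
    using q K bigo_swap[OF O] principal_part_swap[OF f E]
    by (intro exI[of _ \<kappa>] exI[of _ "prod.swap q"] exI[of _ K]) simp
qed

lemma normalization_has_principal_edge:
  assumes f: "smooth_germ f" and E: "has_principal_edge f \<kappa>1 \<kappa>2" and g: "normalization f g \<mu>1 \<mu>2"
  shows "has_principal_edge g \<mu>1 \<mu>2"
  using g has_principal_edge_geometry(4)[OF E] has_principal_edge_geometry(4)[OF has_principal_edge_swap[OF f E]]
    E has_principal_edge_swap[OF f E] by (auto simp: normalization_def)

text \<open>If \<open>g\<close> and \<open>h\<close> differ by the interchange of the coordinates, then \<open>\<kappa>\<^sub>1 \<le> \<kappa>\<^sub>2\<close> for both of them forces
  \<open>n = 1\<close>, where the situation is symmetric.\<close>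

lemma normalization_has_root_above:
  assumes f: "smooth_germ f" and h: "h = f \<or> h = f \<circ> prod.swap" and n: "n \<ge> 1" and root: "has_root_above h n D"
    and g: "normalization f g \<mu>1 \<mu>2"
  shows "has_principal_edge g \<mu>1 \<mu>2 \<and> \<mu>2 = real n * \<mu>1 \<and> has_root_above g n D"
proof -
  obtain \<kappa> where E: "has_principal_edge h \<kappa> (real n * \<kappa>)"
    using root unfolding has_root_above_def by blast
  have h': "smooth_germ h"
    using f h smooth_germ_swap by auto
  have "normalization h g \<mu>1 \<mu>2"
    using g h swap_swap[of f] by (auto simp: normalization_def)
  from normalization_has_principal_edge[OF h' E this] have Eg: "has_principal_edge g \<mu>1 \<mu>2" .
  have le: "\<mu>1 \<le> \<mu>2"
    using g by (simp add: normalization_def)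
  consider "g = h" | "g = h \<circ> prod.swap"
    using g h swap_swap[of f] by (auto simp: normalization_def)
  then show ?thesis
  proof cases
    case 1
    then show ?thesis
      using has_principal_edge_ratio[OF E] Eg root by auto
  next
    case 2
    have "has_principal_edge h \<mu>2 \<mu>1"
      using has_principal_edge_swap[OF smooth_germ_swap[OF h'], of \<mu>1 \<mu>2] Eg 2 swap_swap[of h] by simp
    from has_principal_edge_ratio[OF E this] have \<mu>: "\<mu>2 = \<kappa>" "\<mu>1 = real n * \<kappa>"
      by auto
    have "0 < \<kappa>"
      using E by (simp add: has_principal_edge_def)
    then have "real n \<le> 1"
      using le unfolding \<mu> by simp
    then have "n = 1"
      using n by simp
    then show ?thesis
      using has_root_above_swap[OF h'] root 2 Eg \<mu> by simp
  qed
qed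

section \<open>Local coordinate systems and the height\<close>

lemma coordinate_system_germs:
  assumes "coordinate_system r \<phi>"
  shows "smooth_germ (\<lambda>x. fst (\<phi> x))" "smooth_germ (\<lambda>x. snd (\<phi> x))"
    "fst (\<phi> 0) = 0" "snd (\<phi> 0) = 0"
    "taylor_coeff (\<lambda>x. fst (\<phi> x)) 0 1 0 * taylor_coeff (\<lambda>x. snd (\<phi> x)) 0 0 1
      - taylor_coeff (\<lambda>x. fst (\<phi> x)) 0 0 1 * taylor_coeff (\<lambda>x. snd (\<phi> x)) 0 1 0 \<noteq> 0"
proof -
  have \<phi>0: "\<phi> 0 = 0"
    using assms by (simp add: coordinate_system_def)
  obtain U V \<psi> where UV: "open U" "open V" "0 \<in> U" "homeomorphism U V \<phi> \<psi>" "regular_on r U \<phi>" "regular_on r V \<psi>"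
    using assms unfolding coordinate_system_def by blast
  have "0 \<in> V"
    using UV(3,4) \<phi>0 by (force simp: homeomorphism_def)
  let ?u = "\<lambda>x. fst (\<phi> x)" and ?v = "\<lambda>x. snd (\<phi> x)"
  have u: "smooth_on U ?u" and v: "smooth_on U ?v"
    using regular_on_imp_smooth_component[OF UV(1,5)] bounded_linear_fst bounded_linear_snd by auto
  then show "smooth_germ ?u" "smooth_germ ?v"
    using UV by (auto simp: smooth_germ_def)
  show "fst (\<phi> 0) = 0" "snd (\<phi> 0) = 0"
    using \<phi>0 by auto
  let ?A = "\<lambda>h. (frechet_derivative ?u (at 0) h, frechet_derivative ?v (at 0) h)"
  have A: "(\<phi> has_derivative ?A) (at 0)"
    using has_derivative_Pair[OF smooth_on_has_derivative[OF u UV(3)] smooth_on_has_derivative[OF v UV(3)]] by simp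
  have w: "smooth_on V (\<lambda>x. fst (\<psi> x))" "smooth_on V (\<lambda>x. snd (\<psi> x))"
    using regular_on_imp_smooth_component[OF UV(2,6)] bounded_linear_fst bounded_linear_snd by auto
  obtain B where B: "(\<psi> has_derivative B) (at 0)"
    using has_derivative_Pair[OF smooth_on_has_derivative[OF w(1) \<open>0 \<in> V\<close>] smooth_on_has_derivative[OF w(2) \<open>0 \<in> V\<close>]] by auto
  then have B': "(\<psi> has_derivative B) (at (\<phi> 0))"
    by (simp add: \<phi>0)
  have "((\<lambda>x. \<psi> (\<phi> x)) has_derivative (\<lambda>h. B (?A h))) (at 0)"
    by (rule has_derivative_compose[OF A B'])
  then have "((\<lambda>x. x) has_derivative (\<lambda>h. B (?A h))) (at 0)"
    by (rule has_derivative_transform_within_open[OF _ UV(1,3)]) (use UV(4) in \<open>auto simp: homeomorphism_def\<close>)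
  then have "(\<lambda>h. B (?A h)) = (\<lambda>h. h)"
    by (rule has_derivative_unique) simp
  then have BA: "B (?A h) = h" for h
    by metis
  have B0: "B 0 = 0"
    using B has_derivative_linear linear_0 by blast
  have inj: "h = 0" if "?A h = 0" for h
    using BA[of h] B0 that by simp
  define \<alpha> \<beta> \<gamma> \<delta> where "\<alpha> = taylor_coeff ?u 0 1 0" and "\<beta> = taylor_coeff ?u 0 0 1"
    and "\<gamma> = taylor_coeff ?v 0 1 0" and "\<delta> = taylor_coeff ?v 0 0 1"
  have D: "frechet_derivative ?u (at 0) (1, 0) = \<alpha>" "frechet_derivative ?u (at 0) (0, 1) = \<beta>"
    "frechet_derivative ?v (at 0) (1, 0) = \<gamma>" "frechet_derivative ?v (at 0) (0, 1) = \<delta>"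
    by (simp_all add: \<alpha>_def \<beta>_def \<gamma>_def \<delta>_def taylor_coeff_def partial_deriv_def)
  have A_eq: "?A (x, y) = (x * \<alpha> + y * \<beta>, x * \<gamma> + y * \<delta>)" for x y
  proof -
    have lin: "linear ?A"
      using A has_derivative_linear by blast
    have "?A (x *\<^sub>R (1, 0) + y *\<^sub>R (0, 1)) = x *\<^sub>R ?A (1, 0) + y *\<^sub>R ?A (0, 1)"
      using linear_add[OF lin, of "x *\<^sub>R (1, 0)" "y *\<^sub>R (0, 1)"]
        linear_cmul[OF lin, of x "(1, 0)"] linear_cmul[OF lin, of y "(0, 1)"] by (simp only:)
    then show ?thesis
      by (simp add: D)
  qed
  show "\<alpha> * \<delta> - \<beta> * \<gamma> \<noteq> 0"
  proof
    assume det: "\<alpha> * \<delta> - \<beta> * \<gamma> = 0"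
    have "?A (\<delta>, - \<gamma>) = 0"
      unfolding A_eq using det by (simp add: zero_prod_def algebra_simps)
    then have 1: "\<delta> = 0" "\<gamma> = 0"
      using inj[of "(\<delta>, - \<gamma>)"] by (auto simp: zero_prod_def)
    have "?A (\<beta>, - \<alpha>) = 0"
      unfolding A_eq using det by (simp add: zero_prod_def algebra_simps)
    then have 2: "\<alpha> = 0" "\<beta> = 0"
      using inj[of "(\<beta>, - \<alpha>)"] by (auto simp: zero_prod_def)
    have "?A (1, 0) = 0"
      unfolding A_eq using 1 2 by (simp add: zero_prod_def)
    then show False
      using inj[of "(1, 0)"] by (simp add: zero_prod_def)
  qed
qed

lemma coordinate_system_root_above:
  assumes f: "smooth_germ f" "finite_type f" and \<phi>: "coordinate_system r \<phi>"
    and D: "newton_distance f \<le> D" "D < newton_distance (f \<circ> \<phi>)"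
  shows "\<exists>h n. (h = f \<or> h = f \<circ> prod.swap) \<and> n \<ge> 1 \<and> has_root_above h n D"
proof -
  have "(\<lambda>x. f (fst (\<phi> x), snd (\<phi> x))) = f \<circ> \<phi>"
    by (simp add: fun_eq_iff)
  then show ?thesis
    using larger_distance_has_root_above[OF f coordinate_system_germs(1,3,2,4,5)[OF \<phi>] D(1)] D(2) by simp
qed

lemma coordinate_distance_le:
  assumes f: "smooth_germ f" "finite_type f" and \<phi>: "coordinate_system r \<phi>"
  shows "newton_distance (f \<circ> \<phi>) \<le> 2 * newton_distance f"
proof (rule ccontr)
  assume "\<not> ?thesis"
  then have D: "newton_distance f \<le> 2 * newton_distance f" "2 * newton_distance f < newton_distance (f \<circ> \<phi>)"
    using newton_distance_nonneg[OF f(2)] by auto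
  obtain h n where h: "h = f \<or> h = f \<circ> prod.swap" "has_root_above h n (2 * newton_distance f)"
    using coordinate_system_root_above[OF f \<phi> D] by blast
  moreover have "newton_distance h = newton_distance f"
    using h(1) newton_distance_swap[OF f] by auto
  ultimately show False
    unfolding has_root_above_def by auto
qed

lemma coordinate_distance_le_height:
  assumes "smooth_germ f" "finite_type f" "coordinate_system r \<phi>"
  shows "newton_distance (f \<circ> \<phi>) \<le> height r f"
  unfolding height_def
  by (rule cSUP_upper) (use assms coordinate_distance_le[OF assms(1,2)] in \<open>auto intro!: bdd_aboveI\<close>)

lemma shear_coordinate_system:
  assumes "m \<ge> 1"
  shows "coordinate_system r (\<lambda>(y1, y2). (y1, y2 + a * y1 ^ m))"
    and "coordinate_system r (\<lambda>(y1, y2). (y2 + a * y1 ^ m, y1))"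
proof -
  have lin: "bounded_linear (\<lambda>t. (0 :: real, b * t))" "bounded_linear (\<lambda>t. (b * t, 0 :: real))" for b :: real
    by (intro bounded_linear_intros)+
  have swap: "bounded_linear (prod.swap :: real \<times> real \<Rightarrow> real \<times> real)"
    unfolding prod.swap_def by (intro bounded_linear_intros)
  have 1: "regular_on r UNIV (\<lambda>x. x + (0, b * fst x ^ m))" for b
    by (intro regular_on_add regular_on_linear bounded_linear_ident open_UNIV
        regular_on_bounded_linear[OF open_UNIV lin(1)] regular_on_coordinate_power)
  have 2: "regular_on r UNIV (\<lambda>x. prod.swap x + (a * fst x ^ m, 0))"
    by (intro regular_on_add regular_on_linear swap open_UNIV
        regular_on_bounded_linear[OF open_UNIV lin(2)] regular_on_coordinate_power)
  have 3: "regular_on r UNIV (\<lambda>x. prod.swap x + (0, (- a) * snd x ^ m))"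
    by (intro regular_on_add regular_on_linear swap open_UNIV
        regular_on_bounded_linear[OF open_UNIV lin(1)] regular_on_coordinate_power)
  have e1: "(\<lambda>x :: real \<times> real. x + (0, b * fst x ^ m)) = (\<lambda>(y1, y2). (y1, y2 + b * y1 ^ m))" for b
    by (auto simp: fun_eq_iff)
  have e2: "(\<lambda>x. prod.swap x + (a * fst x ^ m, 0)) = (\<lambda>(y1, y2). (y2 + a * y1 ^ m, y1))"
    by (auto simp: fun_eq_iff)
  have e3: "(\<lambda>x. prod.swap x + (0, (- a) * snd x ^ m)) = (\<lambda>(x1, x2). (x2, x1 + (- a) * x2 ^ m))"
    by (auto simp: fun_eq_iff)
  show "coordinate_system r (\<lambda>(y1, y2). (y1, y2 + a * y1 ^ m))"
    unfolding coordinate_system_def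
  proof (intro conjI exI)
    show "homeomorphism UNIV UNIV (\<lambda>(y1, y2). (y1, y2 + a * y1 ^ m)) (\<lambda>(y1, y2). (y1, y2 + (- a) * y1 ^ m))"
      by (rule homeomorphismI) (auto simp: case_prod_unfold intro!: continuous_intros)
    show "regular_on r UNIV (\<lambda>(y1, y2). (y1, y2 + a * y1 ^ m))"
      "regular_on r UNIV (\<lambda>(y1, y2). (y1, y2 + (- a) * y1 ^ m))"
      using 1[of a] 1[of "- a"] unfolding e1 by auto
  qed (use assms in \<open>auto simp: zero_prod_def\<close>)
  show "coordinate_system r (\<lambda>(y1, y2). (y2 + a * y1 ^ m, y1))"
    unfolding coordinate_system_def
  proof (intro conjI exI)
    show "homeomorphism UNIV UNIV (\<lambda>(y1, y2). (y2 + a * y1 ^ m, y1)) (\<lambda>(x1, x2). (x2, x1 + (- a) * x2 ^ m))"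
      by (rule homeomorphismI) (auto simp: case_prod_unfold intro!: continuous_intros)
    show "regular_on r UNIV (\<lambda>(y1, y2). (y2 + a * y1 ^ m, y1))"
      using 2 unfolding e2 .
    show "regular_on r UNIV (\<lambda>(x1, x2). (x2, x1 + (- a) * x2 ^ m))"
      using 3 unfolding e3 .
  qed (use assms in \<open>auto simp: zero_prod_def\<close>)
qed

lemma not_adapted_obtains:
  assumes "\<not> adapted r f"
  obtains \<phi> where "coordinate_system r \<phi>" "newton_distance f < newton_distance (f \<circ> \<phi>)"
proof -
  have id: "coordinate_system r (\<lambda>x. x)"
    using shear_coordinate_system(1)[of 1 r 0] by (simp add: case_prod_unfold)
  have "\<exists>\<phi>. coordinate_system r \<phi> \<and> newton_distance f < newton_distance (f \<circ> \<phi>)"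
  proof (rule ccontr)
    assume no: "\<not> ?thesis"
    have "height r f = newton_distance f"
      unfolding height_def
    proof (rule cSup_eq_maximum)
      show "newton_distance f \<in> (\<lambda>\<phi>. newton_distance (f \<circ> \<phi>)) ` {\<phi>. coordinate_system r \<phi>}"
        using id by (intro image_eqI[of _ _ "\<lambda>x. x"]) (auto simp: o_def)
      show "x \<le> newton_distance f" if "x \<in> (\<lambda>\<phi>. newton_distance (f \<circ> \<phi>)) ` {\<phi>. coordinate_system r \<phi>}" for x
        using that no by (auto simp: not_less)
    qed
    with assms show False
      by (simp add: adapted_def)
  qed
  then show ?thesis
    using that by blast
qed

text \<open>A coordinate system of distance larger than \<open>m(f\<^sub>p)\<close> would reveal a root of \<open>f\<^sub>p\<close> of order larger than
  \<open>m(f\<^sub>p)\<close>, because \<open>f\<^sub>p\<close> is its own principal part.\<close>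

lemma principal_part_distance_le_max_order:
  assumes E: "has_principal_edge g \<kappa> (real n * \<kappa>)" and n: "n \<ge> 1"
    and M: "newton_distance g < real (max_order_on_circle (principal_part g))" and \<phi>: "coordinate_system r \<phi>"
  shows "newton_distance (principal_part g \<circ> \<phi>) \<le> real (max_order_on_circle (principal_part g))"
proof (rule ccontr)
  let ?P = "principal_part g"
  assume "\<not> ?thesis"
  then have less: "real (max_order_on_circle ?P) < newton_distance (?P \<circ> \<phi>)"
    by simp
  note P = principal_part_root_structure[OF E n]
  have germ: "smooth_germ ?P"
    using P(1) by (auto simp: smooth_germ_def)
  have nd: "newton_distance ?P = newton_distance g"
    using has_principal_edge_geometry(1)[OF E] has_principal_edge_geometry(1)[OF P(2)] by simp
  obtain h n' where h: "h = ?P \<or> h = ?P \<circ> prod.swap" "n' \<ge> 1" "has_root_above h n' (max_order_on_circle ?P)"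
    using coordinate_system_root_above[OF germ has_principal_edge_imp_finite_type[OF P(2)] \<phi> _ less] M nd by auto
  have "0 < \<kappa>"
    using E by (simp add: has_principal_edge_def)
  then have "\<kappa> \<le> real n * \<kappa>"
    using n by simp
  then have "normalization ?P ?P \<kappa> (real n * \<kappa>)"
    using has_principal_edge_geometry(4)[OF P(2)] by (simp add: normalization_def)
  from normalization_has_root_above[OF germ h this]
  have "has_root_above ?P n' (max_order_on_circle ?P)"
    by blast
  then obtain q K where "fst q \<noteq> 0" "real (max_order_on_circle ?P) < real K"
    "vanishes_to (principal_part ?P) q K"
    unfolding has_root_above_def by blast
  then show False
    using P(4)[of q K] unfolding P(3) by simp
qed

lemma principal_part_adapted_coordinates:
  assumes E: "has_principal_edge g \<kappa> (real n * \<kappa>)" and n: "n \<ge> 1"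
    and M: "newton_distance g < real (max_order_on_circle (principal_part g))"
    and a: "nontrivial_max_root (principal_part g) a"
  shows "height r (principal_part g) = real (max_order_on_circle (principal_part g))"
    and "adapted_system r (\<lambda>(y1, y2). (y1, y2 + a * y1 ^ n)) (principal_part g)"
proof -
  let ?P = "principal_part g" and ?\<phi> = "\<lambda>(y1, y2). (y1, y2 + a * y1 ^ n)"
  have \<phi>: "coordinate_system r ?\<phi>"
    by (rule shear_coordinate_system(1)[OF n])
  have "?P \<circ> ?\<phi> = (\<lambda>x. ?P (fst x, snd x + a * fst x ^ n))"
    by (simp add: fun_eq_iff)
  then have eq: "newton_distance (?P \<circ> ?\<phi>) = real (max_order_on_circle ?P)"
    using principal_part_root_structure(7)[OF E n M a] principal_part_distance_le_max_order[OF E n M \<phi>]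
    by (intro antisym) auto
  show h: "height r ?P = real (max_order_on_circle ?P)"
    unfolding height_def
  proof (rule cSup_eq_maximum)
    show "real (max_order_on_circle ?P) \<in> (\<lambda>\<phi>. newton_distance (?P \<circ> \<phi>)) ` {\<phi>. coordinate_system r \<phi>}"
      using \<phi> eq by (intro image_eqI[of _ _ ?\<phi>]) auto
    show "x \<le> real (max_order_on_circle ?P)"
      if "x \<in> (\<lambda>\<phi>. newton_distance (?P \<circ> \<phi>)) ` {\<phi>. coordinate_system r \<phi>}" for x
      using that principal_part_distance_le_max_order[OF E n M] by auto
  qed
  show "adapted_system r ?\<phi> ?P"
    using \<phi> eq h by (simp add: adapted_system_def)
qed

section \<open>The characterization of non-adapted coordinates\<close>

theorem theorem3p3:
  fixes r :: regularity and f :: "real \<times> real \<Rightarrow> real"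
  assumes "\<exists>U. open U \<and> 0 \<in> U \<and> regular_on r U f"
    and "finite_type f"
    and "f 0 = 0"
    and "(f has_derivative (\<lambda>_. 0)) (at 0)"
  shows
    "(\<not> adapted r f \<longrightarrow>
        condition_a f \<and>
        (\<exists>!\<kappa>. principal_line f (fst \<kappa>) (snd \<kappa>)) \<and>
        (\<exists>g \<kappa>1 \<kappa>2. normalization f g \<kappa>1 \<kappa>2) \<and>
        (\<forall>g \<kappa>1 \<kappa>2. normalization f g \<kappa>1 \<kappa>2 \<longrightarrow>
           condition_b \<kappa>1 \<kappa>2 \<and>
           condition_c g \<and>
           (\<exists>!a. nontrivial_max_root (principal_part g) a) \<and>
           (\<forall>a m. nontrivial_max_root (principal_part g) a \<and> real m = \<kappa>2 / \<kappa>1 \<longrightarrow>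
              adapted_system r (\<lambda>(y1, y2). (y1, y2 + a * y1 ^ m)) (principal_part g)) \<and>
           height r (principal_part g) = real (max_order_on_circle (principal_part g))))
     \<and>
     (\<forall>g \<kappa>1 \<kappa>2.
        condition_a f \<and> normalization f g \<kappa>1 \<kappa>2 \<and> condition_b \<kappa>1 \<kappa>2 \<and> condition_c g \<longrightarrow>
        \<not> adapted r (principal_part f))"
proof -
  have f: "smooth_germ f"
    using assms(1) regular_on_imp_smooth_component[OF _ _ bounded_linear_ident, of _ r f]
    by (auto simp: smooth_germ_def)
  show ?thesis
  proof (intro conjI impI allI)
    assume "\<not> adapted r f"
    then obtain \<phi> where \<phi>: "coordinate_system r \<phi>" "newton_distance f < newton_distance (f \<circ> \<phi>)"
      by (rule not_adapted_obtains)
    obtain h n where h: "h = f \<or> h = f \<circ> prod.swap" and n: "n \<ge> 1"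
      and root: "has_root_above h n (newton_distance f)"
      using coordinate_system_root_above[OF f assms(2) \<phi>(1) order_refl \<phi>(2)] by blast
    obtain \<kappa> where E: "has_principal_edge h \<kappa> (real n * \<kappa>)"
      using root unfolding has_root_above_def by blast
    have "\<exists>\<kappa>1 \<kappa>2. has_principal_edge f \<kappa>1 \<kappa>2"
      using E h has_principal_edge_swap[OF smooth_germ_swap[OF f]] swap_swap[of f] by metis
    then obtain \<kappa>1 \<kappa>2 where Ef: "has_principal_edge f \<kappa>1 \<kappa>2"
      by blast
    show "condition_a f"
      by (rule has_principal_edge_geometry(3)[OF Ef])
    show "\<exists>!\<kappa>. principal_line f (fst \<kappa>) (snd \<kappa>)"
      unfolding has_principal_edge_geometry(4)[OF Ef] by (rule ex1I[of _ "(\<kappa>1, \<kappa>2)"]) (auto simp: prod_eq_iff)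
    have "0 < \<kappa>"
      using E by (simp add: has_principal_edge_def)
    then have "normalization f h \<kappa> (real n * \<kappa>)"
      using h n has_principal_edge_geometry(4)[OF E] by (simp add: normalization_def)
    then show "\<exists>g \<kappa>1 \<kappa>2. normalization f g \<kappa>1 \<kappa>2"
      by blast
    fix g \<mu>1 \<mu>2 assume g: "normalization f g \<mu>1 \<mu>2"
    from normalization_has_root_above[OF f h n root g]
    have Eg: "has_principal_edge g \<mu>1 (real n * \<mu>1)" and \<mu>2: "\<mu>2 = real n * \<mu>1"
      and rootg: "has_root_above g n (newton_distance f)"
      by auto
    have "0 < \<mu>1"
      using Eg by (simp add: has_principal_edge_def)
    then have ratio: "\<mu>2 / \<mu>1 = real n"
      by (simp add: \<mu>2)
    then show "condition_b \<mu>1 \<mu>2"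
      by (simp add: condition_b_def)
    let ?P = "principal_part g"
    have nd: "newton_distance g = newton_distance f"
      using g newton_distance_swap[OF f assms(2)] by (auto simp: normalization_def)
    note P = principal_part_root_structure[OF Eg n]
    obtain q K where "fst q \<noteq> 0" "newton_distance f < real K" "vanishes_to ?P q K"
      using rootg unfolding has_root_above_def by blast
    then have M: "newton_distance g < real (max_order_on_circle ?P)"
      using P(4)[of q K] nd by simp
    show "condition_c g"
      by (rule P(5)[OF M])
    show unique: "\<exists>!a. nontrivial_max_root ?P a"
      by (rule P(6)[OF M])
    show "height r ?P = real (max_order_on_circle ?P)"
      using unique principal_part_adapted_coordinates(1)[OF Eg n M] by blast
    fix a m assume am: "nontrivial_max_root ?P a \<and> real m = \<mu>2 / \<mu>1"
    then have "m = n"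
      by (simp add: ratio)
    then show "adapted_system r (\<lambda>(y1, y2). (y1, y2 + a * y1 ^ m)) ?P"
      using principal_part_adapted_coordinates(2)[OF Eg n M] am by blast
  next
    fix g \<kappa>1 \<kappa>2
    assume "condition_a f \<and> normalization f g \<kappa>1 \<kappa>2 \<and> condition_b \<kappa>1 \<kappa>2 \<and> condition_c g"
    then have a: "condition_a f" and g: "normalization f g \<kappa>1 \<kappa>2" and b: "condition_b \<kappa>1 \<kappa>2" and c: "condition_c g"
      by auto
    obtain \<mu>1 \<mu>2 where Ef: "has_principal_edge f \<mu>1 \<mu>2"
      using condition_a_imp_has_principal_edge[OF assms(2) a] .
    have Eg: "has_principal_edge g \<kappa>1 \<kappa>2"
      by (rule normalization_has_principal_edge[OF f Ef g])
    have \<kappa>: "0 < \<kappa>1" "\<kappa>1 \<le> \<kappa>2"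
      using Eg g by (auto simp: has_principal_edge_def normalization_def)
    obtain n where "\<kappa>2 / \<kappa>1 = real n"
      using b by (auto simp: condition_b_def elim: Nats_cases)
    then have \<kappa>2: "\<kappa>2 = real n * \<kappa>1"
      using \<kappa> by (simp add: field_simps)
    have n: "n \<ge> 1"
      using \<kappa> \<kappa>2 by (cases n) auto
    have E: "has_principal_edge g \<kappa>1 (real n * \<kappa>1)"
      using Eg \<kappa>2 by simp
    let ?P = "principal_part g" and ?Q = "principal_part f"
    note P = principal_part_root_structure[OF E n]
    have M: "newton_distance g < real (max_order_on_circle ?P)"
      using c by (simp add: condition_c_def)
    obtain a where a: "nontrivial_max_root ?P a"
      using P(6)[OF M] by blast
    have germ: "smooth_germ ?P"
      using P(1) by (auto simp: smooth_germ_def)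
    have ndP: "newton_distance ?P = newton_distance g"
      using has_principal_edge_geometry(1)[OF E] has_principal_edge_geometry(1)[OF P(2)] by simp
    have ftP: "finite_type ?P"
      using P(2) by (rule has_principal_edge_imp_finite_type)
    have "\<exists>\<phi>. coordinate_system r \<phi> \<and> ?Q \<circ> \<phi> = (\<lambda>x. ?P (fst x, snd x + a * fst x ^ n))
        \<and> smooth_germ ?Q \<and> finite_type ?Q \<and> newton_distance ?Q = newton_distance g"
    proof (cases "g = f")
      case True
      show ?thesis
        unfolding True[symmetric]
        using shear_coordinate_system(1)[OF n, of r a] germ ftP ndP
        by (intro exI[of _ "\<lambda>(y1, y2). (y1, y2 + a * y1 ^ n)"]) (simp add: fun_eq_iff)
    next
      case False
      then have "f = g \<circ> prod.swap"
        using g swap_swap[of f] by (auto simp: normalization_def)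
      moreover have "smooth_germ g"
        using g f smooth_germ_swap[OF f] by (auto simp: normalization_def)
      ultimately have Q: "?Q = ?P \<circ> prod.swap"
        using principal_part_swap[OF _ E] by simp
      show ?thesis
        unfolding Q
        using shear_coordinate_system(2)[OF n, of r a] smooth_germ_swap[OF germ] finite_type_swap[OF germ ftP]
          newton_distance_swap[OF germ ftP] ndP
        by (intro exI[of _ "\<lambda>(y1, y2). (y2 + a * y1 ^ n, y1)"]) (simp add: fun_eq_iff)
    qed
    then obtain \<phi> where \<phi>: "coordinate_system r \<phi>" "?Q \<circ> \<phi> = (\<lambda>x. ?P (fst x, snd x + a * fst x ^ n))"
      and Q: "smooth_germ ?Q" "finite_type ?Q" "newton_distance ?Q = newton_distance g"
      by blast
    have "newton_distance ?Q < newton_distance (?Q \<circ> \<phi>)"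
      unfolding \<phi>(2) Q(3) using P(7)[OF M a] M by linarith
    also have "\<dots> \<le> height r ?Q"
      by (rule coordinate_distance_le_height[OF Q(1,2) \<phi>(1)])
    finally show "\<not> adapted r ?Q"
      by (simp add: adapted_def)
  qed
qed

end
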